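(* (Low-rank tensor autoregressions approximate stable linear dynamical systems.) Consider a stable linear time-invariant Gaussian dynamical system (LDS) $$\mathbf{x}_t = \mathbf{A}\mathbf{x}_{t-1} + \mathbf{b} + \boldsymbol{\epsilon}_t,\qquad \mathbf{y}_t = \mathbf{C}\mathbf{x}_t + \mathbf{d} + \boldsymbol{\delta}_t,\qquad \boldsymbol{\epsilon}_t \overset{\text{i.i.d.}}{\sim}\mathcal{N}(\mathbf{0},\mathbf{Q}),\quad \boldsymbol{\delta}_t\overset{\text{i.i.d.}}{\sim}\mathcal{N}(\mathbf{0},\mathbf{R}),$$ with latent states $\mathbf{x}_t\in\mathbb{R}^D$ and observations $\mathbf{y}_t\in\mathbb{R}^N$. Define the steady-state Kalman gain matrix as $\mathbf{K}=\lim_{t\to\infty}\mathbf{K}_t$, and $\boldsymbol{\Gamma}=\mathbf{A}(\mathbf{I}-\mathbf{K}\mathbf{C})$. The matrix $\boldsymbol{\Gamma}\in\mathbb{R}^{D\times D}$ has eigenvalues $\lambda_1,\ldots,\lambda_D$. Let $\lambda_{\mathsf{max}}=\max_d|\lambda_d|$; for a stable LDS, $\lambda_{\mathsf{max}}<1$. Let $n$ denote the number of real eigenvalues and $m$ the number of complex conjugate pairs. Let $\hat{\mathbf{y}}_t^{(\mathsf{LDS})}=\mathbb{E}[\mathbf{y}_t\mid\mathbf{y}_{<t}]$ denote the predictive mean under a steady-state LDS, and $\hat{\mathbf{y}}_t^{(\mathsf{SALT})}$ the predictive mean under a SALT model. Then an order-$L$ Tucker-SALT model with rank $n+2m$, or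 a CP-SALT model with rank $n+3m$, can approximate the predictive mean of the steady-state LDS with error $$\|\hat{\mathbf{y}}_t^{(\mathsf{LDS})}-\hat{\mathbf{y}}_t^{(\mathsf{SALT})}\|_\infty=\mathcal{O}(\lambda_{\mathsf{max}}^L).$$
   Context: LDS parameters: $\mathbf{A}\in\mathbb{R}^{D\times D}$, $\mathbf{b}\in\mathbb{R}^D$, $\mathbf{C}\in\mathbb{R}^{N\times D}$, $\mathbf{d}\in\mathbb{R}^N$; $\mathbf{Q}\in\mathbb{R}^{D\times D}$ is a positive semi-definite covariance matrix and $\mathbf{R}\in\mathbb{R}^{N\times N}$ is an invertible (positive definite) covariance matrix. Stable means that all eigenvalues of $\mathbf{A}$ have modulus strictly less than $1$. Eigenvalues of $\boldsymbol{\Gamma}$ are counted with multiplicity and "complex conjugate pairs" refers to non-real eigenvalues, so $n+2m=D$. Kalman filter: with predictive covariances $\boldsymbol{\Sigma}_{t|t-1}=\mathbf{A}\boldsymbol{\Sigma}_{t-1}\mathbf{A}^\top+\mathbf{Q}$ and filtered covariances $\boldsymbol{\Sigma}_t=(\mathbf{I}-\mathbf{K}_t\mathbf{C})\boldsymbol{\Sigma}_{t|t-1}$, the Kalman gain is $\mathbf{K}_t=(\boldsymbol{\Sigma}_{t|t-1}^{-1}+\mathbf{C}^\top\mathbf{R}^{-1}\mathbf{C})^{-1}\mathbf{C}^\top\mathbf{R}^{-1}=\boldsymbol{\Sigma}_{t|t-1}\mathbf{C}^\top(\mathbf{C}\boldsymbol{\Sigma}_{t|t-1}\mathbf{C}^\top+\mathbf{R})^{-1}$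 (the last form being used if $\boldsymbol{\Sigma}_{t|t-1}$ is singular). The filter means satisfy $\boldsymbol{\mu}_{t|t-1}=\mathbf{A}\boldsymbol{\mu}_{t-1}+\mathbf{b}$ and $\boldsymbol{\mu}_t=\boldsymbol{\mu}_{t|t-1}+\mathbf{K}_t(\mathbf{y}_t-\mathbf{C}\boldsymbol{\mu}_{t|t-1}-\mathbf{d})$, and the one-step predictive mean is $\mathbf{C}\boldsymbol{\mu}_{t|t-1}+\mathbf{d}$. For a stable LDS, $\boldsymbol{\Sigma}_{t|t-1}$ converges as $t\to\infty$ to the unique non-negative solution $\boldsymbol{\Sigma}$ of the discrete algebraic Riccati equation $\boldsymbol{\Sigma}=\mathbf{A}\boldsymbol{\Sigma}\mathbf{A}^\top-\mathbf{A}\boldsymbol{\Sigma}\mathbf{C}^\top(\mathbf{C}\boldsymbol{\Sigma}\mathbf{C}^\top+\mathbf{R})^{-1}\mathbf{C}\boldsymbol{\Sigma}\mathbf{A}^\top+\mathbf{Q}$, and hence $\mathbf{K}_t$ converges to $\mathbf{K}$. Steady-state predictive mean: the predictive mean when the gain is the constant matrix $\mathbf{K}$; it is a linear (affine) function of all past observations $\mathbf{y}_{t-l}$, $l=1,2,\ldots$: $$\hat{\mathbf{y}}_t^{(\mathsf{LDS})}=\mathbf{C}\sum_{l=1}^{\infty}\boldsymbol{\Gamma}^{l-1}\left(\mathbf{A}\mathbf{K}\mathbf{y}_{t-l}+\mathbf{b}-\mathbf{A}\mathbf{K}\mathbf{d}\right)+\mathbf{d}.$$ SALT (switching autoregressive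 low-rank tensor) model: an autoregressive hidden Markov model in which, given the current discrete state, $\mathbf{y}_t$ is Gaussian with mean an affine function of the $L$ previous observations whose autoregressive tensor has a low-rank factorization. Here, with a single discrete state (the case relevant for approximating a non-switching LDS), an order-$L$ SALT model of rank $r$ has predictive mean $$\hat{\mathbf{y}}_t^{(\mathsf{SALT})}=\mathscr{A}\times_{2,3}\mathbf{y}_{t-1:t-L}+\mathbf{b}_{\mathsf{SALT}},$$ where $\mathbf{b}_{\mathsf{SALT}}\in\mathbb{R}^N$ is a bias vector, $\mathbf{y}_{t-1:t-L}\in\mathbb{R}^{N\times L}$ is the matrix whose $l$-th column is $\mathbf{y}_{t-l}$, and $$\mathscr{A}=\sum_{i=1}^{r}\sum_{j=1}^{r}\sum_{k=1}^{r}g_{ijk}\,\mathbf{u}_{:i}\circ\mathbf{v}_{:j}\circ\mathbf{w}_{:k}\in\mathbb{R}^{N\times N\times L},$$ with $\circ$ the vector outer product, $\mathbf{u}_{:i},\mathbf{v}_{:j},\mathbf{w}_{:k}$ the columns of real factor matrices $\mathbf{U}\in\mathbb{R}^{N\times r}$, $\mathbf{V}\in\mathbb{R}^{N\times r}$, $\mathbf{W}\in\mathbb{R}^{L\times r}$, and $g_{ijk}$ the entries of a real core tensor $\mathscr{G}\in\mathbb{R}^{r\times r\times r}$. The model is called Tucker-SALT if $\mathscr{G}$ is unrestricted, and CP-SALT if $\mathscr{G}$ is diagonal ($g_{ijk}=0$ unless $i=j=k$). For a tensor $\mathscr{A}$ with entries $a_{pqs}$ and a matrix $\mathbf{X}=(x_{qs})\in\mathbb{R}^{N\times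 L}$, $\mathscr{A}\times_{2,3}\mathbf{X}\in\mathbb{R}^N$ is the vector with $p$-th entry $\sum_{q=1}^{N}\sum_{s=1}^{L}a_{pqs}x_{qs}$.
   Formalization: The rate O(λ_max^L) is proved when eigenvalues of Γ of maximal modulus have only size-1 Jordan blocks (it can fail otherwise); for every stable LDS the error is O(ρ^L) for all ρ>λ_max. O(·) is uniform over pasts bounded by B, and in mean for first moments bounded by B. *)

theory Defs
  imports
    "HOL-Probability.Probability_Measure"
    "HOL-Computational_Algebra.Fundamental_Theorem_Algebra"
begin

section \<open>Matrices\<close>

text \<open>The operations \<open>*\<close> and \<open>^\<close> of type \<open>vec\<close> act entrywise, so matrix powers need a definition.\<close>

primrec mat_pow :: "real^'d^'d \<Rightarrow> nat \<Rightarrow> real^'d^'d" where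
  "mat_pow M 0 = mat 1"
| "mat_pow M (Suc k) = M ** mat_pow M k"

definition psd :: "real^'d^'d \<Rightarrow> bool" where
  "psd M \<longleftrightarrow> transpose M = M \<and> (\<forall>v. 0 \<le> v \<bullet> (M *v v))"

definition pos_def :: "real^'d^'d \<Rightarrow> bool" where
  "pos_def M \<longleftrightarrow> transpose M = M \<and> (\<forall>v. v \<noteq> 0 \<longrightarrow> 0 < v \<bullet> (M *v v))"

definition charpoly :: "real^'d^'d \<Rightarrow> complex poly" where
  "charpoly M = det (mat [:0, 1:] - map_matrix (\<lambda>a. [:complex_of_real a:]) M)"

definition eigvals :: "real^'d^'d \<Rightarrow> complex multiset" where
  "eigvals M = proots (charpoly M)"

definition stable_matrix :: "real^'d^'d \<Rightarrow> bool" where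
  "stable_matrix M \<longleftrightarrow> (\<forall>z \<in># eigvals M. cmod z < 1)"

definition lambda_max :: "real^'d^'d \<Rightarrow> real" where
  "lambda_max M = Max (cmod ` set_mset (eigvals M))"

definition num_real_eigvals :: "real^'d^'d \<Rightarrow> nat" where
  "num_real_eigvals M = size (filter_mset (\<lambda>z. Im z = 0) (eigvals M))"

text \<open>Each conjugate pair of non-real eigenvalues has exactly one member in the upper half plane.\<close>

definition num_conj_pairs :: "real^'d^'d \<Rightarrow> nat" where
  "num_conj_pairs M = size (filter_mset (\<lambda>z. Im z > 0) (eigvals M))"

text \<open>No Jordan block of an eigenvalue of maximal modulus has size larger than one.
  Every matrix that is diagonalizable over the complex numbers has this property. It is equivalent to \<open>M^L = O(lambda_max M ^ L)\<close>, and the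
  approximation rate \<open>O(lambda_max^L)\<close> fails without it: for the system with \<open>R = 1\<close>, \<open>C = [1 0]\<close>,
  \<open>A = 1/8 [[2,1],[-2,3]]\<close> and \<open>Q = 1/64 [[61,-1],[-1,53]]\<close>, the matrix \<open>\<Gamma> = 1/8 [[1,1],[-1,3]]\<close> has the
  defective eigenvalue \<open>1/4\<close>, and the weight of the observation at lag \<open>l\<close> is \<open>(2 - l) / (2 * 4^l)\<close>.\<close>

definition dominant_semisimple :: "real^'d^'d \<Rightarrow> bool" where
  "dominant_semisimple M \<longleftrightarrow>
     (\<forall>z \<in># eigvals M. cmod z = lambda_max M \<longrightarrow>
        (let N = map_matrix complex_of_real M - mat z
         in \<forall>v. N *v (N *v v) = 0 \<longrightarrow> N *v v = 0))"

section \<open>Steady-state Kalman filter\<close>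

definition pred_cov :: "real^'d^'d \<Rightarrow> real^'d^'d \<Rightarrow> real^'d^'d \<Rightarrow> real^'d^'d" where
  "pred_cov A Q S = A ** S ** transpose A + Q"

definition gain_of :: "real^'d^'n \<Rightarrow> real^'n^'n \<Rightarrow> real^'d^'d \<Rightarrow> real^'n^'d" where
  "gain_of C R P = P ** transpose C ** matrix_inv (C ** P ** transpose C + R)"

text \<open>The filtered covariance at time \<open>t\<close>, started from an initial state covariance \<open>S0\<close> at time \<open>0\<close>.\<close>

primrec filt_cov ::
  "real^'d^'d \<Rightarrow> real^'d^'n \<Rightarrow> real^'d^'d \<Rightarrow> real^'n^'n \<Rightarrow> real^'d^'d \<Rightarrow> nat \<Rightarrow> real^'d^'d" where
  "filt_cov A C Q R S0 0 = S0"
| "filt_cov A C Q R S0 (Suc t) =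
     (let P = pred_cov A Q (filt_cov A C Q R S0 t) in (mat 1 - gain_of C R P ** C) ** P)"

text \<open>The gain at time \<open>t \<ge> 1\<close>; the value at \<open>t = 0\<close> has no meaning.\<close>

definition kalman_gain ::
  "real^'d^'d \<Rightarrow> real^'d^'n \<Rightarrow> real^'d^'d \<Rightarrow> real^'n^'n \<Rightarrow> real^'d^'d \<Rightarrow> nat \<Rightarrow> real^'n^'d" where
  "kalman_gain A C Q R S0 t = gain_of C R (pred_cov A Q (filt_cov A C Q R S0 (t - 1)))"

text \<open>The summation index is \<open>l = k + 1\<close>.\<close>

definition lds_pred_mean ::
  "real^'d^'d \<Rightarrow> real^'d \<Rightarrow> real^'d^'n \<Rightarrow> real^'n \<Rightarrow> real^'n^'d \<Rightarrow> (int \<Rightarrow> real^'n) \<Rightarrow> int \<Rightarrow> real^'n" where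
  "lds_pred_mean A b C d K y t =
     C *v (\<Sum>k. mat_pow (A ** (mat 1 - K ** C)) k *v
                 ((A ** K) *v y (t - int (k + 1)) + b - (A ** K) *v d)) + d"

section \<open>SALT models with one discrete state\<close>

text \<open>In a model of rank \<open>r\<close> and order \<open>L\<close> only the entries with core indices below \<open>r\<close> and
  lags in \<open>{1..L}\<close> are used: \<open>facU M p i\<close>, \<open>facV M q j\<close> and \<open>facW M s k\<close> are the entries of the
  factor matrices in row \<open>p\<close>, \<open>q\<close>, \<open>s\<close> and column \<open>i\<close>, \<open>j\<close>, \<open>k\<close>.\<close>

record 'n salt =
  core :: "nat \<Rightarrow> nat \<Rightarrow> nat \<Rightarrow> real"
  facU :: "'n \<Rightarrow> nat \<Rightarrow> real"
  facV :: "'n \<Rightarrow> nat \<Rightarrow> real"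
  facW :: "nat \<Rightarrow> nat \<Rightarrow> real"
  bias :: "real^'n"

definition salt_tensor :: "nat \<Rightarrow> 'n::finite salt \<Rightarrow> 'n \<Rightarrow> 'n \<Rightarrow> nat \<Rightarrow> real" where
  "salt_tensor r M p q s =
     (\<Sum>i<r. \<Sum>j<r. \<Sum>k<r. core M i j k * facU M p i * facV M q j * facW M s k)"

definition salt_pred_mean ::
  "nat \<Rightarrow> nat \<Rightarrow> 'n::finite salt \<Rightarrow> (int \<Rightarrow> real^'n) \<Rightarrow> int \<Rightarrow> real^'n" where
  "salt_pred_mean r L M y t =
     (\<chi> p. \<Sum>q\<in>UNIV. \<Sum>s=1..L. salt_tensor r M p q s * y (t - int s) $ q) + bias M"

definition is_cp :: "nat \<Rightarrow> 'n::finite salt \<Rightarrow> bool" where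
  "is_cp r M \<longleftrightarrow> (\<forall>i<r. \<forall>j<r. \<forall>k<r. \<not> (i = j \<and> j = k) \<longrightarrow> core M i j k = 0)"

section \<open>Approximation rate\<close>

text \<open>The models \<open>S L\<close> of order \<open>L\<close> and rank \<open>r\<close> predict with maximum norm error \<open>O(\<rho>^L)\<close>. The
  implied constant depends on the observations only through a bound \<open>B\<close> on their size: uniformly for
  past observations bounded by \<open>B\<close>, and in the mean for random observations with first moments
  bounded by \<open>B\<close>. The observations of a steady-state Gaussian system are of the second kind, but
  almost surely unbounded over the infinite past. The measure \<open>P\<close> is the law of the observation
  process on path space.\<close>

definition salt_rate ::
  "((int \<Rightarrow> real^'n) \<Rightarrow> int \<Rightarrow> real^'n) \<Rightarrow> nat \<Rightarrow> (nat \<Rightarrow> 'n::finite salt) \<Rightarrow> real \<Rightarrow> bool" where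
  "salt_rate yhat r S \<rho> \<longleftrightarrow>
     (\<forall>B. \<exists>c. \<forall>L t y. (\<forall>s<t. norm (y s) \<le> B) \<longrightarrow>
        infnorm (yhat y t - salt_pred_mean r L (S L) y t) \<le> c * \<rho> ^ L) \<and>
     (\<forall>B. \<exists>c. \<forall>L t P. prob_space P \<and> sets P = sets (PiM UNIV (\<lambda>_::int. borel)) \<and>
        (\<forall>s<t. (\<integral>\<^sup>+ y. ennreal (norm (y s)) \<partial>P) \<le> ennreal B) \<longrightarrow>
        (\<integral>\<^sup>+ y. ennreal (infnorm (yhat y t - salt_pred_mean r L (S L) y t)) \<partial>P)
          \<le> ennreal (c * \<rho> ^ L))"

end

theory Submission
  imports Defs
begin

text \<open>
  Write \<open>F\<close> for the Riccati map. The quadratic form of \<open>F P\<close> at \<open>v\<close> is the minimum over \<open>u\<close> of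
  \<open>(A\<^sup>T v - C\<^sup>T u) \<bullet> P (A\<^sup>T v - C\<^sup>T u) + u \<bullet> R u + v \<bullet> Q v\<close>. Hence \<open>F\<close> is monotone, its iterates from \<open>0\<close> increase and
  stay bounded because \<open>A\<close> is stable, and they converge to a fixed point \<open>P\<close> with stable \<open>\<Gamma>\<close>. Using the
  optimal \<open>u\<close> of \<open>P\<close> for another starting point \<open>P'\<close> bounds \<open>F^t P' - P\<close> above by \<open>\<Gamma>^t (P' - P) \<Gamma>^t\<^sup>T\<close>, while
  monotonicity bounds \<open>F^t P'\<close> below by \<open>F^t 0\<close>; so every start leads to \<open>P\<close>.

  The predictor weights are \<open>C \<Gamma>^(l-1) A K\<close>. An invariant flag of \<open>\<Gamma>\<close> whose steps are real vectors and
  conjugate pairs of complex vectors allows a small real perturbation that makes the eigenvalues distinct and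
  keeps their number of either type. For the perturbed matrix the weights are a sum of one real rank-one
  term per real eigenvalue and of the real part of one complex rank-one term per conjugate pair; the latter
  has Tucker rank two and CP rank three. The truncated tail is controlled by the growth of \<open>\<Gamma>^k\<close>, which
  follows from the generalised eigenvector decomposition.\<close>

text \<open>The obstacle is a defective \<open>\<Gamma>\<close>. For a Jordan block of size two the
  slices 1 and \<open>\<Gamma>\<close> already form a tensor of CP rank three, although it is a
  limit of tensors of rank two, so an exact fit of the allowed CP rank need not exist. The model may
  depend on \<open>L\<close> and sees only \<open>L\<close> lags; the perturbation is therefore
  chosen after \<open>L\<close>, and beyond lag \<open>L\<close> the powers of
  \<open>\<Gamma>\<close> itself are estimated, so the growth of the perturbed powers never enters.
  The same perturbation also shows that a flag lists the eigenvalues with their multiplicities, by a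
  limit in the characteristic polynomial. One exception runs through the proof: if
  \<open>lambda_max\<close> is 0 under the semisimplicity condition, then \<open>\<Gamma>\<close> is
  0, the claimed error is 0 for positive \<open>L\<close>, and the fit has to be exact.\<close>

abbreviation cmat :: "real^'n^'m \<Rightarrow> complex^'n^'m" where
  "cmat \<equiv> map_matrix complex_of_real"

definition cvec :: "real^'n \<Rightarrow> complex^'n" where
  "cvec x = (\<chi> i. complex_of_real (x $ i))"

section \<open>Characteristic polynomial and eigenvalues\<close>

lemma poly_det: "poly (det (A :: 'a::comm_ring_1 poly^'n^'n)) z = det (map_matrix (\<lambda>p. poly p z) A)"
  by (simp add: det_def poly_sum poly_prod)

lemma poly_charpoly: "poly (charpoly M) z = det (mat z - cmat M)"
proof -
  have "map_matrix (\<lambda>p. poly p z) (mat [:0, 1:] - map_matrix (\<lambda>a. [:complex_of_real a:]) M) = mat z - cmat M"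
    by (simp add: vec_eq_iff mat_def)
  then show ?thesis by (simp add: charpoly_def poly_det)
qed

lemma mat_mult_vec: "mat z *v v = z *s (v :: 'a::comm_semiring_1^'n)"
  by (simp add: vec_eq_iff matrix_vector_mult_def mat_def mult_delta_left)

lemma charpoly_root_iff: "poly (charpoly M) z = 0 \<longleftrightarrow> (\<exists>v. v \<noteq> 0 \<and> cmat M *v v = z *s v)"
proof -
  let ?X = "mat z - cmat M"
  have "det ?X \<noteq> 0 \<longleftrightarrow> inj ((*v) ?X)"
    using det_nz_iff_inj_gen[of "(*v) ?X"] by (simp only: matrix_vector_mul_linear_gen matrix_of_matrix_vector_mul)
  also have "\<dots> \<longleftrightarrow> (\<forall>v. ?X *v v = 0 \<longrightarrow> v = 0)"
    by (rule vec.inj_iff_eq_0)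
  finally have "det ?X = 0 \<longleftrightarrow> (\<exists>v. v \<noteq> 0 \<and> ?X *v v = 0)"
    by blast
  also have "\<dots> \<longleftrightarrow> (\<exists>v. v \<noteq> 0 \<and> cmat M *v v = z *s v)"
    unfolding matrix_vector_mult_diff_rdistrib mat_mult_vec by (metis right_minus_eq)
  finally show ?thesis by (simp add: poly_charpoly)
qed

lemma degree_prod_le_card:
  fixes f :: "'i \<Rightarrow> 'a::comm_ring_1 poly"
  assumes "\<And>i. i \<in> I \<Longrightarrow> degree (f i) \<le> (if i \<in> J then 1 else 0)" "finite I"
  shows "degree (\<Prod>i\<in>I. f i) \<le> card (I \<inter> J)"
proof -
  have "degree (\<Prod>i\<in>I. f i) \<le> sum (degree \<circ> f) I"
    using assms(2) by (rule degree_prod_sum_le)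
  also have "\<dots> \<le> (\<Sum>i\<in>I. if i \<in> J then 1 else 0)"
    using assms(1) by (intro sum_mono) auto
  also have "\<dots> = card (I \<inter> J)"
    using assms(2) by (simp add: sum.If_cases)
  finally show ?thesis .
qed

text \<open>In the Leibniz expansion the variable occurs only on the diagonal, so a permutation
  contributes degree at most its number of fixed points. Only the identity reaches
  \<open>CARD('d)\<close>, with a monic product.\<close>

lemma charpoly_degree_lead:
  fixes M :: "real^'d^'d"
  shows "degree (charpoly M) \<le> CARD('d) \<and> coeff (charpoly M) (CARD('d)) = 1"
proof -
  let ?A = "mat [:0, 1:] - map_matrix (\<lambda>a. [:complex_of_real a:]) M"
  let ?F = "\<lambda>p. of_int (sign p) * (\<Prod>i\<in>UNIV. ?A $ i $ p i)"
  let ?P = "{p. p permutes (UNIV :: 'd set)}"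
  have deg: "degree (?F p) \<le> card {i. p i = i}" for p :: "'d \<Rightarrow> 'd"
  proof -
    have "degree (?F p) = degree (\<Prod>i\<in>UNIV. ?A $ i $ p i)"
      by (simp only: sign_def if_split) simp
    also have "\<dots> \<le> card (UNIV \<inter> {i. p i = i})"
    proof (rule degree_prod_le_card)
      show "degree (?A $ i $ p i) \<le> (if i \<in> {i. p i = i} then 1 else 0)" for i
        by (cases "p i = i") (simp_all add: mat_def)
    qed simp
    finally show ?thesis by simp
  qed
  have lt: "card {i. p i = i} < CARD('d)" if "p \<noteq> id" for p :: "'d \<Rightarrow> 'd"
  proof (rule psubset_card_mono)
    show "{i. p i = i} \<subset> UNIV" using that eq_id_iff[of p] by blast
  qed simp
  let ?G = "\<Prod>i\<in>UNIV. [:- complex_of_real (M $ i $ i), 1:]"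
  have F_id: "?F id = ?G"
    by (simp add: mat_def)
  have G_degree: "degree ?G = CARD('d)"
    by (subst degree_prod_eq_sum_degree) simp_all
  have "lead_coeff ?G = (\<Prod>i\<in>(UNIV :: 'd set). 1)"
    unfolding lead_coeff_prod by (rule prod.cong) simp_all
  then have G_lead: "coeff ?G (CARD('d)) = 1"
    by (simp add: G_degree)
  have eq: "charpoly M = (\<Sum>p\<in>?P. ?F p)"
    by (simp add: charpoly_def det_def)
  have "degree (?F p) \<le> CARD('d)" for p :: "'d \<Rightarrow> 'd"
    using deg[of p] card_mono[of UNIV "{i. p i = i}"] by simp
  then have "degree (\<Sum>p\<in>?P. ?F p) \<le> CARD('d)"
    by (intro degree_sum_le) simp_all
  moreover have "coeff (?F p) (CARD('d)) = (if p = id then 1 else 0)" for p :: "'d \<Rightarrow> 'd"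
  proof (cases "p = id")
    case True
    have "coeff (?F id) (CARD('d)) = 1"
      unfolding F_id by (rule G_lead)
    with True show ?thesis by (simp only: refl if_True)
  next
    case False
    then have "degree (?F p) < CARD('d)"
      using deg[of p] lt[of p] by linarith
    then have "coeff (?F p) (CARD('d)) = 0"
      by (rule coeff_eq_0)
    with False show ?thesis by simp
  qed
  then have "coeff (\<Sum>p\<in>?P. ?F p) (CARD('d)) = (\<Sum>p\<in>?P. if p = id then 1 else 0)"
    unfolding coeff_sum by (intro sum.cong refl)
  ultimately show ?thesis
    unfolding eq by (simp add: permutes_id)
qed


lemma charpoly_nonzero: "charpoly M \<noteq> 0"
  using charpoly_degree_lead[of M] by force

lemma in_eigvals_iff: "z \<in># eigvals M \<longleftrightarrow> (\<exists>v. v \<noteq> 0 \<and> cmat M *v v = z *s v)"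
  by (simp add: eigvals_def charpoly_nonzero charpoly_root_iff)

section \<open>Invariant subspaces and generalised eigenvectors\<close>

lemma span_image_lessThan:
  fixes u :: "nat \<Rightarrow> 'a::field^'d"
  shows "x \<in> vec.span (u ` {..<k}) \<Longrightarrow> \<exists>c. x = (\<Sum>i<k. c i *s u i)"
proof (induction k arbitrary: x)
  case (Suc k)
  then obtain t where "x - t *s u k \<in> vec.span (u ` {..<k})"
    unfolding lessThan_Suc image_insert vec.span_insert by blast
  from Suc.IH[OF this] obtain c where c: "x - t *s u k = (\<Sum>i<k. c i *s u i)"
    by blast
  have "x = (\<Sum>i<Suc k. (c(k := t)) i *s u i)"
    using c by (simp add: algebra_simps)
  then show ?case by blast
qed simp

text \<open>More than \<open>CARD('d)\<close> vectors cannot be independent. For the orbit of one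
  vector this yields an annihilating polynomial of that vector, which takes the place of the
  Cayley-Hamilton theorem.\<close>

lemma krylov_dependence:
  fixes u :: "nat \<Rightarrow> 'a::field^'d"
  obtains k c where "u k = (\<Sum>i<k. c i *s u i)"
proof -
  have "\<exists>k. u k \<in> vec.span (u ` {..<k})"
  proof (rule ccontr)
    assume "\<not> ?thesis"
    then have new: "u k \<notin> vec.span (u ` {..<k})" for k by simp
    have ind: "vec.independent (u ` {..<k}) \<and> card (u ` {..<k}) = k" for k
    proof (induction k)
      case (Suc k)
      have "u k \<notin> u ` {..<k}"
        using new[of k] vec.span_base[of "u k" "u ` {..<k}"] by metis
      then show ?case
        using Suc new[of k] by (simp add: lessThan_Suc vec.independent_insertI)
    qed (simp add: vec.independent_empty)
    have "card (u ` {..<Suc (CARD('d))}) \<le> vec.dim (UNIV :: ('a^'d) set)"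
      using ind by (intro vec.independent_card_le_dim) blast+
    then have "card (u ` {..<Suc (CARD('d))}) \<le> CARD('d)"
      unfolding vec_dim_card .
    with ind[of "Suc (CARD('d))"] show False by simp
  qed
  then show ?thesis
    using span_image_lessThan that by blast
qed

text \<open>Some nonzero polynomial in \<open>F\<close> sends \<open>x\<close> into
  \<open>W\<close>. Over the complex numbers it has a factor X - z, and \<open>closed\<close>
  removes this factor; when only a nonzero constant is left, \<open>x\<close> itself is in
  \<open>W\<close>. Read for a proper subspace, the lemma supplies an eigenvector modulo that
  subspace.\<close>

lemma subspace_eq_UNIV:
  fixes F :: "complex^'d^'d"
  assumes W: "vec.subspace W" and closed: "\<And>v z. F *v v - z *s v \<in> W \<Longrightarrow> v \<in> W"
  shows "W = UNIV"
proof -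
  have "x \<in> W" for x
  proof -
    define u where "u i = ((*v) F ^^ i) x" for i
    have step: "x \<in> W" if "p \<noteq> 0" "degree p \<le> N" "(\<Sum>i\<le>N. coeff p i *s u i) \<in> W" for p N
      using that
    proof (induction N arbitrary: p)
      case 0
      then have ne: "coeff p 0 \<noteq> 0"
        using leading_coeff_neq_0[of p] by simp
      have "coeff p 0 *s x \<in> W"
        using 0 by (simp add: u_def)
      then have "inverse (coeff p 0) *s (coeff p 0 *s x) \<in> W"
        by (rule vec.subspace_scale[OF W])
      moreover have "inverse (coeff p 0) *s (coeff p 0 *s x) = x"
        using ne by (simp add: vec_eq_iff)
      ultimately show ?case by simp
    next
      case (Suc N)
      show ?case
      proof (cases "degree p \<le> N")
        case True
        then have "coeff p (Suc N) = 0" by (simp add: coeff_eq_0)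
        with Suc True show ?thesis by simp
      next
        case False
        then have dp: "degree p = Suc N" using Suc by simp
        then obtain z where "poly p z = 0"
          using fundamental_theorem_of_algebra_alt[of p] by fastforce
        then obtain q where q: "p = [:-z, 1:] * q"
          unfolding poly_eq_0_iff_dvd by (elim dvdE)
        then have q0: "q \<noteq> 0" using Suc.prems by auto
        then have dq: "degree q = N"
          using dp unfolding q by (subst (asm) degree_mult_eq) auto
        then have qN: "coeff q (Suc N) = 0" by (simp add: coeff_eq_0)
        let ?w = "\<Sum>i\<le>N. coeff q i *s u i"
        have "F *v ?w = (\<Sum>i\<le>N. coeff q i *s u (Suc i))"
          by (simp add: vec.sum vec.scale u_def)
        moreover have "(\<Sum>i\<le>Suc N. coeff p i *s u i)
          = (\<Sum>i\<le>Suc N. coeff (pCons 0 q) i *s u i) - (\<Sum>i\<le>Suc N. coeff q i *s (z *s u i))"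
          by (simp add: q sum_subtractf[symmetric] vec.scale_left_diff_distrib mult.commute)
        moreover have "(\<Sum>i\<le>Suc N. coeff (pCons 0 q) i *s u i) = (\<Sum>i\<le>N. coeff q i *s u (Suc i))"
          by (subst sum.atMost_Suc_shift) simp
        moreover have "(\<Sum>i\<le>Suc N. coeff q i *s (z *s u i)) = z *s ?w"
          by (simp add: qN vec.scale_sum_right mult.commute)
        ultimately have "F *v ?w - z *s ?w \<in> W"
          using Suc.prems(3) by simp
        then have "?w \<in> W" by (rule closed)
        with Suc.IH[of q] q0 dq show ?thesis by simp
      qed
    qed
    obtain k c where k: "u k = (\<Sum>i<k. c i *s u i)"
      by (rule krylov_dependence)
    \<comment> \<open>This polynomial annihilates \<open>x\<close>, and 0 lies in \<open>W\<close>,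
      so the removal of factors can start.\<close>
    define p where "p = monom 1 k - (\<Sum>i<k. monom (c i) i)"
    have cp: "coeff p i = (if i = k then 1 else 0) - (if i < k then c i else 0)" for i
      by (simp add: p_def coeff_sum)
    have "p \<noteq> 0" using cp[of k] by force
    moreover have "degree p \<le> k"
      by (rule degree_le) (simp add: cp)
    moreover have "(\<Sum>i\<le>k. coeff p i *s u i) = u k - (\<Sum>i<k. c i *s u i)"
      by (simp add: cp lessThan_Suc_atMost[symmetric] sum_negf)
    ultimately show ?thesis
      using step[of p k] k vec.subspace_0[OF W] by simp
  qed
  then show ?thesis by blast
qed

definition shift :: "complex^'d^'d \<Rightarrow> complex \<Rightarrow> complex^'d \<Rightarrow> complex^'d" where
  "shift F z v = F *v v - z *s v"

text \<open>The zero vector belongs to every \<open>z\<close>, which makes the vectors for fixed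
  \<open>z\<close> a subspace; statements about eigenvalues therefore add
  \<open>v \<noteq> 0\<close>.\<close>

definition gen_eigvec :: "complex^'d^'d \<Rightarrow> complex \<Rightarrow> complex^'d \<Rightarrow> bool" where
  "gen_eigvec F z v \<longleftrightarrow> (\<exists>k. (shift F z ^^ k) v = 0)"

lemma shift_linear:
  "shift F z (x + y) = shift F z x + shift F z y"
  "shift F z (x - y) = shift F z x - shift F z y"
  "shift F z (c *s x) = c *s shift F z x"
  "shift F z 0 = 0"
  by (simp_all add: shift_def vec.add vec.diff vec.scale vec.zero vec_eq_iff algebra_simps)

lemma funpow_shift_linear:
  "(shift F z ^^ k) (x + y) = (shift F z ^^ k) x + (shift F z ^^ k) y"
  "(shift F z ^^ k) (c *s x) = c *s (shift F z ^^ k) x"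
  "(shift F z ^^ k) 0 = 0"
  by (induction k) (simp_all add: shift_linear)

lemma gen_eigvec_mono:
  assumes "(shift F z ^^ k) v = 0" "k \<le> l"
  shows "(shift F z ^^ l) v = 0"
proof -
  obtain j where "l = j + k" using assms(2) by (metis add.commute le_Suc_ex)
  then show ?thesis using assms(1) by (simp add: funpow_add funpow_shift_linear)
qed

lemma subspace_gen_eigvec: "vec.subspace {v. gen_eigvec F z v}"
proof (rule vec.subspaceI)
  fix x y assume "x \<in> {v. gen_eigvec F z v}" "y \<in> {v. gen_eigvec F z v}"
  then obtain k l where "(shift F z ^^ k) x = 0" "(shift F z ^^ l) y = 0"
    by (auto simp: gen_eigvec_def)
  then have "(shift F z ^^ max k l) x = 0" "(shift F z ^^ max k l) y = 0"
    by (auto intro: gen_eigvec_mono)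
  then have "(shift F z ^^ max k l) (x + y) = 0"
    by (simp add: funpow_shift_linear)
  then show "x + y \<in> {v. gen_eigvec F z v}"
    unfolding gen_eigvec_def by blast
qed (auto simp: gen_eigvec_def funpow_shift_linear)

lemma gen_eigvec_shifted:
  assumes "gen_eigvec F z (shift F z v)" shows "gen_eigvec F z v"
proof -
  obtain k where "(shift F z ^^ k) (shift F z v) = 0"
    using assms by (auto simp: gen_eigvec_def)
  then have "(shift F z ^^ Suc k) v = 0"
    by (simp only: funpow_Suc_right o_apply)
  then show ?thesis unfolding gen_eigvec_def by blast
qed

text \<open>If \<open>F - z\<close> sends \<open>v\<close> into the span, split the image into
  generalised eigenvectors. The parts for eigenvalues other than \<open>z\<close> are themselves
  images under \<open>F - z\<close> of some \<open>h\<close> in the span; what remains belongs to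
  \<open>z\<close>, so \<open>v - h\<close> is a generalised eigenvector for
  \<open>z\<close>.\<close>

lemma gen_eigvec_span:
  "vec.span {v. \<exists>z. gen_eigvec F z v} = (UNIV :: (complex^'d) set)"
proof (rule subspace_eq_UNIV[of _ F])
  let ?G = "{v. \<exists>z. gen_eigvec F z v}" let ?W = "vec.span ?G"
  show "vec.subspace ?W" by (rule vec.subspace_span)
  fix v z assume "F *v v - z *s v \<in> ?W"
  then have v: "shift F z v \<in> ?W" by (simp add: shift_def)
  \<comment> \<open>On the chain of \<open>w\<close>, \<open>F - z\<close> is the nilpotent
    \<open>F - \<mu>\<close> plus the nonzero scalar \<open>\<mu> - z\<close>, so the equation is
    solved by induction on the chain length.\<close>
  have other: "\<exists>h\<in>?W. shift F z h = w"
    if "(shift F \<mu> ^^ k) w = 0" "\<mu> \<noteq> z" for \<mu> k w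
    using that(1)
  proof (induction k arbitrary: w)
    case 0
    then show ?case by (intro bexI[of _ 0]) (simp_all add: shift_linear vec.span_zero)
  next
    case (Suc k)
    let ?w = "shift F \<mu> w"
    have "(shift F \<mu> ^^ k) ?w = 0"
      using Suc.prems by (simp only: funpow_Suc_right o_apply)
    from Suc.IH[OF this] obtain h where h: "h \<in> ?W" "shift F z h = ?w" by blast
    let ?h = "inverse (\<mu> - z) *s (w - h)"
    have "w \<in> ?W" using Suc.prems unfolding gen_eigvec_def by (intro vec.span_base) blast
    then have hW: "?h \<in> ?W" using h by (intro vec.span_scale vec.span_diff)
    have "shift F z ?h = inverse (\<mu> - z) *s ((\<mu> - z) *s w)"
      unfolding shift_linear h(2) by (simp add: shift_def vec_eq_iff algebra_simps)
    moreover have "inverse (\<mu> - z) *s ((\<mu> - z) *s w) = w"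
      using that(2) by (simp only: vector_smult_assoc) simp
    ultimately have "shift F z ?h = w" by metis
    with hW show ?case by blast
  qed
  have "\<exists>h\<in>?W. gen_eigvec F z (w - (shift F z h))" if "w \<in> ?W" for w
    using that
  proof (induction rule: vec.span_induct_alt)
    case base
    show ?case
      using subspace_gen_eigvec[of F z, THEN vec.subspace_0]
      by (intro bexI[of _ 0]) (simp_all add: shift_linear vec.span_zero)
  next
    case (step c x y)
    then obtain h where h: "h \<in> ?W" "gen_eigvec F z (y - (shift F z h))" by blast
    obtain \<mu> k where \<mu>: "(shift F \<mu> ^^ k) x = 0"
      using step(1) by (auto simp: gen_eigvec_def)
    have "\<exists>g\<in>?W. gen_eigvec F z (x - (shift F z g))"
    proof (cases "\<mu> = z")
      case True
      with \<mu> show ?thesis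
        by (intro bexI[of _ 0]) (auto simp: gen_eigvec_def shift_linear vec.span_zero)
    next
      case False
      from other[OF \<mu> this] obtain g where "g \<in> ?W" "shift F z g = x" by blast
      then show ?thesis
        using subspace_gen_eigvec[of F z, THEN vec.subspace_0] by (intro bexI[of _ g]) simp_all
    qed
    then obtain g where g: "g \<in> ?W" "gen_eigvec F z (x - (shift F z g))" by blast
    let ?h = "c *s g + h"
    have eq: "c *s x + y - shift F z ?h = c *s (x - shift F z g) + (y - shift F z h)"
      by (simp add: shift_linear vec_eq_iff algebra_simps)
    have "c *s (x - shift F z g) + (y - shift F z h) \<in> {v. gen_eigvec F z v}"
      using g h by (intro vec.subspace_add vec.subspace_scale subspace_gen_eigvec) simp_all
    then have "gen_eigvec F z (c *s x + y - shift F z ?h)"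
      unfolding eq by simp
    moreover have "?h \<in> ?W" using g h by (intro vec.span_add vec.span_scale)
    ultimately show ?case by blast
  qed
  from this[OF v] obtain h where h: "h \<in> ?W" "gen_eigvec F z (shift F z v - (shift F z h))"
    by blast
  then have "gen_eigvec F z (shift F z (v - h))"
    by (simp add: shift_linear)
  then have "v - h \<in> ?W" by (intro vec.span_base) (blast intro: gen_eigvec_shifted)
  then show "v \<in> ?W" using vec.span_add[OF _ h(1), of "v - h"] by simp
qed


section \<open>Growth of matrix powers\<close>

lemma norm_vector_smult: "norm (z *s (v :: complex^'d)) = cmod z * norm v"
  by (simp add: norm_vec_def norm_mult L2_set_right_distrib)

lemma norm_cvec: "norm (cvec x) = norm x"
  by (simp add: norm_vec_def cvec_def)

lemma cmat_mult_cvec: "cmat M *v cvec x = cvec (M *v x)"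
  by (simp add: cvec_def vec_eq_iff matrix_vector_mult_def)

lemma mat_pow_mult_vec: "mat_pow M k *v x = ((*v) M ^^ k) x"
  by (induction k) (simp_all add: matrix_vector_mul_assoc[symmetric])

lemma funpow_cmat_cvec:
  fixes M :: "real^'d^'d"
  shows "((*v) (cmat M) ^^ k) (cvec x) = cvec (((*v) M ^^ k) x)"
  by (induction k) (simp_all add: cmat_mult_cvec)

lemma funpow_mult_vec_linear:
  fixes F :: "'a::field^'d^'d"
  shows "((*v) F ^^ k) (x + y) = ((*v) F ^^ k) x + ((*v) F ^^ k) y"
    and "((*v) F ^^ k) (c *s x) = c *s ((*v) F ^^ k) x"
    and "((*v) F ^^ k) 0 = 0"
  by (induction k) (simp_all add: vec.add vec.scale vec.zero)

text \<open>Any rate above the modulus of \<open>z\<close> absorbs the polynomial factor of a Jordan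
  chain. Induction along the chain avoids writing that factor down: each level obeys a scalar
  recursion with forcing term \<open>c * \<rho> ^ j\<close>.\<close>

lemma gen_eigvec_growth:
  assumes "(shift F z ^^ k) v = 0" "cmod z < \<rho>"
  shows "\<exists>c. \<forall>j. norm (((*v) F ^^ j) v) \<le> c * \<rho> ^ j"
  using assms(1)
proof (induction k arbitrary: v)
  case 0
  then show ?case by (intro exI[of _ 0]) (simp add: funpow_mult_vec_linear)
next
  case (Suc k)
  then have "(shift F z ^^ k) (shift F z v) = 0"
    by (simp only: funpow_Suc_right o_apply)
  from Suc.IH[OF this] obtain c where c: "norm (((*v) F ^^ j) (shift F z v)) \<le> c * \<rho> ^ j" for j
    by blast
  \<comment> \<open>Chosen so that \<open>c + cmod z * e \<le> e * \<rho>\<close>, which the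
    recursion reproduces, and so that \<open>e\<close> covers the case \<open>j = 0\<close>.\<close>
  define e where "e = max (norm v) (c / (\<rho> - cmod z))"
  have "c / (\<rho> - cmod z) \<le> e" by (simp add: e_def)
  then have e: "c \<le> e * (\<rho> - cmod z)" using assms(2) by (simp add: pos_divide_le_eq)
  have "norm (((*v) F ^^ j) v) \<le> e * \<rho> ^ j" for j
  proof (induction j)
    case (Suc j)
    have "F *v v = shift F z v + z *s v" by (simp add: shift_def)
    then have "((*v) F ^^ Suc j) v = ((*v) F ^^ j) (shift F z v) + z *s ((*v) F ^^ j) v"
      by (simp only: funpow_Suc_right o_apply funpow_mult_vec_linear)
    then have "norm (((*v) F ^^ Suc j) v) \<le> c * \<rho> ^ j + cmod z * (e * \<rho> ^ j)"
      using c[of j] Suc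
      by (metis (no_types, lifting) add_mono mult_left_mono norm_ge_zero norm_triangle_le norm_vector_smult)
    also have "\<dots> \<le> e * (\<rho> - cmod z) * \<rho> ^ j + cmod z * (e * \<rho> ^ j)"
      using less_imp_le[OF le_less_trans[OF norm_ge_zero assms(2)]]
      by (intro add_right_mono mult_right_mono e zero_le_power)
    also have "\<dots> = e * \<rho> ^ Suc j" by (simp add: algebra_simps)
    finally show ?case .
  qed (simp add: e_def)
  then show ?case by blast
qed

text \<open>Vectors whose orbit is O(\<open>\<rho> ^ j\<close>) form a subspace, so generalised
  eigenvectors suffice. The disjunction in the premise serves both uses: \<open>\<rho>\<close>
  strictly above all moduli, and \<open>\<rho>\<close> equal to the largest modulus when its chains
  have length one.\<close>

lemma funpow_growth:
  fixes F :: "complex^'d^'d"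
  assumes "0 \<le> \<rho>"
    and "\<And>z v. gen_eigvec F z v \<Longrightarrow> v \<noteq> 0 \<Longrightarrow> cmod z < \<rho> \<or> cmod z = \<rho> \<and> shift F z v = 0"
  shows "\<exists>c. \<forall>j. norm (((*v) F ^^ j) v) \<le> c * \<rho> ^ j"
proof -
  let ?S = "{v. \<exists>c. \<forall>j. norm (((*v) F ^^ j) v) \<le> c * \<rho> ^ j}"
  have "vec.subspace ?S"
  proof (rule vec.subspaceI)
    show "0 \<in> ?S" by (auto simp: funpow_mult_vec_linear intro!: exI[of _ 0])
    fix x y assume "x \<in> ?S" "y \<in> ?S"
    then obtain a b where "norm (((*v) F ^^ j) x) \<le> a * \<rho> ^ j" "norm (((*v) F ^^ j) y) \<le> b * \<rho> ^ j" for j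
      by blast
    then have "norm (((*v) F ^^ j) (x + y)) \<le> (a + b) * \<rho> ^ j" for j
      unfolding funpow_mult_vec_linear distrib_right by (intro norm_triangle_le add_mono)
    then show "x + y \<in> ?S" by blast
  next
    fix c x assume "x \<in> ?S"
    then obtain a where "norm (((*v) F ^^ j) x) \<le> a * \<rho> ^ j" for j
      by blast
    then have "norm (((*v) F ^^ j) (c *s x)) \<le> (cmod c * a) * \<rho> ^ j" for j
      unfolding funpow_mult_vec_linear norm_vector_smult mult.assoc by (intro mult_left_mono) auto
    then show "c *s x \<in> ?S" by blast
  qed
  moreover have "{v. \<exists>z. gen_eigvec F z v} \<subseteq> ?S"
  proof safe
    fix v z assume v: "gen_eigvec F z v"
    consider "v = 0" | "cmod z < \<rho>" | "cmod z = \<rho>" "shift F z v = 0"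
      using assms(2)[OF v] by blast
    then show "\<exists>c. \<forall>j. norm (((*v) F ^^ j) v) \<le> c * \<rho> ^ j"
    proof cases
      case 1
      then show ?thesis by (intro exI[of _ 0]) (simp add: funpow_mult_vec_linear)
    next
      case 2
      then show ?thesis using v gen_eigvec_growth unfolding gen_eigvec_def by metis
    next
      case 3
      have "((*v) F ^^ j) v = z ^ j *s v" for j
        using 3(2) by (induction j) (simp_all add: shift_def vec.scale vector_smult_assoc mult.commute)
      then show ?thesis
        using 3(1) by (intro exI[of _ "norm v"]) (simp add: norm_vector_smult norm_power)
    qed
  qed
  ultimately have "vec.span {v. \<exists>z. gen_eigvec F z v} \<subseteq> ?S"
    by (rule vec.span_minimal[rotated])
  then show ?thesis unfolding gen_eigvec_span by blast
qed

lemma mat_pow_growth: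
  fixes M :: "real^'d^'d"
  assumes "0 \<le> \<rho>"
    and "\<And>z v. gen_eigvec (cmat M) z v \<Longrightarrow> v \<noteq> 0 \<Longrightarrow>
      cmod z < \<rho> \<or> cmod z = \<rho> \<and> shift (cmat M) z v = 0"
  obtains c where "0 \<le> c" "\<And>k x. norm (mat_pow M k *v x) \<le> c * \<rho> ^ k * norm x"
proof -
  have "\<exists>c. \<forall>k. norm (mat_pow M k *v axis i 1) \<le> c * \<rho> ^ k" for i
    using funpow_growth[of \<rho> "cmat M" "cvec (axis i 1)", OF assms]
    by (simp add: funpow_cmat_cvec norm_cvec mat_pow_mult_vec)
  then obtain c where c: "norm (mat_pow M k *v axis i 1) \<le> c i * \<rho> ^ k" for k i
    by metis
  have c0: "0 \<le> c i" for i
    using c[of 0 i] norm_ge_zero order_trans by fastforce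
  show ?thesis
  proof (rule that[of "\<Sum>i\<in>UNIV. c i"])
    show "0 \<le> (\<Sum>i\<in>UNIV. c i)" using c0 by (simp add: sum_nonneg)
    fix k x
    have "mat_pow M k *v x = (\<Sum>i\<in>UNIV. (x $ i) *\<^sub>R (mat_pow M k *v axis i 1))"
      using linear_sum[OF matrix_vector_mul_linear, of "mat_pow M k" "\<lambda>i. (x $ i) *\<^sub>R axis i 1" UNIV]
      by (simp add: basis_expansion[of x, unfolded scalar_mult_eq_scaleR] matrix_vector_mult_scaleR)
    then have "norm (mat_pow M k *v x) \<le> (\<Sum>i\<in>UNIV. norm x * (c i * \<rho> ^ k))"
      by (simp only:) (intro sum_norm_le; simp; intro mult_mono c component_le_norm_cart; simp)
    then show "norm (mat_pow M k *v x) \<le> (\<Sum>i\<in>UNIV. c i) * \<rho> ^ k * norm x"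
      by (simp add: sum_distrib_left sum_distrib_right mult_ac)
  qed
qed

lemma gen_eigvec_in_eigvals:
  assumes "gen_eigvec (cmat M) z v" "v \<noteq> 0"
  shows "z \<in># eigvals M"
proof -
  obtain k where "(shift (cmat M) z ^^ k) v = 0"
    using assms(1) by (auto simp: gen_eigvec_def)
  then have "\<exists>u. u \<noteq> 0 \<and> shift (cmat M) z u = 0"
    using assms(2)
  proof (induction k)
    case (Suc k)
    then show ?case by (cases "(shift (cmat M) z ^^ k) v = 0") auto
  qed simp
  then show ?thesis by (auto simp: in_eigvals_iff shift_def)
qed

text \<open>\<open>lambda_max\<close> is a \<open>Max\<close>, which says something only for a
  nonempty set. Without any eigenvalue the generalised eigenvectors would span only 0.\<close>

lemma eigvals_nonempty: "eigvals M \<noteq> {#}"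
proof
  assume "eigvals M = {#}"
  then have "{v. \<exists>z. gen_eigvec (cmat M) z v} \<subseteq> {0}"
    using gen_eigvec_in_eigvals by fastforce
  then have "vec.span {v. \<exists>z. gen_eigvec (cmat M) z v} \<subseteq> {0}"
    by (rule vec.span_minimal) (rule vec.subspace_single_0)
  then have "axis undefined 1 \<in> {0 :: complex^'a}"
    unfolding gen_eigvec_span by blast
  then show False by (simp add: axis_eq_0_iff)
qed

lemma eigval_le_lambda_max: "z \<in># eigvals M \<Longrightarrow> cmod z \<le> lambda_max M"
  unfolding lambda_max_def by (intro Max_ge) auto

lemma lambda_max_attained: "\<exists>z. z \<in># eigvals M \<and> cmod z = lambda_max M"
proof -
  have "lambda_max M \<in> cmod ` set_mset (eigvals M)"
    unfolding lambda_max_def by (intro Max_in) (auto simp: eigvals_nonempty)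
  then show ?thesis by auto
qed

lemma lambda_max_nonneg: "0 \<le> lambda_max M"
  using lambda_max_attained[of M] norm_ge_zero by metis

lemma mat_pow_bound:
  assumes "lambda_max M < \<rho>"
  obtains c where "0 \<le> c" "\<And>k x. norm (mat_pow M k *v x) \<le> c * \<rho> ^ k * norm x"
proof (rule mat_pow_growth[of \<rho> M])
  show "0 \<le> \<rho>" using assms lambda_max_nonneg[of M] by simp
  show "cmod z < \<rho> \<or> cmod z = \<rho> \<and> shift (cmat M) z v = 0"
    if "gen_eigvec (cmat M) z v" "v \<noteq> 0" for z v
    using gen_eigvec_in_eigvals[OF that] eigval_le_lambda_max[of z M] assms by simp
qed (rule that)

text \<open>The kernel of the squared shift is the kernel of the shift, so a chain of any length
  collapses to length one.\<close>

lemma dominant_semisimple_gen_eigvec: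
  assumes "dominant_semisimple M" "z \<in># eigvals M" "cmod z = lambda_max M"
    and "gen_eigvec (cmat M) z v"
  shows "shift (cmat M) z v = 0"
proof -
  have S: "shift (cmat M) z u = (cmat M - mat z) *v u" for u
    by (simp only: shift_def matrix_vector_mult_diff_rdistrib mat_mult_vec)
  have ss: "shift (cmat M) z (shift (cmat M) z u) = 0 \<Longrightarrow> shift (cmat M) z u = 0" for u
    using assms(1-3) unfolding dominant_semisimple_def Let_def S by blast
  obtain k where "(shift (cmat M) z ^^ k) v = 0"
    using assms(4) by (auto simp: gen_eigvec_def)
  then show ?thesis
  proof (induction k arbitrary: v)
    case 0
    then show ?case by (simp add: shift_linear)
  next
    case (Suc k)
    then have "(shift (cmat M) z ^^ k) (shift (cmat M) z v) = 0"
      by (simp only: funpow_Suc_right o_apply)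
    from Suc.IH[OF this] ss show ?case by blast
  qed
qed

lemma mat_pow_bound_semisimple:
  assumes "dominant_semisimple M"
  obtains c where "0 \<le> c" "\<And>k x. norm (mat_pow M k *v x) \<le> c * lambda_max M ^ k * norm x"
proof (rule mat_pow_growth[of "lambda_max M" M])
  show "0 \<le> lambda_max M" by (rule lambda_max_nonneg)
  show "cmod z < lambda_max M \<or> cmod z = lambda_max M \<and> shift (cmat M) z v = 0"
    if "gen_eigvec (cmat M) z v" "v \<noteq> 0" for z v
    using gen_eigvec_in_eigvals[OF that] eigval_le_lambda_max[of z M]
      dominant_semisimple_gen_eigvec[OF assms _ _ that(1)] by fastforce
qed (rule that)

section \<open>Perturbation to a semisimple matrix\<close>

definition cnjv :: "complex^'d \<Rightarrow> complex^'d" where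
  "cnjv v = (\<chi> i. cnj (v $ i))"

lemma cnjv_simps [simp]:
  "cnjv (x + y) = cnjv x + cnjv y" "cnjv (x - y) = cnjv x - cnjv y"
  "cnjv (c *s x) = cnj c *s cnjv x" "cnjv 0 = 0" "cnjv (cnjv x) = x"
  by (simp_all add: cnjv_def vec_eq_iff)

lemma cnjv_cmat: "cnjv (cmat M *v v) = cmat M *v cnjv v"
  by (simp add: cnjv_def vec_eq_iff matrix_vector_mult_def)

lemma cnjv_shift: "cnjv (shift (cmat M) z v) = shift (cmat M) (cnj z) (cnjv v)"
  by (simp add: shift_def cnjv_cmat)

section \<open>Conjugate pairs and invariant flags\<close>

text \<open>A pair \<open>(z, v)\<close> stands for the eigenvalues \<open>z\<close> and \<open>cnj z\<close> with vectors \<open>v\<close> and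
  \<open>cnjv v\<close>; real eigenvalues carry real vectors, and non-real ones lie in the upper half plane.\<close>

definition gens :: "(complex \<times> (complex^'d)) list \<Rightarrow> (complex^'d) set" where
  "gens l = (\<Union>v\<in>snd ` set l. {v, cnjv v})"

lemma gens_simps [simp]:
  "gens [] = {}" "gens ((z, v) # l) = insert v (insert (cnjv v) (gens l))"
  by (auto simp: gens_def)

lemma finite_gens [simp]: "finite (gens l)"
  by (simp add: gens_def)

lemma gens_nthE:
  assumes "u \<in> gens l"
  obtains j where "j < length l" "u = snd (l ! j) \<or> u = cnjv (snd (l ! j))"
proof -
  from assms obtain a where a: "a \<in> set l" "u = snd a \<or> u = cnjv (snd a)"
    by (auto simp: gens_def)
  from a(1) obtain j where "j < length l" "l ! j = a" unfolding in_set_conv_nth by (elim exE conjE)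
  with a(2) that[of j] show ?thesis by simp
qed

lemma cnjv_gens: "v \<in> gens l \<Longrightarrow> cnjv v \<in> gens l"
  unfolding gens_def by force

abbreviation gspan :: "(complex \<times> (complex^'d)) list \<Rightarrow> (complex^'d) set" where
  "gspan l \<equiv> vec.span (gens l)"

lemma cnjv_gspan: "v \<in> gspan l \<Longrightarrow> cnjv v \<in> gspan l"
proof (induction rule: vec.span_induct_alt)
  case (step c x y)
  then show ?case by (simp add: vec.span_add vec.span_scale vec.span_base cnjv_gens)
qed (simp add: vec.span_zero)

lemma gspan_Cons_subset:
  assumes "v \<in> gspan k" "cnjv v \<in> gspan k" "gspan l \<subseteq> gspan k"
  shows "gspan ((z, v) # l) \<subseteq> gspan k"
proof (rule vec.span_minimal)
  have "gens l \<subseteq> gspan k" using assms(3) vec.span_superset by (rule order_trans[rotated])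
  with assms show "gens ((z, v) # l) \<subseteq> gspan k" by simp
qed (rule vec.subspace_span)

text \<open>The list grows at its head: its tail spans an invariant space \<open>W\<close>, and
  \<open>v\<close> is an eigenvector modulo \<open>W\<close>. For a real matrix and non-real
  \<open>z\<close>, \<open>cnjv v\<close> is then an eigenvector modulo \<open>W\<close> for
  \<open>cnj z\<close>, and the last condition makes the step worth two dimensions.\<close>

fun flag :: "complex^'d^'d \<Rightarrow> (complex \<times> (complex^'d)) list \<Rightarrow> bool" where
  "flag F [] \<longleftrightarrow> True"
| "flag F ((z, v) # l) \<longleftrightarrow> flag F l \<and> v \<notin> gspan l \<and> shift F z v \<in> gspan l \<and>
     (if Im z = 0 then cnjv v = v else 0 < Im z \<and> cnjv v \<notin> vec.span (insert v (gens l)))"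

definition pair_dim :: "complex \<Rightarrow> nat" where
  "pair_dim z = (if Im z = 0 then 1 else 2)"

lemma flag_Im_nonneg: "flag F l \<Longrightarrow> (z, v) \<in> set l \<Longrightarrow> 0 \<le> Im z"
  by (induction F l rule: flag.induct) (auto split: if_splits)

lemma flag_independent:
  "flag F l \<Longrightarrow> vec.independent (gens l) \<and> card (gens l) = (\<Sum>z\<leftarrow>map fst l. pair_dim z)"
proof (induction F l rule: flag.induct)
  case (2 F z v l)
  then have IH: "vec.independent (gens l)" "card (gens l) = (\<Sum>z\<leftarrow>map fst l. pair_dim z)"
    and v: "v \<notin> gspan l" by auto
  have ind: "vec.independent (insert v (gens l))"
    using v IH by (intro vec.independent_insertI)
  have vg: "v \<notin> gens l" using v vec.span_base[of v "gens l"] by metis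
  show ?case
  proof (cases "Im z = 0")
    case True
    then have "cnjv v = v" using 2 by simp
    then show ?thesis using True ind vg IH by (simp add: pair_dim_def)
  next
    case False
    then have c: "cnjv v \<notin> vec.span (insert v (gens l))" using 2 by simp
    have "cnjv v \<notin> insert v (gens l)"
      using c vec.span_base[of "cnjv v" "insert v (gens l)"] by metis
    moreover have "vec.independent (insert (cnjv v) (insert v (gens l)))"
      using c ind by (rule vec.independent_insertI)
    ultimately show ?thesis using False vg IH by (simp add: pair_dim_def insert_commute[of v])
  qed
qed (simp add: vec.independent_empty)

lemma flag_invariant:
  assumes "flag F l" "F = cmat M" shows "v \<in> gspan l \<Longrightarrow> F *v v \<in> gspan l"
proof -
  have gen: "F *v x \<in> gspan l" if "x \<in> gens l" for x
    using assms that
  proof (induction F l rule: flag.induct)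
    case (2 F z v l)
    let ?W = "gspan ((z, v) # l)"
    have sub: "gspan l \<subseteq> ?W" by (rule vec.span_mono) auto
    have "F *v v = shift F z v + z *s v" by (simp add: shift_def)
    moreover have "shift F z v \<in> ?W" "v \<in> ?W"
      using 2(2) sub by (auto intro: vec.span_base)
    ultimately have v: "F *v v \<in> ?W" by (simp only: vec.span_add vec.span_scale)
    from v have "cnjv (F *v v) \<in> ?W" by (rule cnjv_gspan)
    then have "F *v cnjv v \<in> ?W"
      by (simp only: 2(3) cnjv_cmat)
    moreover have "F *v x \<in> ?W" if "x \<in> gens l"
      using 2 that sub by auto
    ultimately show ?case using v 2(4) by auto
  qed simp
  show "v \<in> gspan l \<Longrightarrow> F *v v \<in> gspan l"
  proof (induction rule: vec.span_induct_alt)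
    case (step c x y)
    then show ?case using gen by (simp only: vec.add vec.scale vec.span_add vec.span_scale)
  qed (simp add: vec.zero vec.span_zero)
qed

text \<open>\<open>subspace_eq_UNIV\<close> gives an eigenvector modulo the proper subspace, and
  conjugation puts \<open>z\<close> into the closed upper half plane. It remains to make the vector
  real when \<open>z\<close> is real, and to show that a non-real step gains two dimensions.\<close>

lemma flag_extend:
  fixes M :: "real^'d^'d"
  assumes l: "flag (cmat M) l" and ne: "gspan l \<noteq> UNIV"
  obtains z v where "flag (cmat M) ((z, v) # l)"
proof -
  let ?F = "cmat M" and ?W = "gspan l"
  have "\<exists>v z. shift ?F z v \<in> ?W \<and> v \<notin> ?W"
    using subspace_eq_UNIV[of ?W ?F] ne vec.subspace_span unfolding shift_def by metis
  then obtain v0 z0 where v0: "shift ?F z0 v0 \<in> ?W" "v0 \<notin> ?W" by metis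
  obtain v z where v: "shift ?F z v \<in> ?W" "v \<notin> ?W" and z: "0 \<le> Im z"
  proof (cases "0 \<le> Im z0")
    case False
    have "shift ?F (cnj z0) (cnjv v0) \<in> ?W"
      using cnjv_gspan[OF v0(1)] by (simp add: cnjv_shift)
    moreover have "cnjv v0 \<notin> ?W" using cnjv_gspan[of "cnjv v0" l] v0(2) by auto
    ultimately show ?thesis using that[of "cnj z0" "cnjv v0"] False by simp
  qed (use that v0 in metis)
  show ?thesis
  proof (cases "Im z = 0")
    case True
    then have rz: "cnj z = z" by (simp add: complex_eq_iff)
    have cv: "shift ?F z (cnjv v) \<in> ?W"
      using cnjv_gspan[OF v(1)] rz by (simp add: cnjv_shift)
    \<comment> \<open>Up to sign these are twice the real and twice the imaginary part of
      \<open>v\<close>; not both can lie in \<open>?W\<close>, as \<open>v\<close> is a combination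
      of them.\<close>
    let ?a = "v + cnjv v" and ?b = "\<i> *s (v - cnjv v)"
    have "v = (1/2) *s (?a - \<i> *s ?b)"
      by (simp add: vec_eq_iff algebra_simps)
    then have "?a \<notin> ?W \<or> ?b \<notin> ?W"
      using v(2) vec.span_scale vec.span_diff by metis
    moreover have "shift ?F z ?a \<in> ?W" "shift ?F z ?b \<in> ?W"
      using v(1) cv unfolding shift_linear by (auto intro!: vec.span_add vec.span_scale vec.span_diff)
    moreover have "cnjv ?a = ?a" "cnjv ?b = ?b"
      by (simp_all add: vec_eq_iff algebra_simps)
    ultimately show ?thesis
      using l True that[of z ?a] that[of z ?b] by auto
  next
    case False
    have "cnjv v \<notin> vec.span (insert v (gens l))"
    proof
      \<comment> \<open>Modulo \<open>?W\<close> the vectors \<open>v\<close> and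
        \<open>cnjv v\<close> would be proportional although they belong to the different
        eigenvalues \<open>z\<close> and \<open>cnj z\<close>; applying \<open>?F - cnj z\<close>
        forces the factor \<open>a\<close> to be 0.\<close>
      assume "cnjv v \<in> vec.span (insert v (gens l))"
      then obtain a where a: "cnjv v - a *s v \<in> ?W"
        unfolding vec.span_breakdown_eq by blast
      have "shift ?F (cnj z) (cnjv v - a *s v) \<in> ?W"
        unfolding shift_def using a
        by (intro vec.span_diff[of "?F *v _"] flag_invariant[OF l refl] vec.span_scale)
      moreover have "shift ?F (cnj z) (cnjv v) \<in> ?W"
        using cnjv_gspan[OF v(1)] by (simp add: cnjv_shift)
      ultimately have "a *s shift ?F (cnj z) v \<in> ?W"
        using vec.span_diff[of "shift ?F (cnj z) (cnjv v)" _ "shift ?F (cnj z) (cnjv v - a *s v)"]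
        by (simp add: shift_linear)
      from vec.span_diff[OF this vec.span_scale[OF v(1), of a]]
      have "(a * (z - cnj z)) *s v \<in> ?W"
        by (simp add: shift_def vec.scale_right_diff_distrib vec.scale_left_diff_distrib algebra_simps)
      then have "inverse (a * (z - cnj z)) *s ((a * (z - cnj z)) *s v) \<in> ?W"
        by (rule vec.span_scale)
      moreover have "inverse t *s (t *s v) = v" if "t \<noteq> 0" for t :: complex
        using that by (simp only: vector_smult_assoc) simp
      ultimately have "a * (z - cnj z) = 0"
        using v(2) by metis
      then have "a = 0" using False by (auto simp: complex_eq_iff)
      with a cnjv_gspan[of "cnjv v" l] v(2) show False by simp
    qed
    then show ?thesis using that[of z v] l v z False by simp
  qed
qed

lemma flag_exists:
  fixes M :: "real^'d^'d"
  obtains l where "flag (cmat M) l" "gspan l = UNIV"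
proof -
  have "\<exists>l. flag (cmat M) l \<and> gspan l = UNIV"
  proof (rule ccontr)
    assume no: "\<not> ?thesis"
    \<comment> \<open>Otherwise \<open>flag_extend\<close> never stops, while every entry adds at
      least one independent vector.\<close>
    have "\<exists>l. flag (cmat M) l \<and> length l = k" for k
    proof (induction k)
      case (Suc k)
      then obtain l where l: "flag (cmat M) l" "length l = k" by blast
      with no have ne: "gspan l \<noteq> UNIV" by blast
      obtain z v where "flag (cmat M) ((z, v) # l)"
        by (rule flag_extend[OF l(1) ne])
      with l show ?case by (intro exI[of _ "(z, v) # l"] conjI) simp_all
    qed (rule exI[of _ "[]"], simp)
    from this[of "Suc (CARD('d))"] obtain l where l: "flag (cmat M) l" "length l = Suc (CARD('d))"
      by (elim exE conjE)
    have "(\<Sum>z\<leftarrow>map fst l. 1) \<le> (\<Sum>z\<leftarrow>map fst l. pair_dim z)"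
      by (rule sum_list_mono) (simp add: pair_dim_def)
    then have "length l \<le> (\<Sum>z\<leftarrow>map fst l. pair_dim z)"
      by (simp add: sum_list_triv)
    also have "\<dots> = card (gens l)" using flag_independent[OF l(1)] by simp
    also have "\<dots> \<le> vec.dim (UNIV :: (complex^'d) set)"
      using flag_independent[OF l(1)] by (intro vec.independent_card_le_dim) blast+
    also have "\<dots> = CARD('d)" unfolding vec_dim_card ..
    finally show False using l(2) by simp
  qed
  then show ?thesis using that by blast
qed

lemma flag_dim:
  fixes F :: "complex^'d^'d"
  assumes "flag F l" "gspan l = UNIV"
  shows "(\<Sum>z\<leftarrow>map fst l. pair_dim z) = CARD('d)"
proof -
  have "card (gens l) = vec.dim (UNIV :: (complex^'d) set)"
    using flag_independent[OF assms(1)] assms(2) by (intro vec.basis_card_eq_dim) auto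
  then show ?thesis
    using flag_independent[OF assms(1)] unfolding vec_dim_card by simp
qed


section \<open>Perturbation along a flag\<close>

lemma conj_invariant_real_part:
  fixes N :: "complex^'d^'d"
  assumes "N *v v = c *s v" "N *v cnjv v = c *s cnjv v" "Im c = 0"
  shows "cmat (map_matrix Re N) *v v = c *s v"
proof -
  have c: "cnj c = c" using assms(3) by (simp add: complex_eq_iff)
  \<comment> \<open>\<open>N\<close> and its entrywise conjugate act alike on \<open>v\<close>,
    hence so does their mean \<open>map_matrix Re N\<close>. This is how a matrix prescribed on
    complex vectors is made real.\<close>
  let ?N = "map_matrix cnj N"
  have "?N *v v = cnjv (N *v cnjv v)"
    by (simp add: cnjv_def vec_eq_iff matrix_vector_mult_def)
  also have "\<dots> = c *s v" by (simp add: assms c)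
  finally have "(N + ?N) *v v = 2 *s (c *s v)"
    using assms(1) by (simp only: matrix_vector_mult_add_rdistrib) (simp add: vec_eq_iff)
  moreover have "(N + ?N) *v v = 2 *s (cmat (map_matrix Re N) *v v)"
    by (simp add: vec_eq_iff matrix_vector_mult_def sum_distrib_left complex_add_cnj mult.assoc)
  ultimately show ?thesis by (simp add: vec_eq_iff)
qed

text \<open>The direction of the perturbation. Multiplying the flag vectors by their positions in
  the list separates equal eigenvalues and keeps the flag. The factors are real and serve
  \<open>v\<close> and \<open>cnjv v\<close> alike, so that \<open>G\<close> can be real and the
  imaginary parts of the eigenvalues do not move.\<close>

fun weights :: "real^'d^'d \<Rightarrow> (complex \<times> (complex^'d)) list \<Rightarrow> bool" where
  "weights G [] \<longleftrightarrow> True"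
| "weights G ((z, v) # l) \<longleftrightarrow> weights G l \<and> cmat G *v v = of_nat (length l) *s v"

lemma weights_exists:
  assumes "flag F l"
  obtains G where "weights G l"
proof -
  have "\<exists>h. \<forall>N. (\<forall>u\<in>gens l. N *v u = h u) \<longrightarrow> weights (map_matrix Re N) l"
    using assms
  proof (induction F l rule: flag.induct)
    case (2 F z v l)
    then obtain h where h: "\<And>N. (\<forall>u\<in>gens l. N *v u = h u) \<Longrightarrow> weights (map_matrix Re N) l"
      by auto
    have v: "v \<notin> gens l"
      using 2(2) vec.span_base[of v "gens l"] by auto
    then have cv: "cnjv v \<notin> gens l"
      using cnjv_gens[of "cnjv v" l] by auto
    let ?h = "\<lambda>u. if u \<in> gens l then h u else of_nat (length l) *s u"
    have "weights (map_matrix Re N) ((z, v) # l)" if N: "\<forall>u\<in>gens ((z, v) # l). N *v u = ?h u" for N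
    proof -
      have "weights (map_matrix Re N) l" using N by (intro h) auto
      moreover have "cmat (map_matrix Re N) *v v = of_nat (length l) *s v"
        using N v cv by (intro conj_invariant_real_part) auto
      ultimately show ?thesis by simp
    qed
    then show ?case by (intro exI[of _ ?h]) blast
  qed simp
  then obtain h where h: "\<And>N. (\<forall>u\<in>gens l. N *v u = h u) \<Longrightarrow> weights (map_matrix Re N) l"
    by blast
  obtain g where g: "Vector_Spaces.linear (*s) (*s) g" "\<forall>u\<in>gens l. g u = h u"
    using vec.linear_independent_extend[of "gens l" h] flag_independent[OF assms] by blast
  have "weights (map_matrix Re (matrix g)) l"
    using g(2) by (intro h) (simp add: matrix_works[OF g(1)])
  then show ?thesis by (rule that)
qed

text \<open>The diagonal of \<open>M + \<epsilon> *\<^sub>R G\<close> along the flag, one entry per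
  real vector or pair.\<close>

fun perturbed :: "real \<Rightarrow> complex list \<Rightarrow> complex list" where
  "perturbed \<epsilon> [] = []"
| "perturbed \<epsilon> (z # zs) = (z + of_real (\<epsilon> * length zs)) # perturbed \<epsilon> zs"

lemma map_Im_perturbed: "map Im (perturbed \<epsilon> zs) = map Im zs"
  by (induction zs) auto

lemma length_filter_perturbed:
  "length (filter (\<lambda>z. Im z = 0) (perturbed \<epsilon> zs)) = length (filter (\<lambda>z. Im z = 0) zs)"
  "length (filter (\<lambda>z. Im z \<noteq> 0) (perturbed \<epsilon> zs)) = length (filter (\<lambda>z. Im z \<noteq> 0) zs)"
proof -
  have "length (filter (\<lambda>z. P (Im z)) ys) = length (filter P (map Im ys))" for P and ys :: "complex list"
    by (simp add: filter_map comp_def)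
  from this[of "\<lambda>x. x = 0"] this[of "\<lambda>x. x \<noteq> 0"]
  show "length (filter (\<lambda>z. Im z = 0) (perturbed \<epsilon> zs)) = length (filter (\<lambda>z. Im z = 0) zs)"
    "length (filter (\<lambda>z. Im z \<noteq> 0) (perturbed \<epsilon> zs)) = length (filter (\<lambda>z. Im z \<noteq> 0) zs)"
    by (simp_all only: map_Im_perturbed)
qed

text \<open>Equal entries have different positions and separate for every positive
  \<open>\<epsilon>\<close>; different entries stay apart for small \<open>\<epsilon>\<close> by
  continuity.\<close>

lemma eventually_distinct_perturbed: "eventually (\<lambda>\<epsilon>::real. distinct (perturbed \<epsilon> zs)) (at_right 0)"
proof (induction zs)
  case (Cons z zs)
  \<comment> \<open>\<open>n\<close> is kept apart from the length of \<open>ys\<close>, because the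
    induction shortens the list while the head retains its position.\<close>
  have "eventually (\<lambda>\<epsilon>::real. z + of_real (\<epsilon> * n) \<notin> set (perturbed \<epsilon> ys)) (at_right 0)"
    if "length ys \<le> n" for n :: nat and ys
    using that
  proof (induction ys)
    case (Cons y ys)
    have "eventually (\<lambda>\<epsilon>::real. z + of_real (\<epsilon> * n) \<noteq> y + of_real (\<epsilon> * length ys)) (at_right 0)"
    proof (cases "z = y")
      case True
      have "eventually (\<lambda>\<epsilon>::real. \<epsilon> > 0) (at_right 0)"
        by (rule eventually_at_right_less)
      then show ?thesis
        by (rule eventually_mono) (use True Cons.prems in simp)
    next
      case False
      have "((\<lambda>\<epsilon>::real. (z + of_real (\<epsilon> * n)) - (y + of_real (\<epsilon> * length ys))) \<longlongrightarrow>
          (z + of_real ((0::real) * n)) - (y + of_real ((0::real) * length ys))) (at_right 0)"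
        by (intro tendsto_intros)
      then have "eventually (\<lambda>\<epsilon>::real. (z + of_real (\<epsilon> * n)) - (y + of_real (\<epsilon> * length ys)) \<noteq> 0) (at_right 0)"
        using False by (intro tendsto_imp_eventually_ne) auto
      then show ?thesis by (rule eventually_mono) (metis right_minus_eq)
    qed
    moreover have "eventually (\<lambda>\<epsilon>::real. z + of_real (\<epsilon> * n) \<notin> set (perturbed \<epsilon> ys)) (at_right 0)"
      using Cons by simp
    ultimately show ?case by eventually_elim simp
  qed simp
  from this[OF order_refl, of zs] Cons.IH show ?case
    by eventually_elim simp
qed simp

text \<open>On eigenvectors for other eigenvalues \<open>F - \<mu>\<close> acts by the nonzero
  scalars \<open>\<nu> - \<mu>\<close>, so it can be inverted term by term.\<close>

lemma shift_surj_on_span: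
  assumes "\<And>u. u \<in> G \<Longrightarrow> \<exists>\<nu>. \<nu> \<noteq> \<mu> \<and> F *v u = \<nu> *s u" and "w \<in> vec.span G"
  obtains r where "r \<in> vec.span G" "shift F \<mu> r = w"
proof -
  have "\<exists>r\<in>vec.span G. shift F \<mu> r = w"
    using assms(2)
  proof (induction rule: vec.span_induct_alt)
    case base
    then show ?case by (intro bexI[of _ 0]) (simp_all add: shift_linear vec.span_zero)
  next
    case (step c x y)
    then obtain r where r: "r \<in> vec.span G" "shift F \<mu> r = y" by blast
    obtain \<nu> where \<nu>: "\<nu> \<noteq> \<mu>" "F *v x = \<nu> *s x" using assms(1) step by blast
    let ?r = "(c / (\<nu> - \<mu>)) *s x + r"
    have "shift F \<mu> x = (\<nu> - \<mu>) *s x"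
      by (simp add: shift_def \<nu> vec.scale_left_diff_distrib)
    then have "shift F \<mu> ?r = (c / (\<nu> - \<mu>) * (\<nu> - \<mu>)) *s x + y"
      by (simp only: shift_linear r vector_smult_assoc)
    also have "c / (\<nu> - \<mu>) * (\<nu> - \<mu>) = c" using \<nu>(1) by simp
    finally have "shift F \<mu> ?r = c *s x + y" .
    moreover have "?r \<in> vec.span G"
      using r step by (intro vec.span_add[OF vec.span_scale[OF vec.span_base]])
    ultimately show ?case by blast
  qed
  then show ?thesis using that by blast
qed

text \<open>The counterpart of \<open>flag\<close> with true eigenvectors in place of eigenvectors
  modulo the tail; spanning is stated separately through \<open>gspan\<close>.\<close>

definition eigpairs :: "real^'d^'d \<Rightarrow> (complex \<times> (complex^'d)) list \<Rightarrow> bool" where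
  "eigpairs M l \<longleftrightarrow> (\<forall>z v. (z, v) \<in> set l \<longrightarrow> v \<noteq> 0 \<and> 0 \<le> Im z \<and> cmat M *v v = z *s v \<and> (Im z = 0 \<longrightarrow> cnjv v = v))"

lemma eigpairs_gens:
  assumes "eigpairs M l" "u \<in> gens l"
  obtains z where "z \<in> set (map fst l) \<or> cnj z \<in> set (map fst l)" "cmat M *v u = z *s u"
proof -
  have "\<exists>z v. (z, v) \<in> set l \<and> (u = v \<or> u = cnjv v)"
    using assms(2)
  proof (induction l)
    case (Cons a l)
    then show ?case by (cases a) auto
  qed simp
  then obtain z v where l: "(z, v) \<in> set l" and u: "u = v \<or> u = cnjv v"
    by (elim exE conjE)
  have v: "cmat M *v v = z *s v" using assms(1) l by (simp add: eigpairs_def)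
  have "cmat M *v cnjv v = cnj z *s cnjv v" by (simp only: cnjv_cmat[symmetric] v cnjv_simps)
  moreover from l have "fst (z, v) \<in> fst ` set l" by (rule imageI)
  then have "z \<in> set (map fst l)" by simp
  ultimately show ?thesis using u v that[of z] that[of "cnj z"] by (elim disjE) simp_all
qed

lemma eigpairs_Im_nonneg: "eigpairs M l \<Longrightarrow> z \<in> set (map fst l) \<Longrightarrow> 0 \<le> Im z"
  by (auto simp: eigpairs_def)

text \<open>Along the flag \<open>M + \<epsilon> *\<^sub>R G\<close> is triangular with distinct
  diagonal entries. At each step \<open>?F - \<mu>\<close> sends \<open>v\<close> into the span of
  the tail and is onto there, so subtracting a preimage turns \<open>v\<close> into a true
  eigenvector without changing the spans.\<close>

lemma perturbation_diagonalises:
  fixes M G :: "real^'d^'d"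
  assumes "flag (cmat M) l" "weights G l" "distinct (perturbed \<epsilon> (map fst l))"
  shows "\<exists>l'. eigpairs (M + \<epsilon> *\<^sub>R G) l' \<and> map fst l' = perturbed \<epsilon> (map fst l) \<and> gspan l' = gspan l"
proof -
  let ?M = "M + \<epsilon> *\<^sub>R G" let ?F = "cmat ?M"
  have F: "?F *v u = cmat M *v u + of_real \<epsilon> *s (cmat G *v u)" for u
    by (simp add: vec_eq_iff matrix_vector_mult_def sum.distrib sum_distrib_left algebra_simps)
  show ?thesis
    using assms
  proof (induction l)
    case (Cons a l)
    obtain z v where a: "a = (z, v)" by force
    obtain l' where l': "eigpairs ?M l'" "map fst l' = perturbed \<epsilon> (map fst l)" "gspan l' = gspan l"
      using Cons a by auto
    define \<mu> where "\<mu> = z + of_real (\<epsilon> * length l)"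
    have v: "v \<notin> gspan l" "shift (cmat M) z v \<in> gspan l" and Im: "0 \<le> Im z" "Im z = 0 \<Longrightarrow> cnjv v = v"
      using Cons.prems(1) a by (auto split: if_splits)
    have "cmat G *v v = of_nat (length l) *s v" using Cons.prems(2) a by simp
    \<comment> \<open>\<open>\<epsilon> *\<^sub>R G\<close> adds
      \<open>\<epsilon> * length l\<close> times \<open>v\<close>, exactly the amount by which
      \<open>\<mu>\<close> differs from \<open>z\<close>.\<close>
    then have sv: "shift ?F \<mu> v = shift (cmat M) z v"
      by (simp add: shift_def F \<mu>_def vec_eq_iff algebra_simps)
    have new: "\<mu> \<notin> set (map fst l')"
      unfolding l'(2) \<mu>_def using Cons.prems(3) a by simp
    \<comment> \<open>The eigenvalues on \<open>gens l'\<close> are the listed ones and their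
      conjugates. If the conjugate of a listed one met \<open>\<mu>\<close>, then
      \<open>\<mu>\<close> and \<open>cnj \<mu>\<close> would both lie in the closed upper half
      plane, so \<open>\<mu>\<close> would be real and listed itself.\<close>
    have "\<exists>\<nu>. \<nu> \<noteq> \<mu> \<and> ?F *v u = \<nu> *s u" if u: "u \<in> gens l'" for u
    proof -
      obtain \<nu> where \<nu>: "\<nu> \<in> set (map fst l') \<or> cnj \<nu> \<in> set (map fst l')" "?F *v u = \<nu> *s u"
        by (rule eigpairs_gens[OF l'(1) u])
      have "\<nu> \<noteq> \<mu>"
      proof
        assume "\<nu> = \<mu>"
        with \<nu>(1) new have c: "cnj \<mu> \<in> set (map fst l')" by metis
        from eigpairs_Im_nonneg[OF l'(1) this] Im(1) have "Im \<mu> = 0" by (simp add: \<mu>_def)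
        then have "cnj \<mu> = \<mu>" by (simp add: complex_eq_iff)
        with c new show False by metis
      qed
      with \<nu>(2) show ?thesis by blast
    qed
    then obtain r0 where r0: "r0 \<in> gspan l" "shift ?F \<mu> r0 = shift (cmat M) z v"
      using shift_surj_on_span[of "gens l'" \<mu> ?F "shift (cmat M) z v"] v(2) l'(3) by metis
    have "\<exists>r\<in>gspan l. shift ?F \<mu> r = shift (cmat M) z v \<and> (Im z = 0 \<longrightarrow> cnjv r = r)"
    proof (cases "Im z = 0")
      case True
      then have c: "cnj z = z" "cnj \<mu> = \<mu>" by (simp_all add: \<mu>_def complex_eq_iff)
      \<comment> \<open>For a real eigenvalue the real part of a preimage is again a preimage, which
        keeps the corrected vector real.\<close>
      let ?r = "(1/2) *s (r0 + cnjv r0)"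
      have "shift ?F \<mu> (cnjv r0) = cnjv (shift ?F \<mu> r0)" by (simp add: cnjv_shift c)
      also have "\<dots> = shift (cmat M) z v" using Im(2)[OF True] by (simp add: r0 cnjv_shift c)
      finally have "shift ?F \<mu> ?r = shift (cmat M) z v"
        unfolding shift_linear by (simp add: r0 vec_eq_iff)
      moreover have "?r \<in> gspan l" using r0 by (intro vec.span_scale vec.span_add cnjv_gspan)
      moreover have "cnjv ?r = ?r" by (simp add: add.commute)
      ultimately show ?thesis by blast
    qed (use r0 in blast)
    then obtain r where r: "r \<in> gspan l" "shift ?F \<mu> r = shift (cmat M) z v" "Im z = 0 \<longrightarrow> cnjv r = r"
      by blast
    let ?p = "v - r"
    have "shift ?F \<mu> ?p = 0"
      using r(2) sv by (simp only: shift_linear diff_self)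
    then have "?F *v ?p = \<mu> *s ?p"
      unfolding shift_def by (simp only: right_minus_eq)
    moreover have "?p \<noteq> 0" using r(1) v(1) by auto
    moreover have "0 \<le> Im \<mu>" "Im \<mu> = 0 \<longrightarrow> cnjv ?p = ?p" using Im r(3) by (auto simp: \<mu>_def)
    ultimately have "eigpairs ?M ((\<mu>, ?p) # l')" using l'(1) by (simp add: eigpairs_def)
    moreover have "map fst ((\<mu>, ?p) # l') = perturbed \<epsilon> (map fst (a # l))"
      using l'(2) by (simp add: a \<mu>_def)
    moreover have "gspan ((\<mu>, ?p) # l') = gspan (a # l)"
    proof (rule antisym)
      have sub: "gspan l \<subseteq> gspan (a # l)" by (rule vec.span_mono) (auto simp: a)
      have "v \<in> gspan (a # l)" by (rule vec.span_base) (simp add: a)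
      then have p: "?p \<in> gspan (a # l)" using sub r by (intro vec.span_diff) auto
      show "gspan ((\<mu>, ?p) # l') \<subseteq> gspan (a # l)"
        using p cnjv_gspan[OF p] sub by (intro gspan_Cons_subset) (simp_all only: l'(3))
      have sub': "gspan l \<subseteq> gspan ((\<mu>, ?p) # l')"
        unfolding l'(3)[symmetric] by (rule vec.span_mono) auto
      have "?p \<in> gspan ((\<mu>, ?p) # l')" by (rule vec.span_base) simp
      from vec.span_add[OF this subsetD[OF sub' r(1)]] have v': "v \<in> gspan ((\<mu>, ?p) # l')" by simp
      show "gspan (a # l) \<subseteq> gspan ((\<mu>, ?p) # l')"
        unfolding a using v' cnjv_gspan[OF v'] sub' by (rule gspan_Cons_subset)
    qed
    ultimately show ?case by blast
  qed (auto simp: eigpairs_def intro!: exI[of _ "[]"])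
qed


section \<open>Eigenvalues of a flag with multiplicity\<close>

definition pair_factor :: "complex \<Rightarrow> complex poly" where
  "pair_factor z = (if Im z = 0 then [:- z, 1:] else [:- z, 1:] * [:- cnj z, 1:])"

lemma pair_factor_monic: "lead_coeff (pair_factor z) = 1" "degree (pair_factor z) = pair_dim z"
  by (simp_all add: pair_factor_def pair_dim_def)

lemma prod_pair_factors_monic:
  "lead_coeff (\<Prod>z\<leftarrow>zs. pair_factor z) = 1 \<and>
   degree (\<Prod>z\<leftarrow>zs. pair_factor z) = (\<Sum>z\<leftarrow>zs. pair_dim z)"
proof (induction zs)
  case (Cons z zs)
  then have "pair_factor z \<noteq> 0" "(\<Prod>z\<leftarrow>zs. pair_factor z) \<noteq> 0"
    using pair_factor_monic[of z] by (metis leading_coeff_0_iff zero_neq_one)+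
  let ?f = "pair_factor z" and ?P = "\<Prod>z\<leftarrow>zs. pair_factor z"
  note lead = conjunct1[OF Cons.IH] and deg = conjunct2[OF Cons.IH]
  have "lead_coeff (?f * ?P) = lead_coeff ?f * lead_coeff ?P" by (rule lead_coeff_mult)
  also have "\<dots> = 1" unfolding pair_factor_monic(1) lead by simp
  finally have "lead_coeff (?f * ?P) = 1" .
  moreover have "degree (?f * ?P) = degree ?f + degree ?P"
    using \<open>?f \<noteq> 0\<close> \<open>?P \<noteq> 0\<close> by (rule degree_mult_eq)
  then have "degree (?f * ?P) = pair_dim z + (\<Sum>z\<leftarrow>zs. pair_dim z)"
    by (simp only: pair_factor_monic(2) deg)
  ultimately show ?case by simp
qed simp

lemma card_conj_closure:
  assumes "distinct zs" "\<And>z. z \<in> set zs \<Longrightarrow> 0 \<le> Im z"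
  shows "card (set zs \<union> cnj ` set zs) = (\<Sum>z\<leftarrow>zs. pair_dim z)"
  using assms
proof (induction zs)
  case (Cons z zs)
  let ?R = "set zs \<union> cnj ` set zs"
  have zI: "0 \<le> Im z" using Cons.prems by simp
  have new: "z \<notin> ?R"
  proof
    assume "z \<in> ?R"
    then obtain y where y: "y \<in> set zs" "z = cnj y" using Cons.prems(1) by auto
    then have "Im y = 0" using zI Cons.prems(2)[of y] by simp
    then have "z = y" using y(2) by (simp add: complex_eq_iff)
    then show False using y(1) Cons.prems(1) by simp
  qed
  then have cnew: "cnj z \<notin> ?R" by (metis (no_types, lifting) Un_iff complex_cnj_cnj image_iff)
  have eq: "set (z # zs) \<union> cnj ` set (z # zs) = insert z (insert (cnj z) ?R)" by auto
  show ?case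
  proof (cases "Im z = 0")
    case True
    then have "cnj z = z" by (simp add: complex_eq_iff)
    then show ?thesis unfolding eq using True new Cons by (simp add: pair_dim_def)
  next
    case False
    then have "z \<noteq> cnj z" by (simp add: complex_eq_iff)
    then show ?thesis unfolding eq using False new cnew Cons by (simp add: pair_dim_def)
  qed
qed simp

lemma eigpairs_root:
  assumes "eigpairs M l" "z \<in> set (map fst l)"
  shows "poly (charpoly M) z = 0" "poly (charpoly M) (cnj z) = 0"
proof -
  obtain v where v: "(z, v) \<in> set l" using assms(2) by auto
  then have v: "v \<noteq> 0" "cmat M *v v = z *s v" using assms(1) by (simp_all add: eigpairs_def)
  then show "poly (charpoly M) z = 0" unfolding charpoly_root_iff by metis
  have "cmat M *v cnjv v = cnj z *s cnjv v" by (simp only: cnjv_cmat[symmetric] v cnjv_simps)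
  moreover have "cnjv v \<noteq> 0" using v(1) by (metis cnjv_simps(4,5))
  ultimately show "poly (charpoly M) (cnj z) = 0" unfolding charpoly_root_iff by metis
qed

text \<open>Both sides have degree at most \<open>CARD('d)\<close> and the same top coefficient, and
  they vanish at the listed eigenvalues and their conjugates. Distinctness of the list makes these
  \<open>CARD('d)\<close> points.\<close>

lemma charpoly_of_eigpairs:
  fixes M :: "real^'d^'d"
  assumes l: "eigpairs M l" and d: "distinct (map fst l)" and D: "(\<Sum>z\<leftarrow>map fst l. pair_dim z) = CARD('d)"
  shows "charpoly M = (\<Prod>z\<leftarrow>map fst l. pair_factor z)"
proof (rule poly_eqI_degree_lead_coeff)
  define zs where "zs = map fst l"
  let ?q = "\<Prod>z\<leftarrow>zs. pair_factor z" and ?R = "set zs \<union> cnj ` set zs"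
  have q: "degree ?q = CARD('d)" "coeff ?q (CARD('d)) = 1"
  proof -
    show "degree ?q = CARD('d)"
      using conjunct2[OF prod_pair_factors_monic[of zs]] D unfolding zs_def by (rule trans)
    then show "coeff ?q (CARD('d)) = 1"
      using conjunct1[OF prod_pair_factors_monic[of zs]] by (simp only:)
  qed
  show "coeff (charpoly M) (CARD('d)) = coeff (\<Prod>z\<leftarrow>map fst l. pair_factor z) (CARD('d))"
    using charpoly_degree_lead[of M] q(2) unfolding zs_def by metis
  show "degree (charpoly M) \<le> CARD('d)" using charpoly_degree_lead[of M] by simp
  show "degree (\<Prod>z\<leftarrow>map fst l. pair_factor z) \<le> CARD('d)" using q(1) unfolding zs_def by simp
  show "CARD('d) \<le> card ?R"
  proof -
    have "card (set (map fst l) \<union> cnj ` set (map fst l)) = (\<Sum>z\<leftarrow>map fst l. pair_dim z)"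
      by (rule card_conj_closure[OF d]) (rule eigpairs_Im_nonneg[OF l])
    then show ?thesis unfolding D zs_def by simp
  qed
  fix x assume "x \<in> ?R"
  then obtain z where z: "z \<in> set zs" "x = z \<or> x = cnj z" by auto
  have "poly (charpoly M) x = 0"
    using z(2) eigpairs_root[of M l z] l z(1) unfolding zs_def by (elim disjE) simp_all
  moreover have "poly (pair_factor z) x = 0"
    using z(2) by (auto simp: pair_factor_def complex_eq_iff)
  then have "poly ?q x = 0"
    using z(1) by (induction zs) auto
  ultimately show "poly (charpoly M) x = poly (\<Prod>z\<leftarrow>map fst l. pair_factor z) x"
    by (simp only: zs_def)
qed

lemma tendsto_charpoly:
  "((\<lambda>\<epsilon>. poly (charpoly (M + \<epsilon> *\<^sub>R G)) x) \<longlongrightarrow> poly (charpoly M) x) (at_right 0)"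
proof -
  have "((\<lambda>\<epsilon>. poly (charpoly (M + \<epsilon> *\<^sub>R G)) x) \<longlongrightarrow> poly (charpoly (M + 0 *\<^sub>R G)) x) (at_right 0)"
    unfolding poly_charpoly det_def by (simp only: vector_minus_component nth_map_matrix vector_add_component vector_scaleR_component) (intro tendsto_intros)
  then show ?thesis by simp
qed

lemma poly_pair_factor:
  "poly (pair_factor z) x = (if Im z = 0 then x - z else (x - z) * (x - cnj z))"
  by (simp add: pair_factor_def algebra_simps)

lemma tendsto_perturbed_factors:
  "((\<lambda>\<epsilon>. poly (\<Prod>z\<leftarrow>perturbed \<epsilon> zs. pair_factor z) x) \<longlongrightarrow> poly (\<Prod>z\<leftarrow>zs. pair_factor z) x) (at_right 0)"
proof (induction zs)
  case (Cons z zs)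
  have lin: "((\<lambda>\<epsilon>. x - (w + of_real (\<epsilon> * real (length zs)))) \<longlongrightarrow> x - w) (at_right 0)" for w
  proof -
    have "((\<lambda>\<epsilon>. x - (w + of_real (\<epsilon> * real (length zs)))) \<longlongrightarrow> x - (w + of_real (0 * real (length zs)))) (at_right 0)"
      by (intro tendsto_intros)
    then show ?thesis by simp
  qed
  have "((\<lambda>\<epsilon>. poly (pair_factor (z + of_real (\<epsilon> * real (length zs)))) x) \<longlongrightarrow> poly (pair_factor z) x) (at_right 0)"
  proof (cases "Im z = 0")
    case True
    then have "(\<lambda>\<epsilon>. poly (pair_factor (z + of_real (\<epsilon> * real (length zs)))) x)
        = (\<lambda>\<epsilon>. x - (z + of_real (\<epsilon> * real (length zs))))"
      and "poly (pair_factor z) x = x - z"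
      by (simp_all add: poly_pair_factor)
    then show ?thesis using lin[of z] by (simp only:)
  next
    case False
    then have "(\<lambda>\<epsilon>. poly (pair_factor (z + of_real (\<epsilon> * real (length zs)))) x)
        = (\<lambda>\<epsilon>. (x - (z + of_real (\<epsilon> * real (length zs)))) * (x - (cnj z + of_real (\<epsilon> * real (length zs)))))"
      and "poly (pair_factor z) x = (x - z) * (x - cnj z)"
      by (simp_all add: poly_pair_factor)
    then show ?thesis using tendsto_mult[OF lin[of z] lin[of "cnj z"]] by (simp only:)
  qed
  from tendsto_mult[OF this Cons.IH] show ?case by simp
qed simp

text \<open>Multiplicities come from a limit: for small positive \<open>\<epsilon>\<close> the
  listed eigenvalues of the perturbed matrix are distinct, and both sides of the identity for it are
  continuous in \<open>\<epsilon>\<close> at every point.\<close>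

lemma charpoly_of_flag:
  fixes M :: "real^'d^'d"
  assumes l: "flag (cmat M) l" "gspan l = UNIV"
  shows "charpoly M = (\<Prod>z\<leftarrow>map fst l. pair_factor z)"
proof -
  obtain G where G: "weights G l" using weights_exists[OF l(1)] .
  have dims: "(\<Sum>z\<leftarrow>perturbed \<epsilon> zs. pair_dim z) = (\<Sum>z\<leftarrow>zs. pair_dim z)" for \<epsilon> zs
    by (induction zs) (simp_all add: pair_dim_def)
  have "eventually (\<lambda>\<epsilon>. charpoly (M + \<epsilon> *\<^sub>R G) = (\<Prod>z\<leftarrow>perturbed \<epsilon> (map fst l). pair_factor z)) (at_right 0)"
    using eventually_distinct_perturbed[of "map fst l"]
  proof (rule eventually_mono)
    fix \<epsilon> assume d: "distinct (perturbed \<epsilon> (map fst l))"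
    then obtain l' where l': "eigpairs (M + \<epsilon> *\<^sub>R G) l'" "map fst l' = perturbed \<epsilon> (map fst l)"
      using perturbation_diagonalises[OF l(1) G] by metis
    show "charpoly (M + \<epsilon> *\<^sub>R G) = (\<Prod>z\<leftarrow>perturbed \<epsilon> (map fst l). pair_factor z)"
      unfolding l'(2)[symmetric]
      using l'(1) by (rule charpoly_of_eigpairs) (simp_all only: l'(2) d dims flag_dim[OF l])
  qed
  note ev = this
  have "poly (charpoly M) x = poly (\<Prod>z\<leftarrow>map fst l. pair_factor z) x" for x
  proof (rule tendsto_unique)
    show "((\<lambda>\<epsilon>. poly (charpoly (M + \<epsilon> *\<^sub>R G)) x) \<longlongrightarrow> poly (charpoly M) x) (at_right 0)"
      by (rule tendsto_charpoly)
    show "((\<lambda>\<epsilon>. poly (charpoly (M + \<epsilon> *\<^sub>R G)) x) \<longlongrightarrow> poly (\<Prod>z\<leftarrow>map fst l. pair_factor z) x) (at_right 0)"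
      by (rule Lim_transform_eventually[OF tendsto_perturbed_factors[of "map fst l" x]])
        (rule eventually_mono[OF ev], simp only:)
  qed simp
  then show ?thesis by (simp add: poly_eq_poly_eq_iff[symmetric] fun_eq_iff)
qed

text \<open>This ties the length of a flag to the ranks in the theorem: a pair stands for two roots,
  of which only the one in the upper half plane enters \<open>num_conj_pairs\<close>.\<close>

lemma flag_counts:
  fixes M :: "real^'d^'d"
  assumes l: "flag (cmat M) l" "gspan l = UNIV"
  shows "num_real_eigvals M = length (filter (\<lambda>z. Im z = 0) (map fst l))"
    and "num_conj_pairs M = length (filter (\<lambda>z. Im z \<noteq> 0) (map fst l))"
proof -
  let ?zs = "map fst l"
  have nz: "0 \<notin> set (map pair_factor zs)" for zs
    using pair_factor_monic(1) by (auto simp: leading_coeff_0_iff[symmetric] simp del: leading_coeff_0_iff)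
  have "proots (\<Prod>z\<leftarrow>zs. pair_factor z) = (\<Sum>z\<leftarrow>zs. proots (pair_factor z))" for zs
    using proots_prod_list[OF nz[of zs]] by (simp add: comp_def)
  then have ev: "eigvals M = (\<Sum>z\<leftarrow>?zs. proots (pair_factor z))"
    unfolding eigvals_def charpoly_of_flag[OF l] by blast
  have Im: "\<And>z. z \<in> set ?zs \<Longrightarrow> 0 \<le> Im z" using flag_Im_nonneg[OF l(1)] by auto
  have roots: "proots (pair_factor z) = (if Im z = 0 then {#z#} else {#z, cnj z#})" for z
  proof (cases "Im z = 0")
    case False
    have "proots ([:- z, 1:] * [:- cnj z, 1:]) = proots [:- z, 1:] + proots [:- cnj z, 1:]"
      by (rule proots_mult) simp_all
    with False show ?thesis by (simp only: pair_factor_def if_False proots_linear_factor) simp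
  qed (simp add: pair_factor_def)
  have "size (filter_mset (\<lambda>z. Im z = 0) (\<Sum>z\<leftarrow>zs. proots (pair_factor z))) = length (filter (\<lambda>z. Im z = 0) zs)" for zs
    by (induction zs) (simp_all add: roots)
  then show "num_real_eigvals M = length (filter (\<lambda>z. Im z = 0) ?zs)"
    by (simp only: num_real_eigvals_def ev)
  have "(\<forall>z\<in>set zs. 0 \<le> Im z) \<Longrightarrow>
    size (filter_mset (\<lambda>z. Im z > 0) (\<Sum>z\<leftarrow>zs. proots (pair_factor z))) = length (filter (\<lambda>z. Im z \<noteq> 0) zs)" for zs
    by (induction zs) (auto simp add: roots)
  moreover have "\<forall>z\<in>set ?zs. 0 \<le> Im z" using Im by blast
  ultimately show "num_conj_pairs M = length (filter (\<lambda>z. Im z \<noteq> 0) ?zs)"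
    unfolding num_conj_pairs_def ev by blast
qed


section \<open>Approximation on finitely many lags\<close>

lemma tendsto_matrix_mult:
  fixes f :: "'c \<Rightarrow> real^'a^'b" and g :: "'c \<Rightarrow> real^'e^'a"
  assumes "(f \<longlongrightarrow> A) F" "(g \<longlongrightarrow> B) F"
  shows "((\<lambda>x. f x ** g x) \<longlongrightarrow> A ** B) F"
  unfolding matrix_matrix_mult_def
  by (intro vec_tendstoI) (simp, intro tendsto_sum tendsto_mult tendsto_vec_nth assms)

lemma tendsto_mat_pow:
  assumes "(f \<longlongrightarrow> A) F" shows "((\<lambda>x. mat_pow (f x) k) \<longlongrightarrow> mat_pow A k) F"
  by (induction k) (simp_all add: tendsto_matrix_mult assms)

text \<open>The shift of the zero matrix is multiplication by \<open>- z\<close>. A nonzero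
  \<open>z\<close> would bring \<open>v\<close> into the span of the tail, so every entry is an
  exact eigenvector for 0.\<close>

lemma flag_zero_eigpairs: "flag (cmat 0) l \<Longrightarrow> eigpairs 0 l"
proof (induction l)
  case (Cons a l)
  obtain z v where a: "a = (z, v)" by (cases a)
  have zero: "cmat 0 *v v = 0" by (simp add: vec_eq_iff matrix_vector_mult_def)
  have v: "v \<notin> gspan l" "shift (cmat 0) z v \<in> gspan l" "Im z = 0 \<longrightarrow> cnjv v = v"
    using Cons.prems a by (auto split: if_splits)
  have "z = 0"
  proof (rule ccontr)
    assume "z \<noteq> 0"
    have "(- inverse z) *s shift (cmat 0) z v \<in> gspan l"
      using v(2) by (rule vec.span_scale)
    moreover have "(- inverse z) *s shift (cmat 0) z v = v"
      using \<open>z \<noteq> 0\<close> by (simp add: shift_def zero vec_eq_iff)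
    ultimately show False using v(1) by simp
  qed
  moreover have "v \<noteq> 0" using v(1) vec.span_zero by auto
  moreover have "eigpairs 0 l" using Cons a by simp
  ultimately show ?case using zero v(3) by (auto simp: eigpairs_def a)
qed (simp add: eigpairs_def)

text \<open>Only finitely many powers are compared, so closeness follows from continuity in
  \<open>\<epsilon>\<close>. The clause for \<open>M = 0\<close> keeps the zero matrix itself, since
  the rate 0 ^ L leaves no tolerance there.\<close>

lemma semisimple_approximation:
  fixes M :: "real^'d^'d" and C :: "real^'d^'n" and B :: "real^'m^'d"
  assumes "\<delta> > 0"
  obtains M' l where "eigpairs M' l" "gspan l = UNIV"
    "length (filter (\<lambda>z. Im z = 0) (map fst l)) = num_real_eigvals M"
    "length (filter (\<lambda>z. Im z \<noteq> 0) (map fst l)) = num_conj_pairs M"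
    "\<And>k p q. k < L \<Longrightarrow> \<bar>(C ** mat_pow M k ** B) $ p $ q - (C ** mat_pow M' k ** B) $ p $ q\<bar> \<le> \<delta>"
    "M = 0 \<Longrightarrow> M' = 0"
proof (cases "M = 0")
  case True
  obtain l where l: "flag (cmat M) l" "gspan l = UNIV" by (rule flag_exists)
  show ?thesis
  proof (rule that)
    show "eigpairs 0 l" using l(1) True by (simp add: flag_zero_eigpairs)
    show "gspan l = UNIV" by (rule l(2))
    show "length (filter (\<lambda>z. Im z = 0) (map fst l)) = num_real_eigvals M"
      by (simp only: flag_counts[OF l])
    show "length (filter (\<lambda>z. Im z \<noteq> 0) (map fst l)) = num_conj_pairs M"
      by (simp only: flag_counts[OF l])
  qed (use True assms in simp_all)
next
  case False
  obtain l where l: "flag (cmat M) l" "gspan l = UNIV" by (rule flag_exists)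
  obtain G where G: "weights G l" using weights_exists[OF l(1)] .
  let ?H = "\<lambda>N k. C ** mat_pow N k ** B"
  have "((\<lambda>\<epsilon>. M + \<epsilon> *\<^sub>R G) \<longlongrightarrow> M + 0 *\<^sub>R G) (at_right 0)" by (intro tendsto_intros)
  then have lim: "((\<lambda>\<epsilon>. M + \<epsilon> *\<^sub>R G) \<longlongrightarrow> M) (at_right 0)" by simp
  have lim': "((\<lambda>\<epsilon>. ?H (M + \<epsilon> *\<^sub>R G) k $ p $ q) \<longlongrightarrow> ?H M k $ p $ q) (at_right 0)" for k p q
    by (intro tendsto_vec_nth tendsto_matrix_mult tendsto_const tendsto_mat_pow lim)
  have near: "eventually (\<lambda>\<epsilon>. \<bar>?H M k $ p $ q - ?H (M + \<epsilon> *\<^sub>R G) k $ p $ q\<bar> \<le> \<delta>) (at_right 0)" for k p q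
    using tendstoD[OF lim'[of k p q] assms]
    by (rule eventually_mono) (simp add: dist_real_def abs_minus_commute less_imp_le)
  have "eventually (\<lambda>\<epsilon>. \<forall>k\<in>{..<L}. \<forall>p\<in>UNIV. \<forall>q\<in>UNIV.
      \<bar>?H M k $ p $ q - ?H (M + \<epsilon> *\<^sub>R G) k $ p $ q\<bar> \<le> \<delta>) (at_right 0)"
    by (intro eventually_ball_finite finite ballI near) simp
  with eventually_distinct_perturbed[of "map fst l"]
  have "eventually (\<lambda>\<epsilon>. distinct (perturbed \<epsilon> (map fst l)) \<and> (\<forall>k\<in>{..<L}. \<forall>p\<in>UNIV. \<forall>q\<in>UNIV.
      \<bar>?H M k $ p $ q - ?H (M + \<epsilon> *\<^sub>R G) k $ p $ q\<bar> \<le> \<delta>)) (at_right 0)"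
    by (rule eventually_conj)
  then obtain \<epsilon> where \<epsilon>: "distinct (perturbed \<epsilon> (map fst l))"
    "\<And>k p q. k < L \<Longrightarrow> \<bar>?H M k $ p $ q - ?H (M + \<epsilon> *\<^sub>R G) k $ p $ q\<bar> \<le> \<delta>"
    using eventually_happens[of _ "at_right (0::real)"] by fastforce
  obtain l' where l': "eigpairs (M + \<epsilon> *\<^sub>R G) l'" "map fst l' = perturbed \<epsilon> (map fst l)" "gspan l' = gspan l"
    using perturbation_diagonalises[OF l(1) G \<epsilon>(1)] by metis
  show ?thesis
  proof (rule that[OF l'(1)])
    show "gspan l' = UNIV" using l(2) l'(3) by simp
    show "length (filter (\<lambda>z. Im z = 0) (map fst l')) = num_real_eigvals M"
      by (simp only: l'(2) length_filter_perturbed flag_counts[OF l])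
    show "length (filter (\<lambda>z. Im z \<noteq> 0) (map fst l')) = num_conj_pairs M"
      by (simp only: l'(2) length_filter_perturbed flag_counts[OF l])
  qed (use \<epsilon>(2) False in simp_all)
qed

section \<open>Expansion in eigenvectors\<close>

definition Rev :: "complex^'d \<Rightarrow> real^'d" where
  "Rev v = (\<chi> i. Re (v $ i))"

lemma Rev_simps: "Rev (x + y) = Rev x + Rev y" "Rev 0 = 0" "Rev (cvec u) = u" "Rev (cnjv x) = Rev x"
  by (simp_all add: Rev_def cvec_def cnjv_def vec_eq_iff)

text \<open>Under the real part a multiple of \<open>cnjv v\<close> equals the multiple of
  \<open>v\<close> with conjugate coefficient. Hence one complex coefficient per listed pair is
  enough, and ranks are later counted per pair.\<close>

lemma eigpairs_power_expansion:
  fixes M :: "real^'d^'d"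
  assumes l: "eigpairs M l" "gspan l = UNIV"
  shows "\<exists>\<zeta>. \<forall>k. mat_pow M k *v x = (\<Sum>i<length l. Rev ((\<zeta> i * fst (l ! i) ^ k) *s snd (l ! i)))"
proof -
  let ?F = "cmat M" and ?S = "\<lambda>\<zeta> k. \<Sum>i<length l. Rev ((\<zeta> i * fst (l ! i) ^ k) *s snd (l ! i))"
  have "\<exists>\<zeta>. \<forall>k. Rev (((*v) ?F ^^ k) w) = ?S \<zeta> k" if "w \<in> gspan l" for w
    using that
  proof (induction rule: vec.span_induct_alt)
    case base
    show ?case by (rule exI[of _ "\<lambda>_. 0"]) (simp add: funpow_mult_vec_linear Rev_simps)
  next
    case (step c x y)
    from step(2) obtain \<zeta> where "\<forall>k. Rev (((*v) ?F ^^ k) y) = ?S \<zeta> k" by (elim exE)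
    then have \<zeta>: "Rev (((*v) ?F ^^ k) y) = ?S \<zeta> k" for k by (rule spec)
    obtain j where j: "j < length l" "x = snd (l ! j) \<or> x = cnjv (snd (l ! j))"
      using step(1) by (rule gens_nthE)
    let ?z = "fst (l ! j)" and ?v = "snd (l ! j)"
    have "(?z, ?v) \<in> set l" using j(1) by simp
    then have "?F *v ?v = ?z *s ?v" using l(1) unfolding eigpairs_def by metis
    then have pow: "((*v) ?F ^^ k) ?v = ?z ^ k *s ?v" for k
      by (induction k) (simp_all add: vec.scale vector_smult_assoc mult.commute)
    have cpow: "((*v) ?F ^^ k) (cnjv u) = cnjv (((*v) ?F ^^ k) u)" for k u
      by (induction k) (simp_all add: cnjv_cmat)
    have "\<exists>d. \<forall>k. Rev (((*v) ?F ^^ k) (c *s x)) = Rev ((d * ?z ^ k) *s ?v)"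
      using j(2)
    proof
      assume "x = ?v"
      then show ?thesis
        by (intro exI[of _ c]) (simp add: funpow_mult_vec_linear pow vector_smult_assoc)
    next
      assume x: "x = cnjv ?v"
      have "c *s cnjv (?z ^ k *s ?v) = cnjv ((cnj c * ?z ^ k) *s ?v)" for k
        by (simp add: vector_smult_assoc)
      then show ?thesis
        by (intro exI[of _ "cnj c"]) (simp only: x funpow_mult_vec_linear cpow pow Rev_simps, simp)
    qed
    then obtain d where "\<forall>k. Rev (((*v) ?F ^^ k) (c *s x)) = Rev ((d * ?z ^ k) *s ?v)" by (elim exE)
    then have d: "Rev (((*v) ?F ^^ k) (c *s x)) = Rev ((d * ?z ^ k) *s ?v)" for k by (rule spec)
    let ?\<zeta> = "\<lambda>i. \<zeta> i + (if i = j then d else 0)"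
    have "Rev (((*v) ?F ^^ k) (c *s x + y)) = ?S ?\<zeta> k" for k
    proof -
      have "Rev ((?\<zeta> i * fst (l ! i) ^ k) *s snd (l ! i))
          = Rev ((\<zeta> i * fst (l ! i) ^ k) *s snd (l ! i)) + (if i = j then Rev ((d * ?z ^ k) *s ?v) else 0)" for i
        by (simp add: Rev_def vec_eq_iff algebra_simps)
      then have "?S ?\<zeta> k = ?S \<zeta> k + Rev ((d * ?z ^ k) *s ?v)"
        using j(1) by (simp add: sum.distrib)
      moreover have "Rev (((*v) ?F ^^ k) (c *s x + y)) = Rev ((d * ?z ^ k) *s ?v) + ?S \<zeta> k"
        by (simp only: funpow_mult_vec_linear(1) Rev_simps d \<zeta>)
      ultimately show ?thesis by (simp only: add.commute)
    qed
    then show ?case by (intro exI[of _ ?\<zeta>] allI)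
  qed
  from this[of "cvec x"] obtain \<zeta> where "\<forall>k. Rev (((*v) ?F ^^ k) (cvec x)) = ?S \<zeta> k"
    unfolding l(2) by (elim exE meta_impE) (rule UNIV_I)
  then have "Rev (((*v) ?F ^^ k) (cvec x)) = ?S \<zeta> k" for k by (rule spec)
  then have "mat_pow M k *v x = ?S \<zeta> k" for k
    by (simp only: mat_pow_mult_vec funpow_cmat_cvec Rev_simps)
  then show ?thesis by (intro exI[of _ \<zeta>] allI)
qed

text \<open>Each summand is the real part of a product of a factor in \<open>p\<close>, one in
  \<open>q\<close> and one in \<open>k\<close>, hence of a complex rank-one tensor. The matrix
  \<open>B\<close> enters through \<open>\<zeta>\<close>, with one expansion for each of its
  columns.\<close>

lemma eigpairs_response_expansion:
  fixes M :: "real^'d^'d" and C :: "real^'d^'n" and B :: "real^'m^'d"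
  assumes l: "eigpairs M l" "gspan l = UNIV"
  obtains \<zeta> where "\<And>k p q. (C ** mat_pow M k ** B) $ p $ q
    = (\<Sum>i<length l. Re ((cmat C *v snd (l ! i)) $ p * \<zeta> q i * fst (l ! i) ^ k))"
proof -
  have "\<exists>\<zeta>. \<forall>k. mat_pow M k *v (B *v axis q 1) = (\<Sum>i<length l. Rev ((\<zeta> i * fst (l ! i) ^ k) *s snd (l ! i)))" for q
    by (rule eigpairs_power_expansion[OF l])
  then have "\<exists>\<zeta>. \<forall>q k. mat_pow M k *v (B *v axis q 1)
      = (\<Sum>i<length l. Rev ((\<zeta> q i * fst (l ! i) ^ k) *s snd (l ! i)))"
    by (intro choice allI)
  then obtain \<zeta> where "\<forall>q k. mat_pow M k *v (B *v axis q 1)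
      = (\<Sum>i<length l. Rev ((\<zeta> q i * fst (l ! i) ^ k) *s snd (l ! i)))" by (elim exE)
  then have \<zeta>: "mat_pow M k *v (B *v axis q 1)
      = (\<Sum>i<length l. Rev ((\<zeta> q i * fst (l ! i) ^ k) *s snd (l ! i)))" for q k by (elim allE)
  have CRev: "(C *v Rev w) $ p = Re ((cmat C *v w) $ p)" for p w
    by (simp add: Rev_def matrix_vector_mult_def)
  have "(C ** mat_pow M k ** B) $ p $ q
    = (\<Sum>i<length l. Re ((cmat C *v snd (l ! i)) $ p * \<zeta> q i * fst (l ! i) ^ k))" for k p q
  proof -
    have "(C ** mat_pow M k ** B) $ p $ q = ((C ** mat_pow M k ** B) *v axis q 1) $ p"
      by (simp add: matrix_vector_mult_basis column_def)
    also have "\<dots> = (C *v (mat_pow M k *v (B *v axis q 1))) $ p"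
      by (simp only: matrix_vector_mul_assoc[symmetric])
    also have "\<dots> = (\<Sum>i<length l. (C *v Rev ((\<zeta> q i * fst (l ! i) ^ k) *s snd (l ! i))) $ p)"
      by (simp only: \<zeta> vec.sum sum_component)
    also have "\<dots> = (\<Sum>i<length l. Re ((cmat C *v snd (l ! i)) $ p * \<zeta> q i * fst (l ! i) ^ k))"
      by (simp only: CRev vec.scale vector_smult_component mult_ac)
    finally show ?thesis .
  qed
  then show ?thesis by (rule that)
qed

section \<open>The Riccati recursion\<close>

definition quad :: "real^'d^'d \<Rightarrow> real^'d \<Rightarrow> real" where
  "quad M v = v \<bullet> (M *v v)"

lemma inner_transpose: "(transpose M *v x) \<bullet> y = x \<bullet> (M *v (y :: real^'n))"
  by (simp add: dot_lmul_matrix)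

lemma symmetric_iff: "transpose M = M \<longleftrightarrow> (\<forall>x y. x \<bullet> (M *v y) = y \<bullet> (M *v (x :: real^'d)))"
proof
  assume "transpose M = M"
  then show "\<forall>x y. x \<bullet> (M *v y) = y \<bullet> (M *v x)"
    using inner_transpose[of M] by (metis inner_commute)
next
  assume s: "\<forall>x y. x \<bullet> (M *v y) = y \<bullet> (M *v x)"
  have "M $ i $ j = axis i 1 \<bullet> (M *v axis j 1)" for i j
    by (simp add: inner_axis' matrix_vector_mult_basis column_def)
  with s show "transpose M = M" by (simp add: transpose_def vec_eq_iff)
qed

lemma psd_iff: "psd M \<longleftrightarrow> (\<forall>x y. x \<bullet> (M *v y) = y \<bullet> (M *v x)) \<and> (\<forall>v. 0 \<le> quad M v)"
  by (simp add: psd_def symmetric_iff quad_def)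

lemma polarization:
  assumes "transpose M = M"
  shows "x \<bullet> (M *v y) = (quad M (x + y) - quad M (x - y)) / 4"
proof -
  have "y \<bullet> (M *v x) = x \<bullet> (M *v y)" using assms unfolding symmetric_iff by simp
  then show ?thesis
    by (simp add: quad_def matrix_vector_right_distrib matrix_vector_mult_diff_distrib inner_add_left
        inner_diff_left inner_add_right inner_diff_right)
qed

lemma quad_bound: obtains c where "0 \<le> c" "\<And>v. \<bar>quad M v\<bar> \<le> c * (norm v)\<^sup>2"
proof -
  have b: "norm (M *v v) \<le> onorm ((*v) M) * norm v" for v
    by (rule onorm) (rule matrix_vector_mul_bounded_linear)
  have "\<bar>quad M v\<bar> \<le> onorm ((*v) M) * (norm v)\<^sup>2" for v
  proof -
    have "\<bar>quad M v\<bar> \<le> norm v * norm (M *v v)"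
      unfolding quad_def by (rule Cauchy_Schwarz_ineq2)
    also have "\<dots> \<le> norm v * (onorm ((*v) M) * norm v)"
      by (intro mult_left_mono b) simp
    finally show ?thesis by (simp add: power2_eq_square mult_ac)
  qed
  then show ?thesis using that[of "onorm ((*v) M)"] onorm_pos_le[OF matrix_vector_mul_bounded_linear] by blast
qed

lemma tendsto_quad: "(f \<longlongrightarrow> M) F \<Longrightarrow> ((\<lambda>x. quad (f x) v) \<longlongrightarrow> quad M v) F"
  unfolding quad_def matrix_vector_mult_def inner_vec_def
  by (simp, intro tendsto_sum tendsto_mult tendsto_const tendsto_vec_nth)

lemma tendsto_of_quad:
  assumes "\<And>x. transpose (f x) = f x" "transpose M = M" "\<And>v. ((\<lambda>x. quad (f x) v) \<longlongrightarrow> quad M v) F"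
  shows "(f \<longlongrightarrow> M) F"
proof (intro vec_tendstoI)
  fix i j
  have entry: "N $ i $ j = (quad N (axis i 1 + axis j 1) - quad N (axis i 1 - axis j 1)) / 4"
    if "transpose N = N" for N :: "real^'b^'b"
    using polarization[OF that, of "axis i 1" "axis j 1"]
    by (simp add: inner_axis' matrix_vector_mult_basis column_def)
  show "((\<lambda>x. f x $ i $ j) \<longlongrightarrow> M $ i $ j) F"
    unfolding entry[OF assms(1)] entry[OF assms(2)]
    by (intro tendsto_divide tendsto_diff assms(3) tendsto_const) simp
qed

text \<open>By polarization the entries of a symmetric matrix are differences of values of its
  quadratic form, so monotone scalar sequences can decide the convergence of matrices.\<close>

lemma convergent_of_quad:
  fixes f :: "nat \<Rightarrow> real^'d^'d"
  assumes "\<And>n. transpose (f n) = f n" "\<And>v. convergent (\<lambda>n. quad (f n) v)"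
  obtains M where "f \<longlonglongrightarrow> M"
proof -
  have entry: "f n $ i $ j = (quad (f n) (axis i 1 + axis j 1) - quad (f n) (axis i 1 - axis j 1)) / 4" for n i j
    using polarization[OF assms(1), of "axis i 1" n "axis j 1"]
    by (simp add: inner_axis' matrix_vector_mult_basis column_def)
  have q: "(\<lambda>n. quad (f n) v) \<longlonglongrightarrow> lim (\<lambda>n. quad (f n) v)" for v
    using assms(2) unfolding convergent_LIMSEQ_iff .
  have "convergent (\<lambda>n. f n $ i $ j)" for i j
    using convergentI[OF tendsto_divide[OF tendsto_diff[OF q[of "axis i 1 + axis j 1"] q[of "axis i 1 - axis j 1"]]
        tendsto_const[of 4]]] by (simp add: entry)
  then have "(\<lambda>n. f n $ i $ j) \<longlonglongrightarrow> lim (\<lambda>n. f n $ i $ j)" for i j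
    unfolding convergent_LIMSEQ_iff .
  then have "f \<longlonglongrightarrow> (\<chi> i j. lim (\<lambda>n. f n $ i $ j))"
    by (intro vec_tendstoI) simp
  then show ?thesis by (rule that)
qed

lemma pos_def_invertible:
  assumes "pos_def M" shows "invertible M"
proof -
  have "M *v v = 0 \<Longrightarrow> v = 0" for v
    using assms unfolding pos_def_def by (metis inner_zero_right less_irrefl)
  then show ?thesis
    unfolding invertible_left_inverse matrix_left_invertible_ker by blast
qed

lemma matrix_inv_mult_vec:
  fixes M :: "real^'d^'d"
  assumes "invertible M"
  shows "M *v (matrix_inv M *v x) = x"
proof -
  have "M ** matrix_inv M = mat 1"
    using assms unfolding invertible_def matrix_inv_def by (rule someI_ex[THEN conjunct1])
  then show ?thesis by (simp add: matrix_vector_mul_assoc)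
qed

lemma tendsto_det:
  fixes f :: "'c \<Rightarrow> real^'d^'d"
  shows "(f \<longlongrightarrow> M) F \<Longrightarrow> ((\<lambda>x. det (f x)) \<longlongrightarrow> det M) F"
  unfolding det_def by (intro tendsto_sum tendsto_mult tendsto_const tendsto_prod tendsto_vec_nth)

text \<open>Cramer's rule writes each entry of the inverse as a quotient of determinants, which are
  polynomials in the entries.\<close>

lemma tendsto_matrix_inv:
  fixes f :: "'c \<Rightarrow> real^'d^'d"
  assumes f: "(f \<longlongrightarrow> M) F" and M: "det M \<noteq> 0"
  shows "((\<lambda>x. matrix_inv (f x)) \<longlongrightarrow> matrix_inv M) F"
proof (intro vec_tendstoI)
  fix k j
  let ?N = "\<lambda>X :: real^'d^'d. \<chi> i l. if l = k then axis j 1 $ i else X $ i $ l"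
  have entry: "matrix_inv X $ k $ j = det (?N X) / det X" if "det X \<noteq> 0" for X :: "real^'d^'d"
  proof -
    have "X *v (matrix_inv X *v axis j 1) = axis j 1"
      using that by (intro matrix_inv_mult_vec) (simp add: invertible_det_nz)
    then have "matrix_inv X *v axis j 1
        = (\<chi> k. det (\<chi> i l. if l = k then axis j 1 $ i else X $ i $ l) / det X)"
      unfolding cramer[OF that] .
    then have "(matrix_inv X *v axis j 1) $ k = det (?N X) / det X" by simp
    then show ?thesis by (simp add: matrix_vector_mult_basis column_def)
  qed
  have "((\<lambda>x. ?N (f x)) \<longlongrightarrow> ?N M) F"
  proof (intro vec_tendstoI)
    fix i l
    show "((\<lambda>x. ?N (f x) $ i $ l) \<longlongrightarrow> ?N M $ i $ l) F"
      using tendsto_vec_nth[OF tendsto_vec_nth[OF f]] by (cases "l = k") simp_all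
  qed
  then have "((\<lambda>x. det (?N (f x)) / det (f x)) \<longlongrightarrow> det (?N M) / det M) F"
    by (intro tendsto_divide tendsto_det f M)
  then have "((\<lambda>x. det (?N (f x)) / det (f x)) \<longlongrightarrow> matrix_inv M $ k $ j) F"
    by (simp only: entry[OF M])
  moreover have "eventually (\<lambda>x. det (f x) \<noteq> 0) F"
    by (rule tendsto_imp_eventually_ne[OF tendsto_det[OF f] M])
  then have "eventually (\<lambda>x. det (?N (f x)) / det (f x) = matrix_inv (f x) $ k $ j) F"
    by (rule eventually_mono) (rule entry[symmetric])
  ultimately show "((\<lambda>x. matrix_inv (f x) $ k $ j) \<longlongrightarrow> matrix_inv M $ k $ j) F"
    by (rule Lim_transform_eventually)
qed

lemma eigvals_transpose: "eigvals (transpose M) = eigvals M"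
proof -
  have "mat z - cmat (transpose M) = transpose (mat z - cmat M)" for z
    by (simp add: transpose_def vec_eq_iff mat_def)
  then have "poly (charpoly (transpose M)) z = poly (charpoly M) z" for z
    by (simp add: poly_charpoly)
  then have "charpoly (transpose M) = charpoly M"
    by (simp add: poly_eq_poly_eq_iff[symmetric] fun_eq_iff)
  then show ?thesis by (simp add: eigvals_def)
qed

lemma stable_iff_lambda_max: "stable_matrix M \<longleftrightarrow> lambda_max M < 1"
  using lambda_max_attained[of M] eigval_le_lambda_max[of _ M] unfolding stable_matrix_def
  by (metis le_less_trans)

lemma stable_transpose: "stable_matrix (transpose M) \<longleftrightarrow> stable_matrix M"
  by (simp add: stable_matrix_def eigvals_transpose)

lemma stable_pow_bound:
  assumes "stable_matrix M"
  obtains c \<rho> where "0 \<le> c" "0 \<le> \<rho>" "\<rho> < 1" "\<And>k x. norm (((*v) M ^^ k) x) \<le> c * \<rho> ^ k * norm x"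
proof -
  obtain \<rho> where \<rho>: "lambda_max M < \<rho>" "\<rho> < 1"
    using assms dense unfolding stable_iff_lambda_max by blast
  obtain c where "0 \<le> c" "\<And>k x. norm (mat_pow M k *v x) \<le> c * \<rho> ^ k * norm x"
    by (rule mat_pow_bound[OF \<rho>(1)]) (rule that)
  then show ?thesis
    using that[of c \<rho>] \<rho> lambda_max_nonneg[of M] by (simp add: mat_pow_mult_vec)
qed


section \<open>The Riccati map as a minimum\<close>

definition innov_cov :: "real^'d^'n \<Rightarrow> real^'n^'n \<Rightarrow> real^'d^'d \<Rightarrow> real^'n^'n" where
  "innov_cov C R P = C ** P ** transpose C + R"

text \<open>One Riccati step is a minimisation over the control \<open>u\<close> of the dual regulator problem.\<close>

definition dual_cost :: "real^'d^'n \<Rightarrow> real^'n^'n \<Rightarrow> real^'d^'d \<Rightarrow> real^'d \<Rightarrow> real^'n \<Rightarrow> real" where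
  "dual_cost C R P w u = quad P (w - transpose C *v u) + quad R u"

text \<open>A measurement update followed by a prediction, so the iterates are predictive
  covariances.\<close>

definition riccati :: "real^'d^'d \<Rightarrow> real^'d^'n \<Rightarrow> real^'d^'d \<Rightarrow> real^'n^'n \<Rightarrow> real^'d^'d \<Rightarrow> real^'d^'d" where
  "riccati A C Q R P = pred_cov A Q ((mat 1 - gain_of C R P ** C) ** P)"

context
  fixes A Q :: "real^'d^'d" and C :: "real^'d^'n" and R :: "real^'n^'n"
  assumes stable: "stable_matrix A" and Q: "psd Q" and R: "pos_def R"
begin

lemma quad_R_pos: "u \<noteq> 0 \<Longrightarrow> 0 < quad R u"
  using R by (simp add: pos_def_def quad_def)

lemma quad_R_nonneg: "0 \<le> quad R u"
  using quad_R_pos[of u] by (cases "u = 0") (simp_all add: quad_def)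

lemma quad_Q_nonneg: "0 \<le> quad Q v"
  using Q by (simp add: psd_iff)

lemma innov_cov_mult: "innov_cov C R P *v u = C *v (P *v (transpose C *v u)) + R *v u"
  unfolding innov_cov_def by (simp only: matrix_vector_mult_add_rdistrib matrix_vector_mul_assoc[symmetric])

lemma innov_cov_pos_def:
  assumes "psd P" shows "pos_def (innov_cov C R P)"
proof -
  have bil: "u \<bullet> (innov_cov C R P *v u') = (transpose C *v u) \<bullet> (P *v (transpose C *v u')) + u \<bullet> (R *v u')" for u u'
    by (simp only: innov_cov_mult inner_add_right inner_transpose)
  have "u \<bullet> (innov_cov C R P *v u') = u' \<bullet> (innov_cov C R P *v u)" for u u'
    using assms R unfolding bil psd_iff pos_def_def symmetric_iff by metis
  moreover have "0 < u \<bullet> (innov_cov C R P *v u)" if "u \<noteq> 0" for u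
    unfolding bil using quad_R_pos[OF that] conjunct2[OF assms[unfolded psd_def]]
    by (intro add_nonneg_pos) (simp_all only: quad_def)
  ultimately show ?thesis unfolding pos_def_def symmetric_iff by (intro conjI allI impI)
qed

lemma innov_cov_symmetric: "psd P \<Longrightarrow> u \<bullet> (innov_cov C R P *v u') = u' \<bullet> (innov_cov C R P *v u)"
  using conjunct1[OF innov_cov_pos_def[of P, unfolded pos_def_def]] unfolding symmetric_iff by simp

text \<open>The minimiser of \<open>dual_cost\<close> over \<open>u\<close>, from the normal
  equations with matrix \<open>innov_cov C R P\<close>; it turns out to be the transposed Kalman
  gain applied to \<open>w\<close>.\<close>

definition best_control :: "real^'d^'d \<Rightarrow> real^'d \<Rightarrow> real^'n" where
  "best_control P w = matrix_inv (innov_cov C R P) *v (C *v (P *v w))"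

lemma innov_best_control: "psd P \<Longrightarrow> innov_cov C R P *v best_control P w = C *v (P *v w)"
  unfolding best_control_def by (intro matrix_inv_mult_vec pos_def_invertible innov_cov_pos_def)

text \<open>Completing the square in \<open>u\<close>: the minimum and the excess of any other
  control can be read off.\<close>

lemma dual_cost_square:
  assumes "psd P"
  shows "dual_cost C R P w u = w \<bullet> (P *v w) - best_control P w \<bullet> (C *v (P *v w))
    + quad (innov_cov C R P) (u - best_control P w)"
proof -
  let ?S = "innov_cov C R P" and ?b = "best_control P w"
  have sP: "x \<bullet> (P *v y) = y \<bullet> (P *v x)" for x y using assms unfolding psd_iff by blast
  have b: "?S *v ?b = C *v (P *v w)" by (rule innov_best_control[OF assms])
  have bS: "?b \<bullet> (?S *v u) = u \<bullet> (C *v (P *v w))"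
    unfolding innov_cov_symmetric[OF assms, of ?b u] b ..
  have "quad ?S (u - ?b) = u \<bullet> (?S *v u) - 2 * (u \<bullet> (C *v (P *v w))) + ?b \<bullet> (C *v (P *v w))"
    unfolding quad_def matrix_vector_mult_diff_distrib inner_diff_left inner_diff_right b bS by simp
  moreover have "u \<bullet> (?S *v u) = (transpose C *v u) \<bullet> (P *v (transpose C *v u)) + quad R u"
    by (simp only: innov_cov_mult inner_add_right inner_transpose quad_def)
  moreover have "u \<bullet> (C *v (P *v w)) = w \<bullet> (P *v (transpose C *v u))"
    unfolding sP[of w] by (simp only: inner_transpose)
  moreover have "quad P (w - transpose C *v u)
    = w \<bullet> (P *v w) - 2 * (w \<bullet> (P *v (transpose C *v u))) + (transpose C *v u) \<bullet> (P *v (transpose C *v u))"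
    unfolding quad_def matrix_vector_mult_diff_distrib inner_diff_left inner_diff_right
      sP[of "transpose C *v u" w] by simp
  ultimately show ?thesis unfolding dual_cost_def by simp
qed

lemma gain_mult: "gain_of C R P *v x = P *v (transpose C *v (matrix_inv (innov_cov C R P) *v x))"
  unfolding gain_of_def innov_cov_def by (simp only: matrix_vector_mul_assoc[symmetric])

lemma riccati_mult:
  "riccati A C Q R P *v v
    = A *v (P *v (transpose A *v v) - P *v (transpose C *v best_control P (transpose A *v v))) + Q *v v"
proof -
  have "riccati A C Q R P *v v
      = A *v ((mat 1 - gain_of C R P ** C) *v (P *v (transpose A *v v))) + Q *v v"
    unfolding riccati_def pred_cov_def
    by (simp only: matrix_vector_mult_add_rdistrib matrix_vector_mul_assoc[symmetric])
  moreover have "(mat 1 - gain_of C R P ** C) *v x = x - gain_of C R P *v (C *v x)" for x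
    by (simp only: matrix_vector_mult_diff_rdistrib matrix_vector_mul_lid matrix_vector_mul_assoc[symmetric])
  ultimately show ?thesis by (simp only: gain_mult best_control_def)
qed

lemma riccati_bilinear:
  assumes "psd P"
  shows "x \<bullet> (riccati A C Q R P *v y) = (transpose A *v x) \<bullet> (P *v (transpose A *v y))
    - (C *v (P *v (transpose A *v x))) \<bullet> best_control P (transpose A *v y) + x \<bullet> (Q *v y)"
proof -
  let ?x = "transpose A *v x" and ?b = "best_control P (transpose A *v y)"
  have sP: "x \<bullet> (P *v y) = y \<bullet> (P *v x)" for x y using assms unfolding psd_iff by blast
  let ?z = "P *v (transpose A *v y) - P *v (transpose C *v ?b)"
  have "x \<bullet> (A *v ?z) = ?x \<bullet> ?z" by (rule inner_transpose[symmetric])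
  moreover have "?x \<bullet> ?z = ?x \<bullet> (P *v (transpose A *v y)) - ?x \<bullet> (P *v (transpose C *v ?b))"
    by (rule inner_diff_right)
  moreover have "?x \<bullet> (P *v (transpose C *v ?b)) = (transpose C *v ?b) \<bullet> (P *v ?x)" by (rule sP)
  moreover have "\<dots> = ?b \<bullet> (C *v (P *v ?x))" by (rule inner_transpose)
  moreover have "\<dots> = (C *v (P *v ?x)) \<bullet> ?b" by (rule inner_commute)
  ultimately show ?thesis by (simp only: riccati_mult inner_add_right)
qed

lemma quad_riccati:
  assumes "psd P"
  shows "quad (riccati A C Q R P) v
    = dual_cost C R P (transpose A *v v) (best_control P (transpose A *v v)) + quad Q v"
  unfolding dual_cost_square[OF assms] quad_def[of "riccati A C Q R P"] riccati_bilinear[OF assms]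
  by (simp add: quad_def inner_commute del: transpose_matrix_vector)

text \<open>The later estimates differ only in the control that they insert here: that of a larger
  covariance, zero, or that of the fixed point.\<close>

lemma quad_riccati_le:
  assumes "psd P"
  shows "quad (riccati A C Q R P) v \<le> dual_cost C R P (transpose A *v v) u + quad Q v"
proof -
  have "0 \<le> quad (innov_cov C R P) x" for x
    using innov_cov_pos_def[OF assms] unfolding pos_def_def quad_def by (cases "x = 0") (auto simp: le_less)
  then show ?thesis
    unfolding quad_riccati[OF assms] dual_cost_square[OF assms, of _ u]
      dual_cost_square[OF assms, of _ "best_control P (transpose A *v v)"]
    by (simp add: quad_def del: transpose_matrix_vector)
qed

lemma dual_cost_nonneg: "psd P \<Longrightarrow> 0 \<le> dual_cost C R P w u"
  unfolding dual_cost_def psd_iff by (intro add_nonneg_nonneg quad_R_nonneg) blast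

lemma psd_riccati:
  assumes "psd P" shows "psd (riccati A C Q R P)"
  unfolding psd_iff
proof (intro conjI allI)
  fix x y
  have "(C *v (P *v (transpose A *v x))) \<bullet> best_control P (transpose A *v y)
      = (C *v (P *v (transpose A *v y))) \<bullet> best_control P (transpose A *v x)"
    using innov_cov_symmetric[OF assms, of "best_control P (transpose A *v y)" "best_control P (transpose A *v x)"]
    unfolding innov_best_control[OF assms] by (simp only: inner_commute)
  then show "x \<bullet> (riccati A C Q R P *v y) = y \<bullet> (riccati A C Q R P *v x)"
    using assms Q unfolding riccati_bilinear[OF assms] psd_iff by metis
  show "0 \<le> quad (riccati A C Q R P) x"
    unfolding quad_riccati[OF assms] by (intro add_nonneg_nonneg dual_cost_nonneg assms quad_Q_nonneg)
qed

lemma riccati_mono: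
  assumes "psd P" "psd P'" "\<And>v. quad P v \<le> quad P' v"
  shows "quad (riccati A C Q R P) v \<le> quad (riccati A C Q R P') v"
proof -
  let ?u = "best_control P' (transpose A *v v)"
  have "quad (riccati A C Q R P) v \<le> dual_cost C R P (transpose A *v v) ?u + quad Q v"
    by (rule quad_riccati_le[OF assms(1)])
  also have "\<dots> \<le> dual_cost C R P' (transpose A *v v) ?u + quad Q v"
    unfolding dual_cost_def by (intro add_right_mono assms(3))
  also have "\<dots> = quad (riccati A C Q R P') v" by (rule quad_riccati[OF assms(2), symmetric])
  finally show ?thesis .
qed

lemma tendsto_gain:
  assumes "(f \<longlongrightarrow> P) F" "psd P"
  shows "((\<lambda>x. gain_of C R (f x)) \<longlongrightarrow> gain_of C R P) F"
proof -
  have "((\<lambda>x. innov_cov C R (f x)) \<longlongrightarrow> innov_cov C R P) F"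
    unfolding innov_cov_def by (intro tendsto_add tendsto_matrix_mult tendsto_const assms)
  moreover have "det (innov_cov C R P) \<noteq> 0"
    using pos_def_invertible[OF innov_cov_pos_def[OF assms(2)]] by (simp add: invertible_det_nz)
  ultimately have "((\<lambda>x. matrix_inv (innov_cov C R (f x))) \<longlongrightarrow> matrix_inv (innov_cov C R P)) F"
    by (rule tendsto_matrix_inv)
  then show ?thesis
    unfolding gain_of_def innov_cov_def by (intro tendsto_matrix_mult tendsto_const assms)
qed

lemma tendsto_riccati:
  assumes "(f \<longlongrightarrow> P) F" "psd P"
  shows "((\<lambda>x. riccati A C Q R (f x)) \<longlongrightarrow> riccati A C Q R P) F"
  unfolding riccati_def pred_cov_def
  by (intro tendsto_add tendsto_matrix_mult tendsto_diff tendsto_const tendsto_gain assms)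

lemma psd_limit:
  assumes "f \<longlonglongrightarrow> P" "\<And>n. psd (f n)"
  shows "psd P"
proof -
  have entry: "f n $ i $ j = f n $ j $ i" for n i j
    using assms(2)[of n] unfolding psd_def by (metis transpose_def vec_lambda_beta)
  have "(\<lambda>n. f n $ i $ j) \<longlonglongrightarrow> P $ i $ j" for i j
    by (intro tendsto_vec_nth assms(1))
  then have "P $ i $ j = P $ j $ i" for i j
    using LIMSEQ_unique entry by (metis (no_types, lifting) ext)
  then have "transpose P = P" by (simp add: transpose_def vec_eq_iff)
  moreover have "0 \<le> quad P v" for v
    using assms(2) unfolding psd_iff by (intro LIMSEQ_le_const[OF tendsto_quad[OF assms(1)]]) blast
  ultimately show ?thesis by (simp add: psd_def quad_def)
qed

section \<open>Iterates of the Riccati map\<close>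

lemma psd_iterates: "psd P \<Longrightarrow> psd ((riccati A C Q R ^^ k) P)"
  by (induction k) (simp_all add: psd_riccati)

lemma iterates_mono:
  assumes "psd P" "psd P'" "\<And>v. quad P v \<le> quad P' v"
  shows "quad ((riccati A C Q R ^^ k) P) v \<le> quad ((riccati A C Q R ^^ k) P') v"
  by (induction k arbitrary: v) (simp_all add: assms riccati_mono psd_iterates)

lemma psd_0: "psd (0 :: real^'d^'d)" and quad_0: "quad (0 :: real^'d^'d) v = 0"
  by (simp_all add: psd_iff quad_def)

text \<open>Inserting the control 0 bounds the iterates by the values of \<open>Q\<close> summed
  along the orbit of \<open>v\<close> under the transpose of \<open>A\<close>, and stability makes
  this sum geometric.\<close>

lemma iterates_zero_bounded: "\<exists>b. \<forall>k. quad ((riccati A C Q R ^^ k) 0) v \<le> b"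
proof -
  let ?T = "(*v) (transpose A)"
  obtain c \<rho> where c: "0 \<le> c" "0 \<le> \<rho>" "\<rho> < 1" "\<And>k x. norm ((?T ^^ k) x) \<le> c * \<rho> ^ k * norm x"
    using stable_pow_bound[of "transpose A"] stable by (auto simp: stable_transpose)
  obtain q where q: "0 \<le> q" "\<And>v. \<bar>quad Q v\<bar> \<le> q * (norm v)\<^sup>2"
    by (rule quad_bound[of Q]) (rule that)
  have step: "quad ((riccati A C Q R ^^ k) 0) v \<le> (\<Sum>j<k. quad Q ((?T ^^ j) v))" for k v
  proof (induction k arbitrary: v)
    case (Suc k)
    let ?P = "(riccati A C Q R ^^ k) 0"
    have "quad ((riccati A C Q R ^^ Suc k) 0) v \<le> dual_cost C R ?P (?T v) 0 + quad Q v"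
      using quad_riccati_le[OF psd_iterates[OF psd_0]] by simp
    also have "dual_cost C R ?P (?T v) 0 = quad ?P (?T v)" by (simp add: dual_cost_def quad_def)
    also have "\<dots> \<le> (\<Sum>j<k. quad Q ((?T ^^ j) (?T v)))" by (rule Suc.IH)
    also have "(\<Sum>j<k. quad Q ((?T ^^ j) (?T v))) + quad Q v = (\<Sum>j<Suc k. quad Q ((?T ^^ j) v))"
      by (simp only: sum.lessThan_Suc_shift funpow_Suc_right o_apply funpow_0 add.commute)
    finally show ?case by (simp only: add_right_mono)
  qed (simp add: quad_0)
  have summand: "quad Q ((?T ^^ j) v) \<le> q * (c * norm v)\<^sup>2 * (\<rho>\<^sup>2) ^ j" for j v
  proof -
    have "quad Q ((?T ^^ j) v) \<le> q * (norm ((?T ^^ j) v))\<^sup>2" using q(2) abs_le_D1 by blast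
    also have "\<dots> \<le> q * (c * \<rho> ^ j * norm v)\<^sup>2"
      by (intro mult_left_mono power_mono c q) simp
    finally show ?thesis by (simp add: power_mult_distrib power_mult[symmetric] mult_ac)
  qed
  have r: "\<rho>\<^sup>2 < 1" using c by (simp add: power_less_one_iff abs_square_less_1)
  have "quad ((riccati A C Q R ^^ k) 0) v \<le> q * (c * norm v)\<^sup>2 * (1 / (1 - \<rho>\<^sup>2))" for k
  proof -
    have "quad ((riccati A C Q R ^^ k) 0) v \<le> (\<Sum>j<k. q * (c * norm v)\<^sup>2 * (\<rho>\<^sup>2) ^ j)"
      by (rule order_trans[OF step sum_mono[OF summand]])
    also have "\<dots> = q * (c * norm v)\<^sup>2 * (\<Sum>j<k. (\<rho>\<^sup>2) ^ j)" by (simp add: sum_distrib_left)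
    also have "(\<Sum>j<k. (\<rho>\<^sup>2) ^ j) \<le> (\<Sum>j. (\<rho>\<^sup>2) ^ j)"
      using r by (intro sum_le_suminf summable_geometric) auto
    also have "(\<Sum>j. (\<rho>\<^sup>2) ^ j) = 1 / (1 - \<rho>\<^sup>2)" using r by (intro suminf_geometric) simp
    finally show ?thesis using q(1) by (simp add: mult_left_mono)
  qed
  then show ?thesis by blast
qed

lemma riccati_fixpoint:
  obtains P where "psd P" "riccati A C Q R P = P" "(\<lambda>k. (riccati A C Q R ^^ k) 0) \<longlonglongrightarrow> P"
proof -
  let ?Z = "\<lambda>k. (riccati A C Q R ^^ k) 0"
  have psd: "psd (?Z k)" for k by (rule psd_iterates[OF psd_0])
  have "quad (?Z k) v \<le> quad (?Z (Suc k)) v" for k v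
  proof -
    have "quad 0 v \<le> quad (riccati A C Q R 0) v" for v
      using psd_riccati[OF psd_0] unfolding quad_0 psd_iff by blast
    then have "quad (?Z k) v \<le> quad ((riccati A C Q R ^^ k) (riccati A C Q R 0)) v"
      by (intro iterates_mono psd_0 psd_riccati)
    then show ?thesis by (simp only: funpow_Suc_right o_apply)
  qed
  then have inc: "incseq (\<lambda>k. quad (?Z k) v)" for v by (rule incseq_SucI)
  have conv: "convergent (\<lambda>k. quad (?Z k) v)" for v
  proof -
    obtain b where b: "\<forall>k. quad (?Z k) v \<le> b" using iterates_zero_bounded[of v] by (elim exE)
    obtain l where "(\<lambda>k. quad (?Z k) v) \<longlonglongrightarrow> l"
      using inc b by (rule incseq_convergent)
    then show ?thesis by (rule convergentI)
  qed
  have sym: "transpose (?Z k) = ?Z k" for k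
    by (rule conjunct1[OF psd[unfolded psd_def]])
  obtain P where P: "?Z \<longlonglongrightarrow> P" by (rule convergent_of_quad[OF sym conv])
  have psdP: "psd P" by (rule psd_limit[OF P psd])
  have "(\<lambda>k. ?Z (Suc k)) \<longlonglongrightarrow> riccati A C Q R P"
    using tendsto_riccati[OF P psdP] by simp
  moreover have "(\<lambda>k. ?Z (Suc k)) \<longlonglongrightarrow> P" by (rule LIMSEQ_Suc[OF P])
  ultimately have "riccati A C Q R P = P" by (rule LIMSEQ_unique)
  with psdP show ?thesis using P by (rule that)
qed

section \<open>Stability of the closed loop\<close>

lemma gain_transpose:
  assumes "psd P"
  shows "transpose (gain_of C R P) *v w = best_control P w"
proof -
  let ?S = "innov_cov C R P"
  have sP: "x \<bullet> (P *v y) = y \<bullet> (P *v x)" for x y using assms unfolding psd_iff by blast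
  have S: "?S *v (matrix_inv ?S *v x) = x" for x
    by (intro matrix_inv_mult_vec pos_def_invertible innov_cov_pos_def assms)
  have "(transpose (gain_of C R P) *v w) \<bullet> y = best_control P w \<bullet> y" for y
  proof -
    let ?i = "matrix_inv ?S *v y"
    have "(transpose (gain_of C R P) *v w) \<bullet> y = w \<bullet> (gain_of C R P *v y)" by (rule inner_transpose)
    also have "\<dots> = w \<bullet> (P *v (transpose C *v ?i))" by (simp only: gain_mult)
    also have "\<dots> = (transpose C *v ?i) \<bullet> (P *v w)" by (rule sP)
    also have "\<dots> = ?i \<bullet> (C *v (P *v w))" by (rule inner_transpose)
    also have "\<dots> = ?i \<bullet> (?S *v best_control P w)" by (simp only: innov_best_control[OF assms])
    also have "\<dots> = best_control P w \<bullet> (?S *v ?i)" by (rule innov_cov_symmetric[OF assms])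
    also have "\<dots> = best_control P w \<bullet> y" by (simp only: S)
    finally show ?thesis .
  qed
  then show ?thesis by (metis vector_eq_rdot)
qed

text \<open>This is \<open>\<Gamma>\<close> for the gain of \<open>P\<close>. Since the transposed
  gain yields the optimal control, its transpose is the optimally controlled dynamics of the dual
  problem.\<close>

definition closed_loop :: "real^'d^'d \<Rightarrow> real^'d^'d" where
  "closed_loop P = A ** (mat 1 - gain_of C R P ** C)"

lemma closed_loop_transpose:
  assumes "psd P"
  shows "transpose (closed_loop P) *v v
    = transpose A *v v - transpose C *v best_control P (transpose A *v v)"
proof -
  have "transpose (mat 1 - X) = mat 1 - transpose X" for X :: "real^'d^'d"
    by (simp add: transpose_def vec_eq_iff mat_def)
  then have "transpose (closed_loop P) *v v
      = (mat 1 - transpose C ** transpose (gain_of C R P)) *v (transpose A *v v)"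
    unfolding closed_loop_def by (simp only: matrix_transpose_mul matrix_vector_mul_assoc[symmetric])
  also have "\<dots> = transpose A *v v - transpose C *v (transpose (gain_of C R P) *v (transpose A *v v))"
    by (simp only: matrix_vector_mult_diff_rdistrib matrix_vector_mul_lid matrix_vector_mul_assoc[symmetric])
  finally show ?thesis by (simp only: gain_transpose[OF assms])
qed

text \<open>A Lyapunov equation along the closed loop: the value at \<open>v\<close> is the value
  one step later plus the costs of control and noise.\<close>

lemma quad_fixpoint:
  assumes "psd P" "riccati A C Q R P = P"
  shows "quad P v = quad P (transpose (closed_loop P) *v v)
    + quad R (best_control P (transpose A *v v)) + quad Q v"
  using quad_riccati[OF assms(1), of v]
  by (simp only: assms(2) dual_cost_def closed_loop_transpose[OF assms(1)])

text \<open>\<open>Rev (- \<i> *s v)\<close> is the imaginary part of \<open>v\<close>. Splitting is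
  needed because the Riccati estimates concern real vectors.\<close>

lemma complex_eigenvector_parts:
  fixes M :: "real^'e^'e"
  assumes "cmat M *v v = z *s v"
  shows "M *v Rev v = Re z *\<^sub>R Rev v - Im z *\<^sub>R Rev (- \<i> *s v)"
    and "M *v Rev (- \<i> *s v) = Im z *\<^sub>R Rev v + Re z *\<^sub>R Rev (- \<i> *s v)"
proof -
  have "M *v Rev w = Rev (cmat M *v w)" for w
    by (simp add: Rev_def vec_eq_iff matrix_vector_mult_def)
  then show "M *v Rev v = Re z *\<^sub>R Rev v - Im z *\<^sub>R Rev (- \<i> *s v)"
    and "M *v Rev (- \<i> *s v) = Im z *\<^sub>R Rev v + Re z *\<^sub>R Rev (- \<i> *s v)"
    by (simp_all only: assms vec.scale) (simp_all add: Rev_def vec_eq_iff)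
qed

lemma complex_eigenvector_of_parts:
  fixes M :: "real^'e^'e"
  assumes "M *v Rev v = Re z *\<^sub>R Rev v - Im z *\<^sub>R Rev (- \<i> *s v)"
    and "M *v Rev (- \<i> *s v) = Im z *\<^sub>R Rev v + Re z *\<^sub>R Rev (- \<i> *s v)"
  shows "cmat M *v v = z *s v"
proof -
  have eq: "w = cvec (Rev w) + \<i> *s cvec (Rev (- \<i> *s w))" for w :: "complex^'e"
    by (simp add: vec_eq_iff cvec_def Rev_def complex_eq_iff)
  have "cmat M *v v = cvec (M *v Rev v) + \<i> *s cvec (M *v Rev (- \<i> *s v))"
    using arg_cong[OF eq[of v], of "(*v) (cmat M)"] by (simp only: vec.add vec.scale cmat_mult_cvec)
  also have "\<dots> = z *s v"
    unfolding assms by (simp add: vec_eq_iff cvec_def Rev_def complex_eq_iff)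
  finally show ?thesis .
qed

text \<open>At an eigenvector of the transpose with eigenvalue of modulus at least one, the fixed point
  equation forces the optimal control to vanish, so the eigenvalue is one of the stable matrix \<open>A\<close>.\<close>

lemma closed_loop_stable:
  assumes "psd P" "riccati A C Q R P = P"
  shows "stable_matrix (closed_loop P)"
proof -
  let ?G = "transpose (closed_loop P)"
  have "cmod z < 1" if z: "z \<in># eigvals ?G" for z
  proof (rule ccontr)
    assume "\<not> cmod z < 1"
    then have z1: "1 \<le> (Re z)\<^sup>2 + (Im z)\<^sup>2" by (simp add: cmod_def)
    obtain v where v: "v \<noteq> 0" "cmat ?G *v v = z *s v"
      using z unfolding in_eigvals_iff by (elim exE conjE)
    let ?a = "Rev v" and ?b = "Rev (- \<i> *s v)"
    note parts = complex_eigenvector_parts[OF v(2)]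
    let ?u = "\<lambda>x. best_control P (transpose A *v x)"
    let ?h = "quad P ?a + quad P ?b"
    have sP: "x \<bullet> (P *v y) = y \<bullet> (P *v x)" for x y using assms(1) unfolding psd_iff by blast
    \<comment> \<open>On real and imaginary part the eigenvalue acts as a rotation with scaling, so
      \<open>?h\<close> is multiplied by the squared modulus of \<open>z\<close>.\<close>
    have "quad P (x *\<^sub>R p - y *\<^sub>R q) + quad P (y *\<^sub>R p + x *\<^sub>R q) = (x\<^sup>2 + y\<^sup>2) * (quad P p + quad P q)" for x y p q
      unfolding quad_def
      by (simp add: matrix_vector_right_distrib matrix_vector_mult_diff_distrib matrix_vector_mult_scaleR
          inner_add_left inner_diff_left inner_add_right inner_diff_right sP[of q p] power2_eq_square algebra_simps)
    then have "quad P (?G *v ?a) + quad P (?G *v ?b) = ((Re z)\<^sup>2 + (Im z)\<^sup>2) * ?h"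
      by (simp only: parts)
    moreover have "?h \<le> ((Re z)\<^sup>2 + (Im z)\<^sup>2) * ?h"
    proof -
      have "0 \<le> ?h" using assms(1) unfolding psd_iff by (intro add_nonneg_nonneg) blast+
      then show ?thesis using z1 mult_right_mono[of 1 _ ?h] by simp
    qed
    \<comment> \<open>Adding the Lyapunov equations for both parts leaves no room for positive
      control costs, as \<open>?h\<close> does not shrink.\<close>
    ultimately have "quad R (?u ?a) + quad R (?u ?b) \<le> 0"
      using quad_fixpoint[OF assms, of ?a] quad_fixpoint[OF assms, of ?b]
        quad_Q_nonneg[of ?a] quad_Q_nonneg[of ?b] by linarith
    then have "quad R (?u ?a) = 0" "quad R (?u ?b) = 0"
      using quad_R_nonneg[of "?u ?a"] quad_R_nonneg[of "?u ?b"] by linarith+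
    then have u: "?u ?a = 0" "?u ?b = 0" using quad_R_pos by (metis less_irrefl)+
    have eq: "?G *v ?a = transpose A *v ?a" "?G *v ?b = transpose A *v ?b"
      unfolding closed_loop_transpose[OF assms(1)] u by (simp_all only: matrix_vector_mult_0_right diff_zero)
    have "cmat (transpose A) *v v = z *s v"
      by (rule complex_eigenvector_of_parts) (simp_all only: eq[symmetric] parts)
    with v(1) have "z \<in># eigvals (transpose A)" unfolding in_eigvals_iff by (intro exI conjI)
    then have "cmod z < 1" using stable by (simp add: eigvals_transpose stable_matrix_def)
    with \<open>\<not> cmod z < 1\<close> show False by simp
  qed
  then show ?thesis by (simp add: stable_matrix_def eigvals_transpose)
qed

lemma riccati_converges:
  assumes P: "psd P" "riccati A C Q R P = P" "(\<lambda>k. (riccati A C Q R ^^ k) 0) \<longlonglongrightarrow> P"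
    and P0: "psd P0"
  shows "(\<lambda>k. (riccati A C Q R ^^ k) P0) \<longlonglongrightarrow> P"
proof (rule tendsto_of_quad)
  let ?X = "\<lambda>k. (riccati A C Q R ^^ k) P0" and ?G = "(*v) (transpose (closed_loop P))"
  show "transpose (?X k) = ?X k" for k by (rule conjunct1[OF psd_iterates[OF P0, unfolded psd_def]])
  show "transpose P = P" by (rule conjunct1[OF P(1)[unfolded psd_def]])
  fix v
  obtain c \<rho> where c: "0 \<le> c" "0 \<le> \<rho>" "\<rho> < 1" "\<And>k x. norm ((?G ^^ k) x) \<le> c * \<rho> ^ k * norm x"
    by (rule stable_pow_bound[of "transpose (closed_loop P)"])
      (simp only: stable_transpose closed_loop_stable[OF P(1,2)], rule that)
  obtain q where q: "0 \<le> q" "\<And>v. \<bar>quad P0 v\<bar> \<le> q * (norm v)\<^sup>2"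
    by (rule quad_bound[of P0]) (rule that)
  have step: "quad (?X k) v - quad P v \<le> quad P0 ((?G ^^ k) v) - quad P ((?G ^^ k) v)" for k v
  proof (induction k arbitrary: v)
    case (Suc k)
    \<comment> \<open>The optimal control of the fixed point is inserted for \<open>?X k\<close>;
      its cost and that of \<open>Q\<close> cancel against \<open>quad_fixpoint\<close>.\<close>
    let ?u = "best_control P (transpose A *v v)"
    have "quad (?X (Suc k)) v \<le> dual_cost C R (?X k) (transpose A *v v) ?u + quad Q v"
      using quad_riccati_le[OF psd_iterates[OF P0]] by (simp del: transpose_matrix_vector)
    also have "\<dots> = quad (?X k) (?G v) + quad R ?u + quad Q v"
      by (simp only: dual_cost_def closed_loop_transpose[OF P(1)])
    finally have "quad (?X (Suc k)) v - quad P v \<le> quad (?X k) (?G v) - quad P (?G v)"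
      using quad_fixpoint[OF P(1,2), of v] by linarith
    also have "\<dots> \<le> quad P0 ((?G ^^ k) (?G v)) - quad P ((?G ^^ k) (?G v))" by (rule Suc.IH)
    finally show ?case by (simp only: funpow_Suc_right o_apply)
  qed simp
  have upper: "quad (?X k) v \<le> quad P v + q * (c * norm v)\<^sup>2 * (\<rho>\<^sup>2) ^ k" for k
  proof -
    have "0 \<le> quad P ((?G ^^ k) v)" using P(1) unfolding psd_iff by blast
    then have "quad (?X k) v - quad P v \<le> quad P0 ((?G ^^ k) v)" using step[of k v] by linarith
    also have "\<dots> \<le> q * (norm ((?G ^^ k) v))\<^sup>2" using q(2)[of "(?G ^^ k) v"] by linarith
    also have "\<dots> \<le> q * (c * \<rho> ^ k * norm v)\<^sup>2"
      by (intro mult_left_mono power_mono c q) simp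
    also have "\<dots> = q * (c * norm v)\<^sup>2 * (\<rho>\<^sup>2) ^ k"
      by (simp add: power_mult_distrib power_mult[symmetric] mult_ac)
    finally show ?thesis by linarith
  qed
  have lower: "quad ((riccati A C Q R ^^ k) 0) v \<le> quad (?X k) v" for k
    using P0 by (intro iterates_mono psd_0 P0) (simp add: quad_0 psd_iff)
  have "\<rho>\<^sup>2 < 1" using c by (simp add: power_less_one_iff abs_square_less_1)
  then have "(\<lambda>k. quad P v + q * (c * norm v)\<^sup>2 * (\<rho>\<^sup>2) ^ k) \<longlonglongrightarrow> quad P v + q * (c * norm v)\<^sup>2 * 0"
    by (intro tendsto_add tendsto_mult tendsto_const LIMSEQ_power_zero) simp
  then have "(\<lambda>k. quad P v + q * (c * norm v)\<^sup>2 * (\<rho>\<^sup>2) ^ k) \<longlonglongrightarrow> quad P v" by simp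
  with tendsto_quad[OF P(3)] show "(\<lambda>k. quad (?X k) v) \<longlonglongrightarrow> quad P v"
    by (rule tendsto_sandwich[rotated 2]) (simp_all only: lower upper eventually_True)
qed

lemma psd_pred_cov: "psd S \<Longrightarrow> psd (pred_cov A Q S)"
proof -
  assume S: "psd S"
  have bil: "x \<bullet> (pred_cov A Q S *v y) = (transpose A *v x) \<bullet> (S *v (transpose A *v y)) + x \<bullet> (Q *v y)" for x y
    unfolding pred_cov_def
    by (simp only: matrix_vector_mult_add_rdistrib matrix_vector_mul_assoc[symmetric] inner_add_right inner_transpose)
  have "x \<bullet> (pred_cov A Q S *v y) = y \<bullet> (pred_cov A Q S *v x)" for x y
    using S Q unfolding bil psd_iff by metis
  moreover have "0 \<le> quad (pred_cov A Q S) v" for v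
    using S Q unfolding quad_def bil psd_iff by (metis add_nonneg_nonneg)
  ultimately show ?thesis unfolding psd_iff by (intro conjI allI)
qed

lemma kalman_gain_converges:
  assumes "psd S0"
  obtains P where "kalman_gain A C Q R S0 \<longlonglongrightarrow> gain_of C R P" "stable_matrix (closed_loop P)"
proof -
  obtain P where P: "psd P" "riccati A C Q R P = P" "(\<lambda>k. (riccati A C Q R ^^ k) 0) \<longlonglongrightarrow> P"
    by (rule riccati_fixpoint)
  let ?P0 = "pred_cov A Q S0"
  \<comment> \<open>\<open>S0\<close> is a filtered covariance, so the recursion for predictive ones
    starts one prediction later.\<close>
  have "pred_cov A Q (filt_cov A C Q R S0 k) = (riccati A C Q R ^^ k) ?P0" for k
    by (induction k) (simp_all add: Let_def riccati_def)
  then have "(\<lambda>k. gain_of C R (pred_cov A Q (filt_cov A C Q R S0 k))) \<longlonglongrightarrow> gain_of C R P"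
    using tendsto_gain[OF riccati_converges[OF P psd_pred_cov[OF assms]] P(1)] by simp
  then have "(\<lambda>t. kalman_gain A C Q R S0 (Suc t)) \<longlonglongrightarrow> gain_of C R P"
    by (simp add: kalman_gain_def)
  then have "kalman_gain A C Q R S0 \<longlonglongrightarrow> gain_of C R P" by (rule LIMSEQ_imp_Suc)
  then show ?thesis using closed_loop_stable[OF P(1,2)] by (rule that)
qed

end

section \<open>Low-rank tensors\<close>

definition tucker_rep :: "nat \<Rightarrow> ('p \<Rightarrow> 'q \<Rightarrow> 's \<Rightarrow> real) \<Rightarrow> bool" where
  "tucker_rep r T \<longleftrightarrow> (\<exists>g u v w. \<forall>p q s.
     T p q s = (\<Sum>i<r. \<Sum>j<r. \<Sum>k<r. g i j k * u p i * v q j * w s k))"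

definition cp_rep :: "nat \<Rightarrow> ('p \<Rightarrow> 'q \<Rightarrow> 's \<Rightarrow> real) \<Rightarrow> bool" where
  "cp_rep r T \<longleftrightarrow> (\<exists>u v w. \<forall>p q s. T p q s = (\<Sum>i<r. u p i * v q i * w s i))"

lemma sum_lessThan_add: "(\<Sum>i<a + b. f i) = (\<Sum>i<a. f i) + (\<Sum>i<b. f (a + i))"
  for f :: "nat \<Rightarrow> 'a::comm_monoid_add"
  by (induction b) (simp_all add: add.assoc)

lemma cp_rep_add:
  assumes "cp_rep a S" "cp_rep b T"
  shows "cp_rep (a + b) (\<lambda>p q s. S p q s + T p q s)"
proof -
  obtain u v w where S: "\<forall>p q s. S p q s = (\<Sum>i<a. u p i * v q i * w s i)"
    using assms(1) unfolding cp_rep_def by (elim exE)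
  obtain u' v' w' where T: "\<forall>p q s. T p q s = (\<Sum>i<b. u' p i * v' q i * w' s i)"
    using assms(2) unfolding cp_rep_def by (elim exE)
  let ?j = "\<lambda>f f' x i. if i < a then f x i else f' x (i - a)"
  have "S p q s + T p q s = (\<Sum>i<a + b. ?j u u' p i * ?j v v' q i * ?j w w' s i)" for p q s
    by (simp add: S T sum_lessThan_add)
  then show ?thesis unfolding cp_rep_def
    by (intro exI[of _ "?j u u'"] exI[of _ "?j v v'"] exI[of _ "?j w w'"] allI)
qed

lemma tucker_rep_add:
  assumes "tucker_rep a S" "tucker_rep b T"
  shows "tucker_rep (a + b) (\<lambda>p q s. S p q s + T p q s)"
proof -
  obtain g u v w where S: "\<forall>p q s. S p q s = (\<Sum>i<a. \<Sum>j<a. \<Sum>k<a. g i j k * u p i * v q j * w s k)"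
    using assms(1) unfolding tucker_rep_def by (elim exE)
  obtain g' u' v' w' where T: "\<forall>p q s. T p q s = (\<Sum>i<b. \<Sum>j<b. \<Sum>k<b. g' i j k * u' p i * v' q j * w' s k)"
    using assms(2) unfolding tucker_rep_def by (elim exE)
  let ?j = "\<lambda>f f' x i. if i < a then f x i else f' x (i - a)"
  \<comment> \<open>A block-diagonal core: entries that mix indices of the two summands are
    0.\<close>
  let ?g = "\<lambda>i j k. if i < a then (if j < a \<and> k < a then g i j k else 0)
    else (if j < a \<or> k < a then 0 else g' (i - a) (j - a) (k - a))"
  have "S p q s + T p q s
    = (\<Sum>i<a + b. \<Sum>j<a + b. \<Sum>k<a + b. ?g i j k * ?j u u' p i * ?j v v' q j * ?j w w' s k)" for p q s
    by (simp add: S T sum_lessThan_add)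
  then show ?thesis unfolding tucker_rep_def
    by (intro exI[of _ ?g] exI[of _ "?j u u'"] exI[of _ "?j v v'"] exI[of _ "?j w w'"] allI)
qed

lemma cp_rep_sum:
  "(\<And>i. i < N \<Longrightarrow> cp_rep (r i) (T i)) \<Longrightarrow> cp_rep (\<Sum>i<N. r i) (\<lambda>p q s. \<Sum>i<N. T i p q s)"
  for N :: nat
proof (induction N)
  case 0
  show ?case by (simp add: cp_rep_def)
next
  case (Suc N)
  then show ?case by (simp add: cp_rep_add)
qed

lemma tucker_rep_sum:
  "(\<And>i. i < N \<Longrightarrow> tucker_rep (r i) (T i)) \<Longrightarrow> tucker_rep (\<Sum>i<N. r i) (\<lambda>p q s. \<Sum>i<N. T i p q s)"
  for N :: nat
proof (induction N)
  case 0
  show ?case by (simp add: tucker_rep_def)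
next
  case (Suc N)
  then show ?case by (simp add: tucker_rep_add)
qed

text \<open>Three real products suffice for the real part of a complex rank-one term, as in
  Karatsuba's multiplication.\<close>

lemma cp_rep_pair: "cp_rep 3 (\<lambda>p q s. Re (U p * V q * W s))"
proof -
  let ?u = "\<lambda>p i. if i = 0 then Re (U p) else if i = 1 then Im (U p) else Re (U p) + Im (U p)"
  let ?v = "\<lambda>q i. if i = 0 then Re (V q) else if i = 1 then Im (V q) else Re (V q) + Im (V q)"
  let ?w = "\<lambda>s i. if i = 0 then Re (W s) + Im (W s) else if i = 1 then Im (W s) - Re (W s) else - Im (W s)"
  have "Re (U p * V q * W s) = (\<Sum>i<3::nat. ?u p i * ?v q i * ?w s i)" for p q s
    by (simp add: numeral_3_eq_3 algebra_simps)
  then show ?thesis unfolding cp_rep_def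
    by (intro exI[of _ ?u] exI[of _ ?v] exI[of _ ?w] allI)
qed

text \<open>An index 1 selects an imaginary part. The real part of a product of three factors keeps
  the terms with none or two imaginary factors, the latter with sign -1; \<open>?g\<close> encodes
  this.\<close>

lemma tucker_rep_pair: "tucker_rep 2 (\<lambda>p q s. Re (U p * V q * W s))"
proof -
  let ?c = "\<lambda>(F :: _ \<Rightarrow> complex) x (i::nat). if i = 0 then Re (F x) else Im (F x)"
  let ?g = "\<lambda>i j k :: nat. if i + j + k = 0 then 1 else if i + j + k = 2 then -1 else 0"
  have "Re (U p * V q * W s) = (\<Sum>i<2. \<Sum>j<2. \<Sum>k<2. ?g i j k * ?c U p i * ?c V q j * ?c W s k)" for p q s
    by (simp add: numeral_2_eq_2 algebra_simps)
  then show ?thesis unfolding tucker_rep_def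
    by (intro exI[of _ ?g] exI[of _ "?c U"] exI[of _ "?c V"] exI[of _ "?c W"] allI)
qed

text \<open>\<open>V\<close> stays complex, as the coefficients at a real eigenvector need not be
  real; with the other two factors real, only its real part survives.\<close>

lemma real_rank_one:
  assumes "\<And>p. Im (U p) = 0" "\<And>s. Im (W s) = 0"
  shows "cp_rep 1 (\<lambda>p q s. Re (U p * V q * W s))" and "tucker_rep 1 (\<lambda>p q s. Re (U p * V q * W s))"
proof -
  let ?c = "\<lambda>(F :: _ \<Rightarrow> complex) x (i::nat). Re (F x)"
  have eq: "Re (U p * V q * W s) = Re (U p) * Re (V q) * Re (W s)" for p q s
    by (simp add: assms)
  show "cp_rep 1 (\<lambda>p q s. Re (U p * V q * W s))" unfolding cp_rep_def eq
    by (intro exI[of _ "?c U"] exI[of _ "?c V"] exI[of _ "?c W"]) simp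
  show "tucker_rep 1 (\<lambda>p q s. Re (U p * V q * W s))" unfolding tucker_rep_def eq
    by (intro exI[of _ "\<lambda>_ _ _. 1"] exI[of _ "?c U"] exI[of _ "?c V"] exI[of _ "?c W"]) simp
qed

lemma complex_rank_one:
  assumes "c \<Longrightarrow> \<forall>p. Im (U p) = 0" "c \<Longrightarrow> \<forall>s. Im (W s) = 0"
  shows "cp_rep (if c then 1 else 3) (\<lambda>p q s. Re (U p * V q * W s))"
    and "tucker_rep (if c then 1 else 2) (\<lambda>p q s. Re (U p * V q * W s))"
proof -
  show "cp_rep (if c then 1 else 3) (\<lambda>p q s. Re (U p * V q * W s))"
    using real_rank_one(1)[of U W V] cp_rep_pair[of U V W] assms by (cases c) (simp_all del: times_complex.sel)
  show "tucker_rep (if c then 1 else 2) (\<lambda>p q s. Re (U p * V q * W s))"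
    using real_rank_one(2)[of U W V] tucker_rep_pair[of U V W] assms by (cases c) (simp_all del: times_complex.sel)
qed

lemma sum_conj_types:
  "(\<Sum>i<length l. if Im (fst (l ! i)) = 0 then a else b)
    = a * length (filter (\<lambda>z. Im z = 0) (map fst l)) + b * length (filter (\<lambda>z. Im z \<noteq> 0) (map fst l))"
  for a b :: nat
proof -
  have "(\<Sum>i<length l. if Im (fst (l ! i)) = 0 then a else b) = (\<Sum>x\<leftarrow>l. if Im (fst x) = 0 then a else b)"
    by (simp add: sum_list_sum_nth atLeast0LessThan)
  also have "\<dots> = a * length (filter (\<lambda>z. Im z = 0) (map fst l)) + b * length (filter (\<lambda>z. Im z \<noteq> 0) (map fst l))"
    by (induction l) simp_all
  finally show ?thesis .
qed

text \<open>A single tensor carries both representations, so Tucker and CP models share one error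
  estimate.\<close>

lemma low_rank_response:
  fixes M :: "real^'d^'d" and C :: "real^'d^'n" and B :: "real^'m^'d"
  assumes "\<delta> > 0"
  shows "\<exists>T. tucker_rep (num_real_eigvals M + 2 * num_conj_pairs M) T \<and>
    cp_rep (num_real_eigvals M + 3 * num_conj_pairs M) T \<and>
    (\<forall>k<L. \<forall>p q. \<bar>(C ** mat_pow M k ** B) $ p $ q - T p q (Suc k)\<bar> \<le> (if M = 0 then 0 else \<delta>))"
proof -
  obtain M' l where l: "eigpairs M' l" "gspan l = UNIV"
    and counts: "length (filter (\<lambda>z. Im z = 0) (map fst l)) = num_real_eigvals M"
      "length (filter (\<lambda>z. Im z \<noteq> 0) (map fst l)) = num_conj_pairs M"
    and near: "\<And>k p q. k < L \<Longrightarrow> \<bar>(C ** mat_pow M k ** B) $ p $ q - (C ** mat_pow M' k ** B) $ p $ q\<bar> \<le> \<delta>"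
    and zero: "M = 0 \<Longrightarrow> M' = 0"
    by (rule semisimple_approximation[OF assms, where M = M and C = C and B = B and L = L]) (rule that)
  obtain \<zeta> where \<zeta>: "\<And>k p q. (C ** mat_pow M' k ** B) $ p $ q
      = (\<Sum>i<length l. Re ((cmat C *v snd (l ! i)) $ p * \<zeta> q i * fst (l ! i) ^ k))"
    by (rule eigpairs_response_expansion[OF l, of C B]) (rule that)
  \<comment> \<open>Lags start at 1, so lag \<open>s\<close> carries the power
    \<open>s - 1\<close>.\<close>
  define T where "T p q s = (C ** mat_pow M' (s - 1) ** B) $ p $ q" for p q s
  have T: "T = (\<lambda>p q s. \<Sum>i<length l. Re ((cmat C *v snd (l ! i)) $ p * \<zeta> q i * fst (l ! i) ^ (s - 1)))"
    by (intro ext) (simp only: T_def \<zeta>)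
  have real: "Im ((cmat C *v snd (l ! i)) $ p) = 0" "Im (fst (l ! i) ^ s) = 0"
    if "i < length l" "Im (fst (l ! i)) = 0" for i p s
  proof -
    have "(fst (l ! i), snd (l ! i)) \<in> set l" using that(1) by simp
    then have "cnjv (snd (l ! i)) = snd (l ! i)" using l(1) that(2) unfolding eigpairs_def by blast
    then have "cnjv (cmat C *v snd (l ! i)) = cmat C *v snd (l ! i)" by (simp only: cnjv_cmat)
    then have "cnj ((cmat C *v snd (l ! i)) $ p) = (cmat C *v snd (l ! i)) $ p"
      by (metis cnjv_def vec_lambda_beta)
    then show "Im ((cmat C *v snd (l ! i)) $ p) = 0" by (simp add: complex_eq_iff)
    have "fst (l ! i) = of_real (Re (fst (l ! i)))" using that(2) by (simp add: complex_eq_iff)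
    then have "fst (l ! i) ^ s = of_real (Re (fst (l ! i)) ^ s)" by (metis of_real_power)
    then show "Im (fst (l ! i) ^ s) = 0" by simp
  qed
  show ?thesis
  proof (intro exI[of _ T] conjI allI impI)
    have rep: "tucker_rep (if Im (fst (l ! i)) = 0 then 1 else 2)
        (\<lambda>p q s. Re ((cmat C *v snd (l ! i)) $ p * \<zeta> q i * fst (l ! i) ^ (s - 1)))" if i: "i < length l" for i
      by (rule complex_rank_one(2)[of "Im (fst (l ! i)) = 0" "\<lambda>p. (cmat C *v snd (l ! i)) $ p"
          "\<lambda>s. fst (l ! i) ^ (s - 1)" "\<lambda>q. \<zeta> q i"]) (simp_all only: real[OF i] simp_thms)
    have "tucker_rep (\<Sum>i<length l. if Im (fst (l ! i)) = 0 then 1 else 2) T"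
      unfolding T by (rule tucker_rep_sum) (rule rep)
    then show "tucker_rep (num_real_eigvals M + 2 * num_conj_pairs M) T"
      by (simp only: sum_conj_types counts mult_1)
    have rep: "cp_rep (if Im (fst (l ! i)) = 0 then 1 else 3)
        (\<lambda>p q s. Re ((cmat C *v snd (l ! i)) $ p * \<zeta> q i * fst (l ! i) ^ (s - 1)))" if i: "i < length l" for i
      by (rule complex_rank_one(1)[of "Im (fst (l ! i)) = 0" "\<lambda>p. (cmat C *v snd (l ! i)) $ p"
          "\<lambda>s. fst (l ! i) ^ (s - 1)" "\<lambda>q. \<zeta> q i"]) (simp_all only: real[OF i] simp_thms)
    have "cp_rep (\<Sum>i<length l. if Im (fst (l ! i)) = 0 then 1 else 3) T"
      unfolding T by (rule cp_rep_sum) (rule rep)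
    then show "cp_rep (num_real_eigvals M + 3 * num_conj_pairs M) T"
      by (simp only: sum_conj_types counts mult_1)
    show "\<bar>(C ** mat_pow M k ** B) $ p $ q - T p q (Suc k)\<bar> \<le> (if M = 0 then 0 else \<delta>)" if k: "k < L" for k p q
      using near[OF k, of p q] zero by (simp add: T_def)
  qed
qed

section \<open>Approximation error\<close>

text \<open>One pathwise estimate serves both halves of \<open>salt_rate\<close>. In
  \<open>ennreal\<close> it makes sense for every path, including those with infinite weighted sum,
  and it can be integrated term by term.\<close>

lemma salt_rate_of_weights:
  assumes err: "\<And>L t y. ennreal (infnorm (yhat y t - salt_pred_mean r L (S L) y t))
      \<le> (\<Sum>k. ennreal (\<omega> L k * norm (y (t - int (k + 1)))))"
    and \<omega>: "\<And>L k. 0 \<le> \<omega> L k" "\<And>L. summable (\<omega> L)" "\<And>L. suminf (\<omega> L) \<le> c * \<rho> ^ L"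
  shows "salt_rate yhat r S \<rho>"
proof -
  have sum: "(\<Sum>k. ennreal (\<omega> L k) * ennreal B) \<le> ennreal (c * max B 0 * \<rho> ^ L)" for L B
  proof -
    \<comment> \<open>A negative bound acts as 0, and \<open>max B 0\<close> keeps the constants
      nonnegative.\<close>
    have "ennreal B = ennreal (max B 0)" by (cases "0 \<le> B") (simp_all add: ennreal_neg)
    then have "(\<Sum>k. ennreal (\<omega> L k) * ennreal B) = (\<Sum>k. ennreal (\<omega> L k)) * ennreal (max B 0)"
      by (simp only: ennreal_suminf_multc)
    also have "\<dots> = ennreal (suminf (\<omega> L)) * ennreal (max B 0)"
      by (simp only: suminf_ennreal2[OF \<omega>(1,2)])
    also have "\<dots> = ennreal (suminf (\<omega> L) * max B 0)"
      using \<omega> by (simp add: ennreal_mult suminf_nonneg)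
    also have "\<dots> \<le> ennreal (c * \<rho> ^ L * max B 0)"
      by (intro ennreal_leI mult_right_mono \<omega>) simp
    finally show ?thesis by (simp only: mult_ac)
  qed
  have "infnorm (yhat y t - salt_pred_mean r L (S L) y t) \<le> c * max B 0 * \<rho> ^ L"
    if "\<forall>s<t. norm (y s) \<le> B" for B L t y
  proof -
    have "ennreal (infnorm (yhat y t - salt_pred_mean r L (S L) y t))
        \<le> (\<Sum>k. ennreal (\<omega> L k * norm (y (t - int (k + 1)))))" by (rule err)
    also have "\<dots> \<le> (\<Sum>k. ennreal (\<omega> L k) * ennreal B)"
      using that by (intro suminf_le summableI) (simp add: ennreal_mult'[symmetric] \<omega> ennreal_leI mult_left_mono)
    also have "\<dots> \<le> ennreal (c * max B 0 * \<rho> ^ L)" by (rule sum)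
    finally have le: "ennreal (infnorm (yhat y t - salt_pred_mean r L (S L) y t)) \<le> ennreal (c * max B 0 * \<rho> ^ L)" .
    have "0 \<le> c * \<rho> ^ L" using \<omega>(3)[of L] suminf_nonneg[OF \<omega>(2) \<omega>(1), of L] by linarith
    then have "0 \<le> c * \<rho> ^ L * max B 0" by (rule mult_nonneg_nonneg) simp
    with le show ?thesis by (simp add: ennreal_le_iff mult_ac)
  qed
  moreover have "(\<integral>\<^sup>+ y. ennreal (infnorm (yhat y t - salt_pred_mean r L (S L) y t)) \<partial>P) \<le> ennreal (c * max B 0 * \<rho> ^ L)"
    if P: "sets P = sets (PiM UNIV (\<lambda>_::int. borel))"
      and B: "\<forall>s<t. (\<integral>\<^sup>+ y. ennreal (norm (y s)) \<partial>P) \<le> ennreal B" for B L t P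
  proof -
    have meas [measurable]: "(\<lambda>y. y s) \<in> borel_measurable P" for s
      unfolding measurable_cong_sets[OF P refl] by (rule measurable_component_singleton) simp
    have "(\<integral>\<^sup>+ y. ennreal (infnorm (yhat y t - salt_pred_mean r L (S L) y t)) \<partial>P)
        \<le> (\<integral>\<^sup>+ y. (\<Sum>k. ennreal (\<omega> L k) * ennreal (norm (y (t - int (k + 1))))) \<partial>P)"
      using err by (intro nn_integral_mono) (simp add: ennreal_mult' \<omega>)
    also have "\<dots> = (\<Sum>k. ennreal (\<omega> L k) * (\<integral>\<^sup>+ y. ennreal (norm (y (t - int (k + 1)))) \<partial>P))"
      by (subst nn_integral_suminf) (simp_all add: nn_integral_cmult)
    also have "\<dots> \<le> (\<Sum>k. ennreal (\<omega> L k) * ennreal B)"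
      using B by (intro suminf_le summableI mult_left_mono) simp_all
    also have "\<dots> \<le> ennreal (c * max B 0 * \<rho> ^ L)" by (rule sum)
    finally show ?thesis .
  qed
  ultimately show ?thesis unfolding salt_rate_def by blast
qed

text \<open>The terms of the series for exp(1 / \<sigma>) tend to 0 and so are bounded.\<close>

lemma inverse_fact_bound:
  assumes "0 < (\<sigma>::real)" obtains c where "0 \<le> c" "\<And>L. 1 / fact L \<le> c * \<sigma> ^ L"
proof -
  have "(\<lambda>L. (1 / \<sigma>) ^ L / fact L) \<longlonglongrightarrow> 0"
    using summable_LIMSEQ_zero[OF summable_exp[of "1 / \<sigma>"]] by (simp add: field_simps)
  then have "Bseq (\<lambda>L. (1 / \<sigma>) ^ L / fact L)" using convergent_imp_Bseq convergentI by blast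
  then obtain c where c: "0 < c" "\<And>L. norm ((1 / \<sigma>) ^ L / fact L) \<le> c" by (rule BseqE) blast
  have "1 / fact L \<le> c * \<sigma> ^ L" for L
    using c(2)[of L] assms by (simp add: power_divide field_simps)
  then show ?thesis using that[of c] c(1) by simp
qed


lemma norm_suminf_le_ennreal:
  fixes h :: "nat \<Rightarrow> 'a::banach"
  assumes "\<And>k. norm (h k) \<le> e k" "summable e"
  shows "ennreal (norm (suminf h)) \<le> (\<Sum>k. ennreal (e k))"
proof -
  have e: "0 \<le> e k" for k using assms(1)[of k] norm_ge_zero[of "h k"] by linarith
  have "norm (suminf h) \<le> suminf e" by (rule norm_suminf_le[OF assms])
  then have "ennreal (norm (suminf h)) \<le> ennreal (suminf e)" by (rule ennreal_leI)
  also have "\<dots> = (\<Sum>k. ennreal (e k))" by (rule suminf_ennreal2[OF e assms(2), symmetric])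
  finally show ?thesis .
qed

section \<open>Error of the truncated and fitted predictor\<close>

context
  fixes A :: "real^'d^'d" and b :: "real^'d" and C :: "real^'d^'n" and d :: "real^'n" and K :: "real^'n^'d"
    and M :: "real^'d^'d"
  assumes M: "M = A ** (mat 1 - K ** C)"
begin

definition response :: "nat \<Rightarrow> real^'n^'n" where
  "response k = C ** mat_pow M k ** (A ** K)"

text \<open>The constant part keeps its whole series: a bias costs no rank, so only observation
  terms are truncated.\<close>

definition steady_bias :: "real^'n" where
  "steady_bias = C *v (\<Sum>k. mat_pow M k *v (b - (A ** K) *v d)) + d"

text \<open>Up to lag \<open>L\<close> the fitting error, with one factor \<open>CARD('n)\<close>
  for the sum over outputs that bounds the norm and one for the sum over inputs; beyond it the size
  of the full response.\<close>

definition error_weight :: "real \<Rightarrow> real \<Rightarrow> (nat \<Rightarrow> real) \<Rightarrow> nat \<Rightarrow> nat \<Rightarrow> real" where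
  "error_weight E \<sigma> \<delta> L k = (if k < L then real CARD('n) * real CARD('n) * \<delta> L else E * \<sigma> ^ k)"

lemma response_bound:
  assumes "0 \<le> c" "\<And>k x. norm (mat_pow M k *v x) \<le> c * \<sigma> ^ k * norm x" "0 \<le> \<sigma>"
  obtains E where "0 < E" "\<And>k x. norm (response k *v x) \<le> E * \<sigma> ^ k * norm x"
proof -
  let ?a = "onorm ((*v) C)" and ?b = "onorm ((*v) (A ** K))"
  have a: "0 \<le> ?a" "norm (C *v x) \<le> ?a * norm x" for x
    by (rule onorm_pos_le onorm, rule matrix_vector_mul_bounded_linear)+
  have b: "0 \<le> ?b" "norm ((A ** K) *v x) \<le> ?b * norm x" for x
    by (rule onorm_pos_le onorm, rule matrix_vector_mul_bounded_linear)+
  \<comment> \<open>The summand 1 makes the constant positive, so that it can later be divided out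
    of a convergent series.\<close>
  have "norm (response k *v x) \<le> (?a * c * ?b + 1) * \<sigma> ^ k * norm x" for k x
  proof -
    have "response k *v x = C *v (mat_pow M k *v ((A ** K) *v x))"
      unfolding response_def by (simp only: matrix_vector_mul_assoc[symmetric])
    then have "norm (response k *v x) \<le> ?a * norm (mat_pow M k *v ((A ** K) *v x))"
      using a(2) by simp
    also have "\<dots> \<le> ?a * (c * \<sigma> ^ k * norm ((A ** K) *v x))" by (intro mult_left_mono assms a)
    also have "\<dots> \<le> ?a * (c * \<sigma> ^ k * (?b * norm x))"
      using assms(1,3) by (intro mult_left_mono a b mult_nonneg_nonneg) simp_all
    also have "\<dots> \<le> (?a * c * ?b + 1) * \<sigma> ^ k * norm x"
      using assms(3) by (simp add: algebra_simps)
    finally show ?thesis .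
  qed
  moreover have "0 < ?a * c * ?b + 1" using a(1) b(1) assms(1) by (simp add: add_nonneg_pos)
  ultimately show ?thesis by (rule that[rotated])
qed

text \<open>A right side equal to \<open>top\<close> bounds anything. Otherwise its finiteness
  forces the series of the predictive mean to converge, so that \<open>suminf\<close> is a genuine
  sum and may be split and subtracted.\<close>

lemma prediction_error:
  fixes T :: "'n \<Rightarrow> 'n \<Rightarrow> nat \<Rightarrow> real"
  assumes c: "0 \<le> c" "\<And>k x. norm (mat_pow M k *v x) \<le> c * \<sigma> ^ k * norm x" and \<sigma>: "0 \<le> \<sigma>" "\<sigma> < 1"
    and E: "0 < E" "\<And>k x. norm (response k *v x) \<le> E * \<sigma> ^ k * norm x"
    and T: "\<And>k p q. k < L \<Longrightarrow> \<bar>response k $ p $ q - T p q (Suc k)\<bar> \<le> \<delta> L" and \<delta>: "0 \<le> \<delta> L"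
    and S: "\<And>p q s. salt_tensor r S p q s = T p q s" "bias S = steady_bias"
  shows "ennreal (infnorm (lds_pred_mean A b C d K y t - salt_pred_mean r L S y t))
    \<le> (\<Sum>k. ennreal (error_weight E \<sigma> \<delta> L k * norm (y (t - int (k + 1)))))"
proof (cases "(\<Sum>k. ennreal (error_weight E \<sigma> \<delta> L k * norm (y (t - int (k + 1))))) = top")
  case False
  let ?B = "A ** K" and ?w = "error_weight E \<sigma> \<delta> L"
  define x where "x k = y (t - int (k + 1))" for k
  define f where "f k = mat_pow M k *v (?B *v x k)" for k
  define g where "g k = mat_pow M k *v (b - ?B *v d)" for k
  define h where "h k = (if k < L then (\<chi> p. \<Sum>q\<in>UNIV. T p q (Suc k) * x k $ q) else 0)" for k
  have sw: "summable (\<lambda>k. ?w k * norm (x k))"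
  proof (rule summable_suminf_not_top)
    show "0 \<le> ?w k * norm (x k)" for k using E(1) \<sigma>(1) \<delta> by (simp add: error_weight_def)
    show "(\<Sum>k. ennreal (?w k * norm (x k))) \<noteq> top" using False by (simp only: x_def not_False_eq_True)
  qed
  \<comment> \<open>From \<open>L\<close> on the weight is \<open>E * \<sigma> ^ k\<close>, and
    finitely many terms do not affect summability.\<close>
  have "summable (\<lambda>k. E * (\<sigma> ^ k * norm (x k)))"
  proof (rule summable_comparison_test'[OF sw])
    show "norm (E * (\<sigma> ^ k * norm (x k))) \<le> ?w k * norm (x k)" if "L \<le> k" for k
      using that E(1) \<sigma>(1) by (simp add: error_weight_def abs_mult)
  qed
  then have sx: "summable (\<lambda>k. \<sigma> ^ k * norm (x k))" by (rule summable_mult_D) (use E(1) in simp)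
  let ?k = "onorm ((*v) ?B)"
  have B: "0 \<le> ?k" "norm (?B *v z) \<le> ?k * norm z" for z
    by (rule onorm_pos_le onorm, rule matrix_vector_mul_bounded_linear)+
  have sf: "summable f"
  proof (rule summable_comparison_test'[OF summable_mult[OF sx, of "c * ?k"]])
    show "norm (f k) \<le> c * ?k * (\<sigma> ^ k * norm (x k))" for k
    proof -
      have "norm (f k) \<le> c * \<sigma> ^ k * norm (?B *v x k)" unfolding f_def by (rule c(2))
      also have "\<dots> \<le> c * \<sigma> ^ k * (?k * norm (x k))"
        using c(1) \<sigma>(1) by (intro mult_left_mono B) simp
      finally show ?thesis by (simp add: mult_ac)
    qed
  qed
  have sg: "summable g"
  proof (rule summable_comparison_test'[OF summable_mult[OF summable_geometric, of \<sigma> "c * norm (b - ?B *v d)"]])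
    show "norm \<sigma> < 1" using \<sigma> by simp
    show "norm (g k) \<le> c * norm (b - ?B *v d) * \<sigma> ^ k" for k
      using c(2)[of k "b - ?B *v d"] by (simp add: g_def mult_ac)
  qed
  have "(\<lambda>k. mat_pow M k *v (b - ?B *v d)) = g" by (simp only: g_def fun_eq_iff simp_thms)
  then have bias_g: "steady_bias = C *v suminf g + d" unfolding steady_bias_def by (simp only:)
  have C: "bounded_linear ((*v) C)" by (rule matrix_vector_mul_bounded_linear)
  have "lds_pred_mean A b C d K y t = C *v (\<Sum>k. f k + g k) + d"
    unfolding lds_pred_mean_def M[symmetric] x_def[symmetric]
    by (simp add: f_def g_def matrix_vector_right_distrib[symmetric] add_diff_eq)
  also have "\<dots> = C *v suminf f + steady_bias"
    unfolding suminf_add[OF sf sg, symmetric] matrix_vector_right_distrib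
    by (simp only: bias_g add.assoc)
  finally have lds: "lds_pred_mean A b C d K y t = C *v suminf f + steady_bias" .
  have Cf: "C *v f k = response k *v x k" for k
    unfolding response_def f_def by (simp only: matrix_vector_mul_assoc[symmetric])
  have "(\<lambda>k. response k *v x k) sums (C *v suminf f)"
    unfolding Cf[symmetric] by (rule bounded_linear.sums[OF C summable_sums[OF sf]])
  moreover have "h sums (\<Sum>k<L. h k)" by (rule sums_finite) (simp_all add: h_def)
  ultimately have "(\<lambda>k. response k *v x k - h k) sums (C *v suminf f - (\<Sum>k<L. h k))"
    by (rule sums_diff)
  moreover have "salt_pred_mean r L S y t = (\<Sum>k<L. h k) + steady_bias"
  proof -
    have "(\<chi> p. \<Sum>q\<in>UNIV. \<Sum>s = 1..L. T p q s * y (t - int s) $ q) = (\<Sum>k<L. h k)"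
    proof (simp only: vec_eq_iff vec_lambda_beta sum_component, intro allI)
      fix p
      have "(\<Sum>s = 1..L. T p q s * y (t - int s) $ q) = (\<Sum>k<L. T p q (Suc k) * x k $ q)" for q
        by (rule sum.reindex_bij_witness[of _ Suc "\<lambda>s. s - 1"]) (auto simp: x_def)
      then have "(\<Sum>q\<in>UNIV. \<Sum>s = 1..L. T p q s * y (t - int s) $ q) = (\<Sum>k<L. \<Sum>q\<in>UNIV. T p q (Suc k) * x k $ q)"
        by (simp only:) (rule sum.swap)
      also have "\<dots> = (\<Sum>k<L. h k $ p)" by (rule sum.cong) (simp_all add: h_def)
      finally show "(\<Sum>q\<in>UNIV. \<Sum>s = 1..L. T p q s * y (t - int s) $ q) = (\<Sum>k<L. h k $ p)" .
    qed
    then show ?thesis by (simp add: salt_pred_mean_def S)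
  qed
  ultimately have "(\<lambda>k. response k *v x k - h k) sums (lds_pred_mean A b C d K y t - salt_pred_mean r L S y t)"
    by (simp add: lds)
  then have diff: "lds_pred_mean A b C d K y t - salt_pred_mean r L S y t = (\<Sum>k. response k *v x k - h k)"
    by (rule sums_unique)
  have bound: "norm (response k *v x k - h k) \<le> ?w k * norm (x k)" for k
  proof (cases "k < L")
    case True
    have "norm (response k *v x k - h k) \<le> (\<Sum>p\<in>UNIV. \<bar>(response k *v x k - h k) $ p\<bar>)"
      by (rule norm_le_l1_cart)
    also have "\<dots> \<le> (\<Sum>p\<in>(UNIV :: 'n set). \<Sum>q\<in>(UNIV :: 'n set). \<delta> L * norm (x k))"
    proof (rule sum_mono)
      fix p
      have "(response k *v x k - h k) $ p = (\<Sum>q\<in>UNIV. (response k $ p $ q - T p q (Suc k)) * x k $ q)"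
        using True by (simp add: h_def matrix_vector_mult_def left_diff_distrib sum_subtractf)
      also have "\<bar>\<dots>\<bar> \<le> (\<Sum>q\<in>UNIV. \<bar>(response k $ p $ q - T p q (Suc k)) * x k $ q\<bar>)"
        by (rule sum_abs)
      also have "\<dots> \<le> (\<Sum>q\<in>(UNIV :: 'n set). \<delta> L * norm (x k))"
        unfolding abs_mult by (intro sum_mono mult_mono T True \<delta> component_le_norm_cart abs_ge_zero)
      finally show "\<bar>(response k *v x k - h k) $ p\<bar> \<le> (\<Sum>q\<in>(UNIV :: 'n set). \<delta> L * norm (x k))" .
    qed
    finally show ?thesis using True by (simp add: error_weight_def mult_ac)
  next
    case False
    then show ?thesis using E(2)[of k "x k"] by (simp add: h_def error_weight_def)
  qed
  have "ennreal (infnorm (lds_pred_mean A b C d K y t - salt_pred_mean r L S y t))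
      \<le> ennreal (norm (\<Sum>k. response k *v x k - h k))"
    unfolding diff by (intro ennreal_leI infnorm_le_norm)
  also have "\<dots> \<le> (\<Sum>k. ennreal (?w k * norm (x k)))"
    by (rule norm_suminf_le_ennreal[OF bound sw])
  finally show ?thesis by (simp only: x_def)
qed simp

lemma error_weight_sum:
  assumes "0 < E" "0 \<le> \<sigma>" "\<sigma> < 1" "0 \<le> \<delta> L"
  shows "summable (error_weight E \<sigma> \<delta> L)"
    and "suminf (error_weight E \<sigma> \<delta> L) = real CARD('n) * real CARD('n) * (real L * \<delta> L) + E / (1 - \<sigma>) * \<sigma> ^ L"
    and "0 \<le> error_weight E \<sigma> \<delta> L k"
proof -
  have geo: "(\<lambda>k. E * \<sigma> ^ L * \<sigma> ^ k) sums (E * \<sigma> ^ L * (1 / (1 - \<sigma>)))"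
    using assms by (intro sums_mult geometric_sums) simp
  have "(\<lambda>k. error_weight E \<sigma> \<delta> L (k + L)) = (\<lambda>k. E * \<sigma> ^ L * \<sigma> ^ k)"
    by (simp add: error_weight_def fun_eq_iff power_add mult_ac)
  with geo have "(\<lambda>k. error_weight E \<sigma> \<delta> L (k + L)) sums (E * \<sigma> ^ L * (1 / (1 - \<sigma>)))" by simp
  then have s: "error_weight E \<sigma> \<delta> L sums (E * \<sigma> ^ L * (1 / (1 - \<sigma>)) + (\<Sum>k<L. error_weight E \<sigma> \<delta> L k))"
    by (rule sums_iff_shift[THEN iffD1])
  then show "summable (error_weight E \<sigma> \<delta> L)" by (rule sums_summable)
  have "(\<Sum>k<L. error_weight E \<sigma> \<delta> L k) = real CARD('n) * real CARD('n) * (real L * \<delta> L)"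
    by (simp add: error_weight_def)
  with sums_unique[OF s] show "suminf (error_weight E \<sigma> \<delta> L)
      = real CARD('n) * real CARD('n) * (real L * \<delta> L) + E / (1 - \<sigma>) * \<sigma> ^ L"
    by (simp add: mult_ac)
  show "0 \<le> error_weight E \<sigma> \<delta> L k" using assms by (simp add: error_weight_def)
qed

section \<open>Fitted models and their rates\<close>

text \<open>Each lag is fitted up to the same tolerance, so \<open>L\<close> lags contribute at most \<open>1 / fact L\<close>. This is
  \<open>O(\<rho>^L)\<close> for every positive \<open>\<rho>\<close>, so one family of models serves all rates at once. For \<open>M = 0\<close> the
  rate is \<open>0^L\<close> and the fit must be exact.\<close>

definition fit_tolerance :: "nat \<Rightarrow> real" where
  "fit_tolerance L = (if M = 0 then 0 else 1 / (real (Suc L) * fact L))"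

definition fitted :: "nat \<Rightarrow> (nat \<Rightarrow> 'n salt) \<Rightarrow> bool" where
  "fitted r S \<longleftrightarrow> (\<forall>L. bias (S L) = steady_bias \<and>
     (\<forall>k<L. \<forall>p q. \<bar>response k $ p $ q - salt_tensor r (S L) p q (Suc k)\<bar> \<le> fit_tolerance L))"

text \<open>\<open>\<sigma>\<close> is a growth rate of the powers and lies below 1 so that the tail
  is summable; \<open>\<rho>\<close> is the claimed rate and may be larger. The alternative
  \<open>M = 0 \<or> 0 < \<sigma>\<close> reflects the tolerance, which decays faster than every
  positive geometric rate and is 0 for \<open>M = 0\<close>.\<close>

lemma salt_rate_of_fitted:
  assumes fit: "fitted r S"
    and c: "0 \<le> c" "\<And>k x. norm (mat_pow M k *v x) \<le> c * \<sigma> ^ k * norm x"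
    and \<sigma>: "0 \<le> \<sigma>" "\<sigma> < 1" "M = 0 \<or> 0 < \<sigma>" and \<rho>: "\<sigma> \<le> \<rho>"
  shows "salt_rate (lds_pred_mean A b C d K) r S \<rho>"
proof -
  have \<delta>: "0 \<le> fit_tolerance L" for L by (simp add: fit_tolerance_def)
  obtain E where E: "0 < E" "\<And>k x. norm (response k *v x) \<le> E * \<sigma> ^ k * norm x"
    by (rule response_bound[OF c \<sigma>(1)]) (rule that)
  obtain a where a: "0 \<le> a" "\<And>L. real L * fit_tolerance L \<le> a * \<sigma> ^ L"
  proof (cases "M = 0")
    case True
    then have "fit_tolerance L = 0" for L unfolding fit_tolerance_def by simp
    then have "real L * fit_tolerance L \<le> 0 * \<sigma> ^ L" for L by (simp only: mult_zero_left mult_zero_right order_refl)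
    then show ?thesis by (rule that[OF order_refl])
  next
    case False
    then have "0 < \<sigma>" using \<sigma>(3) by simp
    then obtain a where a: "0 \<le> a" "\<And>L. 1 / fact L \<le> a * \<sigma> ^ L"
      by (rule inverse_fact_bound) (rule that)
    have "real L * fit_tolerance L \<le> a * \<sigma> ^ L" for L
    proof -
      have "real L * fit_tolerance L = real L / real (Suc L) * (1 / fact L)"
        unfolding fit_tolerance_def using False by simp
      also have "\<dots> \<le> 1 * (1 / fact L)" by (intro mult_right_mono) simp_all
      also have "\<dots> \<le> a * \<sigma> ^ L" using a(2)[of L] by simp
      finally show ?thesis .
    qed
    then show ?thesis by (rule that[OF a(1)])
  qed
  let ?c = "real CARD('n) * real CARD('n) * a + E / (1 - \<sigma>)"
  show ?thesis
  proof (rule salt_rate_of_weights)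
    show "ennreal (infnorm (lds_pred_mean A b C d K y t - salt_pred_mean r L (S L) y t))
        \<le> (\<Sum>k. ennreal (error_weight E \<sigma> fit_tolerance L k * norm (y (t - int (k + 1)))))" for L t y
      using fit unfolding fitted_def
      by (intro prediction_error[OF c \<sigma>(1,2) E, where T = "salt_tensor r (S L)"] \<delta>) simp_all
    show "0 \<le> error_weight E \<sigma> fit_tolerance L k" for L k
      by (rule error_weight_sum[OF E(1) \<sigma>(1,2) \<delta>])
    show "summable (error_weight E \<sigma> fit_tolerance L)" for L
      by (rule error_weight_sum[OF E(1) \<sigma>(1,2) \<delta>])
    show "suminf (error_weight E \<sigma> fit_tolerance L) \<le> ?c * \<rho> ^ L" for L
    proof -
      have "suminf (error_weight E \<sigma> fit_tolerance L)
          \<le> real CARD('n) * real CARD('n) * (a * \<sigma> ^ L) + E / (1 - \<sigma>) * \<sigma> ^ L"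
        unfolding error_weight_sum(2)[OF E(1) \<sigma>(1,2) \<delta>]
        by (intro add_right_mono mult_left_mono a) simp
      also have "\<dots> = ?c * \<sigma> ^ L" by (simp add: algebra_simps)
      also have "\<dots> \<le> ?c * \<rho> ^ L"
        using a(1) E(1) \<sigma> \<rho> by (intro mult_left_mono power_mono) simp_all
      finally show ?thesis .
    qed
  qed
qed

lemma fitted_models:
  assumes "n = num_real_eigvals M" "m = num_conj_pairs M"
  shows "\<exists>S. fitted (n + 2 * m) S" "\<exists>S. (\<forall>L. is_cp (n + 3 * m) (S L)) \<and> fitted (n + 3 * m) S"
proof -
  have T: "\<exists>T. tucker_rep (n + 2 * m) T \<and> cp_rep (n + 3 * m) T \<and>
      (\<forall>k<L. \<forall>p q. \<bar>response k $ p $ q - T p q (Suc k)\<bar> \<le> fit_tolerance L)" for L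
  proof -
    have pos: "0 < 1 / (real (Suc L) * fact L)" by simp
    show ?thesis unfolding response_def fit_tolerance_def assms by (rule low_rank_response[OF pos])
  qed
  have "\<exists>S :: 'n salt. bias S = steady_bias \<and>
     (\<forall>k<L. \<forall>p q. \<bar>response k $ p $ q - salt_tensor (n + 2 * m) S p q (Suc k)\<bar> \<le> fit_tolerance L)" for L
  proof -
    obtain T where T: "tucker_rep (n + 2 * m) T"
      "\<forall>k<L. \<forall>p q. \<bar>response k $ p $ q - T p q (Suc k)\<bar> \<le> fit_tolerance L"
      using T[of L] by (elim exE conjE)
    obtain g u v w where rep: "\<forall>p q s. T p q s
        = (\<Sum>i<n + 2 * m. \<Sum>j<n + 2 * m. \<Sum>k<n + 2 * m. g i j k * u p i * v q j * w s k)"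
      using T(1) unfolding tucker_rep_def by (elim exE)
    let ?S = "\<lparr>core = g, facU = u, facV = v, facW = w, bias = steady_bias\<rparr>"
    have "salt_tensor (n + 2 * m) ?S p q s = T p q s" for p q s
      by (simp add: salt_tensor_def rep)
    then show ?thesis using T(2) by (intro exI[of _ ?S]) simp
  qed
  then show "\<exists>S. fitted (n + 2 * m) S" unfolding fitted_def by (rule choice[OF allI])
  have "\<exists>S :: 'n salt. is_cp (n + 3 * m) S \<and> bias S = steady_bias \<and>
     (\<forall>k<L. \<forall>p q. \<bar>response k $ p $ q - salt_tensor (n + 3 * m) S p q (Suc k)\<bar> \<le> fit_tolerance L)" for L
  proof -
    obtain T where T: "cp_rep (n + 3 * m) T"
      "\<forall>k<L. \<forall>p q. \<bar>response k $ p $ q - T p q (Suc k)\<bar> \<le> fit_tolerance L"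
      using T[of L] by (elim exE conjE)
    obtain u v w where rep: "\<forall>p q s. T p q s = (\<Sum>i<n + 3 * m. u p i * v q i * w s i)"
      using T(1) unfolding cp_rep_def by (elim exE)
    let ?g = "\<lambda>i j k. if i = j \<and> j = k then 1 else 0 :: real"
    let ?S = "\<lparr>core = ?g, facU = u, facV = v, facW = w, bias = steady_bias\<rparr>"
    have inner: "(\<Sum>j<r. \<Sum>k<r. ?g i j k * u p i * v q j * w s k) = u p i * v q i * w s i" if "i < r" for i p q s r
    proof -
      have "?g i j k * u p i * v q j * w s k
          = (if k = i then (if j = i then u p i * v q i * w s i else 0) else 0)" for j k
        by auto
      then show ?thesis using that by (simp only:) simp
    qed
    have "salt_tensor (n + 3 * m) ?S p q s = T p q s" for p q s
      unfolding salt_tensor_def rep[rule_format] by (simp only: salt.simps) (intro sum.cong refl inner, simp)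
    then show ?thesis using T(2) by (intro exI[of _ ?S]) (simp add: is_cp_def)
  qed
  then have "\<exists>S. \<forall>L. is_cp (n + 3 * m) (S L) \<and> bias (S L :: 'n salt) = steady_bias \<and>
     (\<forall>k<L. \<forall>p q. \<bar>response k $ p $ q - salt_tensor (n + 3 * m) (S L) p q (Suc k)\<bar> \<le> fit_tolerance L)"
    by (rule choice[OF allI])
  then show "\<exists>S. (\<forall>L. is_cp (n + 3 * m) (S L)) \<and> fitted (n + 3 * m) S"
    unfolding fitted_def by blast
qed

lemma fitted_rates:
  assumes "lambda_max M < 1" "fitted r S"
  shows "dominant_semisimple M \<longrightarrow> salt_rate (lds_pred_mean A b C d K) r S (lambda_max M)"
    and "\<forall>\<rho>>lambda_max M. salt_rate (lds_pred_mean A b C d K) r S \<rho>"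
proof -
  show "dominant_semisimple M \<longrightarrow> salt_rate (lds_pred_mean A b C d K) r S (lambda_max M)"
  proof
    assume ss: "dominant_semisimple M"
    obtain c where c: "0 \<le> c" "\<And>k x. norm (mat_pow M k *v x) \<le> c * lambda_max M ^ k * norm x"
      by (rule mat_pow_bound_semisimple[OF ss]) (rule that)
    \<comment> \<open>The growth bound with \<open>k = 1\<close> reads \<open>M *v x = 0\<close>: a
      nonzero nilpotent \<open>M\<close> is not \<open>dominant_semisimple\<close>, so the rate 0 ^
      L meets only exact fits.\<close>
    have "M = 0" if "lambda_max M = 0"
    proof -
      have "M *v x = 0" for x using c(2)[of 1 x] that by simp
      then show ?thesis by (simp add: matrix_eq)
    qed
    then have "M = 0 \<or> 0 < lambda_max M" using lambda_max_nonneg[of M] by linarith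
    then show "salt_rate (lds_pred_mean A b C d K) r S (lambda_max M)"
      by (intro salt_rate_of_fitted[OF assms(2) c lambda_max_nonneg assms(1)]) simp_all
  qed
  show "\<forall>\<rho>>lambda_max M. salt_rate (lds_pred_mean A b C d K) r S \<rho>"
  proof (intro allI impI)
    fix \<rho> assume "lambda_max M < \<rho>"
    \<comment> \<open>The claimed rate may be 1 or more, while the tail needs a rate below 1; hence
      the minimum.\<close>
    then obtain \<sigma> where \<sigma>: "lambda_max M < \<sigma>" "\<sigma> < min \<rho> 1"
      using dense[of "lambda_max M" "min \<rho> 1"] assms(1) by auto
    obtain c where c: "0 \<le> c" "\<And>k x. norm (mat_pow M k *v x) \<le> c * \<sigma> ^ k * norm x"
      by (rule mat_pow_bound[OF \<sigma>(1)]) (rule that)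
    show "salt_rate (lds_pred_mean A b C d K) r S \<rho>"
      using \<sigma> lambda_max_nonneg[of M] by (intro salt_rate_of_fitted[OF assms(2) c]) simp_all
  qed
qed

end

theorem proposition1:
  fixes A Q S0 \<Gamma> :: "real^'d^'d" and b :: "real^'d" and C :: "real^'d^'n" and d :: "real^'n"
    and R :: "real^'n^'n" and K :: "real^'n^'d" and n m :: nat
  assumes "stable_matrix A" and "psd Q" and "pos_def R" and "psd S0"
    and "K = lim (kalman_gain A C Q R S0)"
    and "\<Gamma> = A ** (mat 1 - K ** C)"
    and "n = num_real_eigvals \<Gamma>" and "m = num_conj_pairs \<Gamma>"
  shows "convergent (kalman_gain A C Q R S0) \<and>
     lambda_max \<Gamma> < 1 \<and>
     (\<exists>S. (dominant_semisimple \<Gamma> \<longrightarrow>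
              salt_rate (lds_pred_mean A b C d K) (n + 2 * m) S (lambda_max \<Gamma>)) \<and>
          (\<forall>\<rho>>lambda_max \<Gamma>. salt_rate (lds_pred_mean A b C d K) (n + 2 * m) S \<rho>)) \<and>
     (\<exists>S. (\<forall>L. is_cp (n + 3 * m) (S L)) \<and>
          (dominant_semisimple \<Gamma> \<longrightarrow>
              salt_rate (lds_pred_mean A b C d K) (n + 3 * m) S (lambda_max \<Gamma>)) \<and>
          (\<forall>\<rho>>lambda_max \<Gamma>. salt_rate (lds_pred_mean A b C d K) (n + 3 * m) S \<rho>))"
proof -
  obtain P where P: "kalman_gain A C Q R S0 \<longlonglongrightarrow> gain_of C R P" "stable_matrix (closed_loop A C R P)"
    by (rule kalman_gain_converges[OF assms(1-4)])
  have "K = gain_of C R P" using P(1) assms(5) limI by metis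
  then have \<Gamma>: "\<Gamma> = closed_loop A C R P" by (simp only: assms(6) closed_loop_def[OF assms(1-3)])
  have less: "lambda_max \<Gamma> < 1" using P(2) unfolding \<Gamma> stable_iff_lambda_max .
  obtain S where "fitted A b C d K \<Gamma> (n + 2 * m) S"
    using fitted_models(1)[OF assms(6-8), where b = b and d = d] by (elim exE)
  moreover obtain S' where "\<forall>L. is_cp (n + 3 * m) (S' L)" "fitted A b C d K \<Gamma> (n + 3 * m) S'"
    using fitted_models(2)[OF assms(6-8), where b = b and d = d] by (elim exE conjE)
  ultimately show ?thesis
    using fitted_rates[OF assms(6) less] less convergentI[OF P(1)] by (intro conjI exI) simp_all
qed

end
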